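(* Fix $2\leq n,m<\infty$. For $\pi\in\mathrm{Rep}\,\mathcal{O}_m$, let $\pi':=F_{n,m}(\pi)\in\mathrm{Rep}\,\mathcal{O}_n$. Then the following hold: (i) $\pi$ is a factor representation if and only if $\pi'$ is a factor representation. (ii) $\pi$ is of type X if and only if $\pi'$ is of type X, where the type means the type of a representation with respect to the Murray–von Neumann–Connes classification and X is I, II$_1$, II$_\infty$ or III$_\lambda$. (iii) $\pi$ is irreducible if and only if $\pi'$ is irreducible. (iv) $\pi=\bigoplus_{\lambda}\pi_{\lambda}$ if and only if $\pi'=\bigoplus_{\lambda}\pi'_{\lambda}$, where $\pi_\lambda\in\mathrm{Rep}\,\mathcal{O}_m$ and $\pi'_\lambda:=F_{n,m}(\pi_\lambda)$.
   Context: For $2\leq n<\infty$, the Cuntz algebra $\mathcal{O}_n$ is the universal unital $C^*$-algebra generated by $s_1,\dots,s_n$ (Cuntz generators) subject to $s_i^*s_j=\delta_{ij}I$ and $\sum_{i=1}^n s_is_i^*=I$. $\mathcal{O}_\infty$ is the universal unital $C^*$-algebra generated by $t_1,t_2,\dots$ subject to $t_i^*t_j=\delta_{ij}I$ and $\sum_{j=1}^k t_jt_j^*\le I$ for all $k\ge1$. Let $s_1,\dots,s_n$, $r_1,\dots,r_m$ and $t_1,t_2,\dots$ be the Cuntz generators of $\mathcal{O}_n,\mathcal{O}_m$ and $\mathcal{O}_\infty$. $\mathrm{Rep}\,\mathcal{O}_n$ is the category of all nondegenerate $*$-representations of $\mathcal{O}_n$ on Hilbert spaces (unital representations together with the zero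 representation), with intertwiners as morphisms. The functor $F_{n,m}:\mathrm{Rep}\,\mathcal{O}_m\to\mathrm{Rep}\,\mathcal{O}_n$ is defined as follows. Let $f_{m,\infty}:\mathcal{O}_\infty\to\mathcal{O}_m$ be the unital $*$-embedding with $f_{m,\infty}(t_{(m-1)k+i})=r_m^k r_i$ for $k\ge0$, $i=1,\dots,m-1$ (with $r_m^0=I$). For $(\mathcal{H},\pi)\in\mathrm{Rep}\,\mathcal{O}_m$ with $\pi\neq0$, $F_{n,m}(\pi)=\pi'$ is the representation of $\mathcal{O}_n$ on the same space $\mathcal{H}$ determined by $\pi'(s_i)=\pi(f_{m,\infty}(t_i))$ for $i=1,\dots,n-1$ and $$\pi'(s_n)=\pi(r_m)\Big\{I-\sum_{j=1}^\infty\pi(f_{m,\infty}(t_jt_j^* ))\Big\}+\sum_{j=1}^\infty\pi(f_{m,\infty}(t_{j+n-1}t_j^* )),$$ the infinite sums converging in the strong operator topology; $F_{n,m}(0)=0$, and $F_{n,m}(T)=T$ on intertwiners $T$. A representation is a factor representation, resp. of a given type, if the von Neumann algebra generated by its image is a factor, resp. of that type. *)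

theory Defs
  imports "HOL-Analysis.Analysis" "HOL-Algebra.Module" "HOL-Algebra.Subrings"
begin

section \<open>Complex Hilbert spaces\<close>

text \<open>Inner products are linear in the first argument.\<close>

class chilbert_space = banach +
  fixes scaleC :: "complex \<Rightarrow> 'a \<Rightarrow> 'a" (infixr \<open>*\<^sub>C\<close> 75)
    and cinner :: "'a \<Rightarrow> 'a \<Rightarrow> complex"
  assumes scaleC_add_right: "c *\<^sub>C (x + y) = c *\<^sub>C x + c *\<^sub>C y"
    and scaleC_add_left: "(c + d) *\<^sub>C x = c *\<^sub>C x + d *\<^sub>C x"
    and scaleC_scaleC: "c *\<^sub>C d *\<^sub>C x = (c * d) *\<^sub>C x"
    and scaleR_scaleC: "r *\<^sub>R x = complex_of_real r *\<^sub>C x"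
    and cinner_add_left: "cinner (x + y) z = cinner x z + cinner y z"
    and cinner_scaleC_left: "cinner (c *\<^sub>C x) y = c * cinner x y"
    and cinner_commute: "cinner x y = cnj (cinner y x)"
    and norm_eq_sqrt_cinner: "norm x = sqrt (Re (cinner x x))"

instantiation complex :: chilbert_space
begin

definition scaleC_complex :: "complex \<Rightarrow> complex \<Rightarrow> complex" where
  "scaleC_complex c x = c * x"

definition cinner_complex :: "complex \<Rightarrow> complex \<Rightarrow> complex" where
  "cinner_complex x y = x * cnj y"

instance
  by standard
    (auto simp: scaleC_complex_def cinner_complex_def algebra_simps scaleR_conv_of_real
      cmod_def power2_eq_square)

end

lemma scaleC_one [simp]: "1 *\<^sub>C x = (x::'a::chilbert_space)"
  using scaleR_scaleC[of 1 x] by simp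

lemma scaleC_minus1: "(-1) *\<^sub>C x = - (x::'a::chilbert_space)"
  using scaleR_scaleC[of "-1" x] by simp

lemma cinner_minus_left: "cinner (- x) (y::'a::chilbert_space) = - cinner x y"
  using cinner_scaleC_left[of "-1" x y] by (simp add: scaleC_minus1)

lemma cinner_diff_left: "cinner (x - y) (z::'a::chilbert_space) = cinner x z - cinner y z"
  using cinner_add_left[of x "- y" z] by (simp add: cinner_minus_left)

lemma cinner_add_right: "cinner x (y + z) = cinner x y + cinner x (z::'a::chilbert_space)"
  by (metis cinner_commute cinner_add_left complex_cnj_add)

lemma cinner_diff_right: "cinner x (y - z) = cinner x y - cinner x (z::'a::chilbert_space)"
  by (metis cinner_commute cinner_diff_left complex_cnj_diff)

lemma cinner_scaleC_right: "cinner x (c *\<^sub>C y) = cnj c * cinner x (y::'a::chilbert_space)"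
  by (metis cinner_commute cinner_scaleC_left complex_cnj_mult)

lemma cinner_self: "cinner x x = complex_of_real ((norm (x::'a::chilbert_space))\<^sup>2)"
proof -
  have "Im (cinner x x) = 0"
    using cinner_commute[of x x] by (metis cnj.simps(2) neg_equal_zero)
  moreover have "Re (cinner x x) \<ge> 0"
    using norm_eq_sqrt_cinner[of x] norm_ge_zero[of x] by (metis real_sqrt_ge_0_iff)
  ultimately show ?thesis
    by (simp add: norm_eq_sqrt_cinner complex_eq_iff)
qed

lemma norm_scaleC: "norm (c *\<^sub>C x) = cmod c * norm (x::'a::chilbert_space)"
proof -
  have "complex_of_real ((norm (c *\<^sub>C x))\<^sup>2) = complex_of_real ((cmod c * norm x)\<^sup>2)"
    by (simp only: cinner_self[symmetric] cinner_scaleC_left cinner_scaleC_right)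
      (simp add: cinner_self complex_norm_square[simplified] power_mult_distrib ac_simps)
  then have "(norm (c *\<^sub>C x))\<^sup>2 = (cmod c * norm x)\<^sup>2"
    using of_real_eq_iff by blast
  then show ?thesis
    by simp
qed

lemma norm_cinner_le: "norm (cinner x y) \<le> norm x * norm (y::'a::chilbert_space)"
proof (cases "y = 0")
  case True
  then show ?thesis
    using cinner_scaleC_right[of x 0 y] cinner_diff_right[of x y y] by simp
next
  case False
  define a where "a = cinner x y / complex_of_real ((norm y)\<^sup>2)"
  have ay: "a * complex_of_real ((norm y)\<^sup>2) = cinner x y"
    using False by (simp add: a_def)
  have "cinner (x - a *\<^sub>C y) (x - a *\<^sub>C y) = cinner x x - a * cnj (cinner x y)"
    using ay
    by (simp add: cinner_diff_left cinner_diff_right cinner_scaleC_left cinner_scaleC_right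
        cinner_commute[of y x] cinner_self[of y] algebra_simps)
  moreover have "a * cnj (cinner x y) = complex_of_real ((cmod (cinner x y))\<^sup>2 / (norm y)\<^sup>2)"
    by (simp add: a_def complex_norm_square[simplified])
  ultimately have "(norm (x - a *\<^sub>C y))\<^sup>2 = (norm x)\<^sup>2 - (cmod (cinner x y))\<^sup>2 / (norm y)\<^sup>2"
    by (simp only: cinner_self) (metis of_real_diff of_real_eq_iff)
  then have "(cmod (cinner x y))\<^sup>2 / (norm y)\<^sup>2 \<le> (norm x)\<^sup>2"
    using zero_le_power2[of "norm (x - a *\<^sub>C y)"] by linarith
  then have "(cmod (cinner x y))\<^sup>2 \<le> (norm x * norm y)\<^sup>2"
    using False by (simp add: field_simps power_mult_distrib)
  then show ?thesis
    by (simp add: power2_le_iff_abs_le)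
qed

text \<open>The Hilbert space direct sum of copies of \<open>'k\<close> indexed by \<open>'i\<close>.\<close>

definition square_summable :: "('i \<Rightarrow> 'k::real_normed_vector) \<Rightarrow> bool" where
  "square_summable f \<longleftrightarrow> (\<lambda>i. (norm (f i))\<^sup>2) summable_on UNIV"

lemma square_summableI:
  assumes "\<And>F. finite F \<Longrightarrow> L2_set (\<lambda>i. norm (f i)) F \<le> b"
  shows "square_summable f"
  unfolding square_summable_def
proof (rule nonneg_bdd_above_summable_on)
  have "(\<Sum>i\<in>F. (norm (f i))\<^sup>2) \<le> b\<^sup>2" if "finite F" for F
    using assms[OF that] unfolding L2_set_def by (metis real_sqrt_le_iff sqrt_le_D)
  then show "bdd_above (sum (\<lambda>i. (norm (f i))\<^sup>2) ` {F. F \<subseteq> UNIV \<and> finite F})"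
    by (intro bdd_aboveI2[where M = "b\<^sup>2"]) auto
qed auto

typedef (overloaded) ('i, 'k) l2sum = "{f :: 'i \<Rightarrow> 'k::chilbert_space. square_summable f}"
  by (rule exI[of _ "\<lambda>_. 0"]) (simp add: square_summable_def)

lemma l2sum_eqI: "(\<And>i. Rep_l2sum f i = Rep_l2sum g i) \<Longrightarrow> f = g"
  by (simp add: Rep_l2sum_inject[symmetric] fun_eq_iff)

lemma square_summable_Rep [simp]: "square_summable (Rep_l2sum f)"
  using Rep_l2sum by blast

lemma square_summable_add:
  assumes "square_summable f" "square_summable g"
  shows "square_summable (\<lambda>i. f i + g i)"
    and "sqrt (\<Sum>\<^sub>\<infinity>i. (norm (f i + g i))\<^sup>2)
          \<le> sqrt (\<Sum>\<^sub>\<infinity>i. (norm (f i))\<^sup>2) + sqrt (\<Sum>\<^sub>\<infinity>i. (norm (g i))\<^sup>2)" (is "_ \<le> ?b")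
proof -
  have *: "L2_set (\<lambda>i. norm (h i)) F \<le> sqrt (\<Sum>\<^sub>\<infinity>i. (norm (h i))\<^sup>2)"
    if "finite F" "square_summable h" for F and h :: "'a \<Rightarrow> 'b"
    unfolding L2_set_def
    by (intro real_sqrt_le_mono finite_sum_le_infsum) (use that in \<open>auto simp: square_summable_def\<close>)
  have le: "L2_set (\<lambda>i. norm (f i + g i)) F \<le> ?b" if "finite F" for F
  proof -
    have "L2_set (\<lambda>i. norm (f i + g i)) F \<le> L2_set (\<lambda>i. norm (f i) + norm (g i)) F"
      by (intro L2_set_mono) (auto intro: norm_triangle_ineq)
    also have "\<dots> \<le> L2_set (\<lambda>i. norm (f i)) F + L2_set (\<lambda>i. norm (g i)) F"
      by (rule L2_set_triangle_ineq)
    also have "\<dots> \<le> ?b"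
      using *[OF that assms(1)] *[OF that assms(2)] by simp
    finally show ?thesis .
  qed
  show summ: "square_summable (\<lambda>i. f i + g i)"
    by (rule square_summableI[OF le])
  have b: "0 \<le> ?b"
    using le[of "{}"] by simp
  have "(\<Sum>\<^sub>\<infinity>i. (norm (f i + g i))\<^sup>2) \<le> ?b\<^sup>2"
  proof (rule infsum_le_finite_sums)
    fix F :: "'a set" assume "finite F"
    from le[OF this] show "(\<Sum>i\<in>F. (norm (f i + g i))\<^sup>2) \<le> ?b\<^sup>2"
      unfolding L2_set_def by (rule sqrt_le_D)
  qed (use summ in \<open>simp add: square_summable_def\<close>)
  then show "sqrt (\<Sum>\<^sub>\<infinity>i. (norm (f i + g i))\<^sup>2) \<le> ?b"
    using b by (rule real_le_lsqrt[rotated -1])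
qed

lemma square_summable_scaleC:
  assumes "square_summable f"
  shows "square_summable (\<lambda>i. c *\<^sub>C (f i :: 'k::chilbert_space))"
  using assms unfolding square_summable_def norm_scaleC power_mult_distrib
  by (rule summable_on_cmult_right)

lemma square_summable_uminus:
  "square_summable f \<Longrightarrow> square_summable (\<lambda>i. - f i)"
  by (simp add: square_summable_def)

lemma square_summable_diff:
  "square_summable f \<Longrightarrow> square_summable g \<Longrightarrow> square_summable (\<lambda>i. f i - g i)"
  using square_summable_add(1)[OF _ square_summable_uminus] by fastforce

lemma summable_on_cinner:
  fixes f g :: "'i \<Rightarrow> 'k::chilbert_space"
  assumes "square_summable f" "square_summable g"
  shows "(\<lambda>i. cinner (f i) (g i)) summable_on UNIV"
proof (rule Infinite_Sum.abs_summable_summable, rule Infinite_Sum.abs_summable_on_comparison_test')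
  show "(\<lambda>i. (norm (f i))\<^sup>2 + (norm (g i))\<^sup>2) summable_on UNIV"
    using assms unfolding square_summable_def by (rule summable_on_add)
  show "norm (cinner (f i) (g i)) \<le> (norm (f i))\<^sup>2 + (norm (g i))\<^sup>2" for i
  proof -
    have "2 * (norm (f i) * norm (g i)) \<le> (norm (f i))\<^sup>2 + (norm (g i))\<^sup>2"
      using sum_squares_bound[of "norm (f i)" "norm (g i)"] by simp
    moreover have "0 \<le> norm (f i) * norm (g i)"
      by simp
    ultimately show ?thesis
      using norm_cinner_le[of "f i" "g i"] by linarith
  qed
qed

instantiation l2sum :: (type, chilbert_space) real_normed_vector
begin

definition zero_l2sum :: "('a, 'b) l2sum" where
  "0 = Abs_l2sum (\<lambda>_. 0)"

definition plus_l2sum :: "('a, 'b) l2sum \<Rightarrow> ('a, 'b) l2sum \<Rightarrow> ('a, 'b) l2sum" where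
  "f + g = Abs_l2sum (\<lambda>i. Rep_l2sum f i + Rep_l2sum g i)"

definition minus_l2sum :: "('a, 'b) l2sum \<Rightarrow> ('a, 'b) l2sum \<Rightarrow> ('a, 'b) l2sum" where
  "f - g = Abs_l2sum (\<lambda>i. Rep_l2sum f i - Rep_l2sum g i)"

definition uminus_l2sum :: "('a, 'b) l2sum \<Rightarrow> ('a, 'b) l2sum" where
  "- f = Abs_l2sum (\<lambda>i. - Rep_l2sum f i)"

definition scaleR_l2sum :: "real \<Rightarrow> ('a, 'b) l2sum \<Rightarrow> ('a, 'b) l2sum" where
  "r *\<^sub>R f = Abs_l2sum (\<lambda>i. r *\<^sub>R Rep_l2sum f i)"

definition norm_l2sum :: "('a, 'b) l2sum \<Rightarrow> real" where
  "norm f = sqrt (\<Sum>\<^sub>\<infinity>i. (norm (Rep_l2sum f i))\<^sup>2)"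

definition dist_l2sum :: "('a, 'b) l2sum \<Rightarrow> ('a, 'b) l2sum \<Rightarrow> real" where
  "dist f g = norm (f - g)" for f g :: "('a, 'b) l2sum"

definition sgn_l2sum :: "('a, 'b) l2sum \<Rightarrow> ('a, 'b) l2sum" where
  "sgn f = inverse (norm f) *\<^sub>R f" for f :: "('a, 'b) l2sum"

definition uniformity_l2sum :: "(('a, 'b) l2sum \<times> ('a, 'b) l2sum) filter" where
  "uniformity = (INF e\<in>{0 <..}. principal {(x :: ('a, 'b) l2sum, y). dist x y < e})"

definition open_l2sum :: "('a, 'b) l2sum set \<Rightarrow> bool" where
  "open U \<longleftrightarrow> (\<forall>x\<in>U. eventually (\<lambda>(x', y). x' = x \<longrightarrow> y \<in> U) uniformity)"
  for U :: "('a, 'b) l2sum set"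

lemma Rep_l2sum_simps:
  "Rep_l2sum (0 :: ('a, 'b) l2sum) i = 0"
  "Rep_l2sum (f + g) i = Rep_l2sum f i + Rep_l2sum g i"
  "Rep_l2sum (f - g) i = Rep_l2sum f i - Rep_l2sum g i"
  "Rep_l2sum (- f) i = - Rep_l2sum f i"
  "Rep_l2sum (r *\<^sub>R f) i = r *\<^sub>R Rep_l2sum f i"
  for f g :: "('a, 'b) l2sum"
  by (simp_all add: zero_l2sum_def plus_l2sum_def minus_l2sum_def uminus_l2sum_def
      scaleR_l2sum_def scaleR_scaleC Abs_l2sum_inverse square_summable_add
      square_summable_diff square_summable_uminus square_summable_scaleC)
    (simp add: square_summable_def Abs_l2sum_inverse)

lemma norm_nth_le: "norm (Rep_l2sum f i) \<le> norm (f :: ('a, 'b) l2sum)"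
proof -
  have "(\<Sum>j\<in>{i}. (norm (Rep_l2sum f j))\<^sup>2) \<le> (\<Sum>\<^sub>\<infinity>j. (norm (Rep_l2sum f j))\<^sup>2)"
    by (rule finite_sum_le_infsum) (use square_summable_Rep[of f] in \<open>auto simp: square_summable_def\<close>)
  then show ?thesis
    unfolding norm_l2sum_def by (simp add: real_le_rsqrt)
qed

instance
proof
  fix f g h :: "('a, 'b) l2sum" and r s :: real
  show "f + g + h = f + (g + h)" "f + g = g + f" "0 + f = f" "- f + f = 0" "f - g = f + - g"
    "r *\<^sub>R (f + g) = r *\<^sub>R f + r *\<^sub>R g" "(r + s) *\<^sub>R f = r *\<^sub>R f + s *\<^sub>R f"
    "r *\<^sub>R s *\<^sub>R f = (r * s) *\<^sub>R f" "1 *\<^sub>R f = f"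
    by (auto intro!: l2sum_eqI simp: Rep_l2sum_simps algebra_simps)
  show "dist f g = norm (f - g)" "sgn f = inverse (norm f) *\<^sub>R f"
    "(uniformity :: (('a, 'b) l2sum \<times> ('a, 'b) l2sum) filter)
      = (INF e\<in>{0 <..}. principal {(x, y). dist x y < e})"
    by (simp_all add: dist_l2sum_def sgn_l2sum_def uniformity_l2sum_def)
  show "open U \<longleftrightarrow> (\<forall>x\<in>U. eventually (\<lambda>(x', y). x' = x \<longrightarrow> y \<in> U) uniformity)"
    for U :: "('a, 'b) l2sum set"
    by (rule open_l2sum_def)
  show "norm f = 0 \<longleftrightarrow> f = 0"
  proof
    assume "norm f = 0"
    then have "Rep_l2sum f i = 0" for i
      using norm_nth_le[of f i] by simp
    then show "f = 0"
      by (intro l2sum_eqI) (simp add: Rep_l2sum_simps)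
  qed (simp add: norm_l2sum_def Rep_l2sum_simps)
  show "norm (f + g) \<le> norm f + norm g"
    unfolding norm_l2sum_def Rep_l2sum_simps by (rule square_summable_add) simp_all
  show "norm (r *\<^sub>R f) = \<bar>r\<bar> * norm f"
    unfolding norm_l2sum_def Rep_l2sum_simps
    by (simp add: power_mult_distrib infsum_cmult_right' real_sqrt_mult)
qed

end

instantiation l2sum :: (type, chilbert_space) chilbert_space
begin

definition scaleC_l2sum :: "complex \<Rightarrow> ('a, 'b) l2sum \<Rightarrow> ('a, 'b) l2sum" where
  "c *\<^sub>C f = Abs_l2sum (\<lambda>i. c *\<^sub>C Rep_l2sum f i)"

definition cinner_l2sum :: "('a, 'b) l2sum \<Rightarrow> ('a, 'b) l2sum \<Rightarrow> complex" where
  "cinner f g = (\<Sum>\<^sub>\<infinity>i. cinner (Rep_l2sum f i) (Rep_l2sum g i))"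

lemma Rep_l2sum_scaleC: "Rep_l2sum (c *\<^sub>C f) i = c *\<^sub>C Rep_l2sum f i"
  for f :: "('a, 'b) l2sum"
  by (simp add: scaleC_l2sum_def Abs_l2sum_inverse square_summable_scaleC)

lemma cinner_l2sum_self: "cinner f f = complex_of_real ((norm f)\<^sup>2)" for f :: "('a, 'b) l2sum"
  unfolding cinner_l2sum_def norm_l2sum_def cinner_self
  proof -
  have "(\<lambda>i. (norm (Rep_l2sum f i))\<^sup>2) summable_on UNIV"
    using square_summable_Rep[of f] unfolding square_summable_def .
  then have "((\<lambda>i. complex_of_real ((norm (Rep_l2sum f i))\<^sup>2)) has_sum
      complex_of_real (\<Sum>\<^sub>\<infinity>i. (norm (Rep_l2sum f i))\<^sup>2)) UNIV"
    by (intro has_sum_of_real has_sum_infsum)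
  then show "(\<Sum>\<^sub>\<infinity>i. complex_of_real ((norm (Rep_l2sum f i))\<^sup>2)) =
      complex_of_real ((sqrt (\<Sum>\<^sub>\<infinity>i. (norm (Rep_l2sum f i))\<^sup>2))\<^sup>2)"
    by (simp add: infsumI infsum_nonneg)
qed

instance
proof
  fix f g h :: "('a, 'b) l2sum" and c d :: complex and r :: real
  show "c *\<^sub>C (f + g) = c *\<^sub>C f + c *\<^sub>C g" "(c + d) *\<^sub>C f = c *\<^sub>C f + d *\<^sub>C f"
    "c *\<^sub>C d *\<^sub>C f = (c * d) *\<^sub>C f" "r *\<^sub>R f = complex_of_real r *\<^sub>C f"
    by (auto intro!: l2sum_eqI simp: Rep_l2sum_simps Rep_l2sum_scaleC scaleC_add_right
        scaleC_add_left scaleC_scaleC scaleR_scaleC)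
  show "cinner (f + g) h = cinner f h + cinner g h"
    unfolding cinner_l2sum_def Rep_l2sum_simps cinner_add_left
    by (rule infsum_add) (rule summable_on_cinner; simp)+
  show "cinner (c *\<^sub>C f) g = c * cinner f g"
    unfolding cinner_l2sum_def Rep_l2sum_scaleC cinner_scaleC_left by (rule infsum_cmult_right')
  show "cinner f g = cnj (cinner g f)"
    unfolding cinner_l2sum_def by (subst cinner_commute) simp
  show "norm f = sqrt (Re (cinner f f))"
    by (simp add: cinner_l2sum_self)
next
  fix X :: "nat \<Rightarrow> ('a, 'b) l2sum"
  assume "Cauchy X"
  then have C: "\<exists>N. \<forall>m\<ge>N. \<forall>n\<ge>N. norm (X m - X n) < e" if "e > 0" for e
    using that unfolding Cauchy_def dist_norm by blast
  have "Cauchy (\<lambda>n. Rep_l2sum (X n) i)" for i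
    unfolding Cauchy_def dist_norm
    using C norm_nth_le[of "X m - X n" i for m n] unfolding Rep_l2sum_simps
    by (meson le_less_trans)
  then have "\<exists>l. (\<lambda>n. Rep_l2sum (X n) i) \<longlonglongrightarrow> l" for i
    using Cauchy_convergent convergent_def by blast
  then obtain L where L: "\<And>i. (\<lambda>n. Rep_l2sum (X n) i) \<longlonglongrightarrow> L i"
    by metis
  have le: "\<exists>N. \<forall>m\<ge>N. \<forall>F. finite F \<longrightarrow> L2_set (\<lambda>i. norm (Rep_l2sum (X m) i - L i)) F \<le> e"
    if "e > 0" for e
  proof -
    obtain N where N: "\<And>m n. m \<ge> N \<Longrightarrow> n \<ge> N \<Longrightarrow> norm (X m - X n) < e"
      using C[OF \<open>e > 0\<close>] by blast
    have "L2_set (\<lambda>i. norm (Rep_l2sum (X m) i - L i)) F \<le> e" if "m \<ge> N" "finite F" for m F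
    proof (rule tendsto_upperbound)
      show "(\<lambda>n. L2_set (\<lambda>i. norm (Rep_l2sum (X m) i - Rep_l2sum (X n) i)) F)
        \<longlonglongrightarrow> L2_set (\<lambda>i. norm (Rep_l2sum (X m) i - L i)) F"
        unfolding L2_set_def by (intro tendsto_intros L)
      have "L2_set (\<lambda>i. norm (Rep_l2sum (X m) i - Rep_l2sum (X n) i)) F \<le> e" if "n \<ge> N" for n
      proof -
        have "L2_set (\<lambda>i. norm (Rep_l2sum (X m - X n) i)) F \<le> norm (X m - X n)"
          unfolding L2_set_def norm_l2sum_def
          by (intro real_sqrt_le_mono finite_sum_le_infsum)
            (use \<open>finite F\<close> square_summable_Rep[of "X m - X n"] in \<open>auto simp: square_summable_def\<close>)
        then show ?thesis
          using N[OF \<open>m \<ge> N\<close> that] by (simp add: Rep_l2sum_simps)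
      qed
      then show "eventually (\<lambda>n. L2_set (\<lambda>i. norm (Rep_l2sum (X m) i - Rep_l2sum (X n) i)) F \<le> e)
        sequentially"
        using eventually_sequentially by blast
    qed simp
    then show ?thesis
      by blast
  qed
  obtain M where "\<And>F. finite F \<Longrightarrow> L2_set (\<lambda>i. norm (Rep_l2sum (X M) i - L i)) F \<le> 1"
    using le[of 1] by auto
  then have "square_summable (\<lambda>i. Rep_l2sum (X M) i - L i)"
    by (rule square_summableI)
  then have "square_summable (\<lambda>i. Rep_l2sum (X M) i - (Rep_l2sum (X M) i - L i))"
    by (rule square_summable_diff[OF square_summable_Rep])
  then have sL: "square_summable L"
    by simp
  have "X \<longlonglongrightarrow> Abs_l2sum L"
  proof (rule metric_LIMSEQ_I)
    fix e :: real
    assume "e > 0"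
    then obtain N where N: "\<And>m F. m \<ge> N \<Longrightarrow> finite F \<Longrightarrow>
        L2_set (\<lambda>i. norm (Rep_l2sum (X m) i - L i)) F \<le> e / 2"
      using le[of "e / 2"] by auto
    have "dist (X m) (Abs_l2sum L) < e" if "m \<ge> N" for m
    proof -
      have "(\<Sum>\<^sub>\<infinity>i. (norm (Rep_l2sum (X m) i - L i))\<^sup>2) \<le> (e / 2)\<^sup>2"
      proof (rule infsum_le_finite_sums)
        show "(\<lambda>i. (norm (Rep_l2sum (X m) i - L i))\<^sup>2) summable_on UNIV"
          using square_summable_diff[OF square_summable_Rep sL] unfolding square_summable_def .
        show "(\<Sum>i\<in>F. (norm (Rep_l2sum (X m) i - L i))\<^sup>2) \<le> (e / 2)\<^sup>2" if "finite F" for F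
          using N[OF \<open>m \<ge> N\<close> that] unfolding L2_set_def by (rule sqrt_le_D)
      qed
      then have "sqrt (\<Sum>\<^sub>\<infinity>i. (norm (Rep_l2sum (X m) i - L i))\<^sup>2) \<le> sqrt ((e / 2)\<^sup>2)"
        by (rule real_sqrt_le_mono)
      then have "dist (X m) (Abs_l2sum L) \<le> e / 2"
        unfolding dist_l2sum_def norm_l2sum_def Rep_l2sum_simps
        using sL \<open>e > 0\<close> by (simp add: Abs_l2sum_inverse)
      then show ?thesis
        using \<open>e > 0\<close> by simp
    qed
    then show "\<exists>N. \<forall>m\<ge>N. dist (X m) (Abs_l2sum L) < e"
      by blast
  qed
  then show "convergent X"
    by (rule convergentI)
qed

end

text \<open>
  A Hilbert space is a closed complex subspace of a type of class \<^class>\<open>chilbert_space\<close>.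
  This includes every Hilbert space (take \<open>UNIV\<close>), the zero space, and families of Hilbert
  spaces of different dimensions, which can be realised inside one common type.
\<close>

definition hilbert_subspace :: "'h::chilbert_space set \<Rightarrow> bool" where
  "hilbert_subspace H \<longleftrightarrow> closed H \<and> 0 \<in> H \<and> (\<forall>x\<in>H. \<forall>y\<in>H. x + y \<in> H) \<and>
    (\<forall>c. \<forall>x\<in>H. c *\<^sub>C x \<in> H)"

definition closed_cspan :: "'h::chilbert_space set \<Rightarrow> 'h set" where
  "closed_cspan X = \<Inter>{K. hilbert_subspace K \<and> X \<subseteq> K}"


section \<open>Von Neumann algebras\<close>

text \<open>
  An operator on \<open>H\<close> is a function that is \<^const>\<open>undefined\<close> outside \<open>H\<close>, so that operators
  are equal iff they agree on \<open>H\<close>; the product is \<^term>\<open>compose H S T\<close> and the identity is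
  \<^term>\<open>\<lambda>x\<in>H. x\<close>.
\<close>

definition bounded_ops :: "'h::chilbert_space set \<Rightarrow> ('h \<Rightarrow> 'h) set" where
  "bounded_ops H = {T \<in> extensional H. T ` H \<subseteq> H \<and>
    (\<forall>x\<in>H. \<forall>y\<in>H. T (x + y) = T x + T y) \<and> (\<forall>c. \<forall>x\<in>H. T (c *\<^sub>C x) = c *\<^sub>C T x) \<and>
    (\<exists>b. \<forall>x\<in>H. norm (T x) \<le> b * norm x)}"

definition op_adjoint :: "'h::chilbert_space set \<Rightarrow> ('h \<Rightarrow> 'h) \<Rightarrow> 'h \<Rightarrow> 'h" where
  "op_adjoint H T =
    (THE S. S \<in> bounded_ops H \<and> (\<forall>x\<in>H. \<forall>y\<in>H. cinner (T x) y = cinner x (S y)))"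

definition commutant :: "'h::chilbert_space set \<Rightarrow> ('h \<Rightarrow> 'h) set \<Rightarrow> ('h \<Rightarrow> 'h) set" where
  "commutant H X = {T \<in> bounded_ops H. \<forall>S\<in>X. compose H T S = compose H S T}"

definition von_neumann_algebra :: "'h::chilbert_space set \<Rightarrow> ('h \<Rightarrow> 'h) set \<Rightarrow> bool" where
  "von_neumann_algebra H M \<longleftrightarrow> M \<subseteq> bounded_ops H \<and> (\<forall>T\<in>M. op_adjoint H T \<in> M) \<and>
    commutant H (commutant H M) = M"

definition vn_generated :: "'h::chilbert_space set \<Rightarrow> ('h \<Rightarrow> 'h) set \<Rightarrow> ('h \<Rightarrow> 'h) set" where
  "vn_generated H X = \<Inter>{M. von_neumann_algebra H M \<and> X \<subseteq> M}"

definition factor :: "'h::chilbert_space set \<Rightarrow> ('h \<Rightarrow> 'h) set \<Rightarrow> bool" where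
  "factor H M \<longleftrightarrow> von_neumann_algebra H M \<and> H \<noteq> {0} \<and>
    M \<inter> commutant H M = range (\<lambda>c. \<lambda>x\<in>H. c *\<^sub>C x)"


subsection \<open>Types I, II and III\<close>

definition projections :: "'h::chilbert_space set \<Rightarrow> ('h \<Rightarrow> 'h) set \<Rightarrow> ('h \<Rightarrow> 'h) set" where
  "projections H M = {p \<in> M. op_adjoint H p = p \<and> compose H p p = p}"

definition central_projections ::
  "'h::chilbert_space set \<Rightarrow> ('h \<Rightarrow> 'h) set \<Rightarrow> ('h \<Rightarrow> 'h) set" where
  "central_projections H M = projections H M \<inter> commutant H M"

definition zero_op :: "'h::chilbert_space set \<Rightarrow> 'h \<Rightarrow> 'h" where
  "zero_op H = (\<lambda>x\<in>H. 0)"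

definition proj_le :: "'h::chilbert_space set \<Rightarrow> ('h \<Rightarrow> 'h) \<Rightarrow> ('h \<Rightarrow> 'h) \<Rightarrow> bool" where
  "proj_le H p q \<longleftrightarrow> compose H q p = p"

definition mvn_equiv ::
  "'h::chilbert_space set \<Rightarrow> ('h \<Rightarrow> 'h) set \<Rightarrow> ('h \<Rightarrow> 'h) \<Rightarrow> ('h \<Rightarrow> 'h) \<Rightarrow> bool" where
  "mvn_equiv H M p q \<longleftrightarrow>
    (\<exists>v\<in>M. compose H (op_adjoint H v) v = p \<and> compose H v (op_adjoint H v) = q)"

definition finite_projection ::
  "'h::chilbert_space set \<Rightarrow> ('h \<Rightarrow> 'h) set \<Rightarrow> ('h \<Rightarrow> 'h) \<Rightarrow> bool" where
  "finite_projection H M p \<longleftrightarrow> p \<in> projections H M \<and>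
    (\<forall>q\<in>projections H M. proj_le H q p \<and> mvn_equiv H M q p \<longrightarrow> q = p)"

definition abelian_projection ::
  "'h::chilbert_space set \<Rightarrow> ('h \<Rightarrow> 'h) set \<Rightarrow> ('h \<Rightarrow> 'h) \<Rightarrow> bool" where
  "abelian_projection H M p \<longleftrightarrow> p \<in> projections H M \<and>
    (\<forall>S\<in>M. \<forall>T\<in>M. let S' = compose H p (compose H S p); T' = compose H p (compose H T p)
      in compose H S' T' = compose H T' S')"

definition type_I :: "'h::chilbert_space set \<Rightarrow> ('h \<Rightarrow> 'h) set \<Rightarrow> bool" where
  "type_I H M \<longleftrightarrow> von_neumann_algebra H M \<and>
    (\<forall>z\<in>central_projections H M. z \<noteq> zero_op H \<longrightarrow>
      (\<exists>p. abelian_projection H M p \<and> p \<noteq> zero_op H \<and> proj_le H p z))"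

definition type_II :: "'h::chilbert_space set \<Rightarrow> ('h \<Rightarrow> 'h) set \<Rightarrow> bool" where
  "type_II H M \<longleftrightarrow> von_neumann_algebra H M \<and>
    (\<forall>p. abelian_projection H M p \<longrightarrow> p = zero_op H) \<and>
    (\<forall>z\<in>central_projections H M. z \<noteq> zero_op H \<longrightarrow>
      (\<exists>p. finite_projection H M p \<and> p \<noteq> zero_op H \<and> proj_le H p z))"

definition type_II_1 :: "'h::chilbert_space set \<Rightarrow> ('h \<Rightarrow> 'h) set \<Rightarrow> bool" where
  "type_II_1 H M \<longleftrightarrow> type_II H M \<and> finite_projection H M (\<lambda>x\<in>H. x)"

definition type_II_inf :: "'h::chilbert_space set \<Rightarrow> ('h \<Rightarrow> 'h) set \<Rightarrow> bool" where
  "type_II_inf H M \<longleftrightarrow> type_II H M \<and>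
    (\<forall>z\<in>central_projections H M. finite_projection H M z \<longrightarrow> z = zero_op H)"

definition type_III :: "'h::chilbert_space set \<Rightarrow> ('h \<Rightarrow> 'h) set \<Rightarrow> bool" where
  "type_III H M \<longleftrightarrow> von_neumann_algebra H M \<and>
    (\<forall>p. finite_projection H M p \<longrightarrow> p = zero_op H)"


subsection \<open>Weights, modular operators and Connes' invariant\<close>

definition positive_ops :: "'h::chilbert_space set \<Rightarrow> ('h \<Rightarrow> 'h) set \<Rightarrow> ('h \<Rightarrow> 'h) set" where
  "positive_ops H M = {T \<in> M. \<forall>x\<in>H. Im (cinner (T x) x) = 0 \<and> 0 \<le> Re (cinner (T x) x)}"

definition op_le :: "'h::chilbert_space set \<Rightarrow> ('h \<Rightarrow> 'h) \<Rightarrow> ('h \<Rightarrow> 'h) \<Rightarrow> bool" where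
  "op_le H S T \<longleftrightarrow> (\<forall>x\<in>H. Re (cinner (S x) x) \<le> Re (cinner (T x) x))"

definition weight ::
  "'h::chilbert_space set \<Rightarrow> ('h \<Rightarrow> 'h) set \<Rightarrow> (('h \<Rightarrow> 'h) \<Rightarrow> ennreal) \<Rightarrow> bool" where
  "weight H M \<phi> \<longleftrightarrow>
    (\<forall>S\<in>positive_ops H M. \<forall>T\<in>positive_ops H M. \<phi> (\<lambda>x\<in>H. S x + T x) = \<phi> S + \<phi> T) \<and>
    (\<forall>r\<ge>0. \<forall>T\<in>positive_ops H M. \<phi> (\<lambda>x\<in>H. complex_of_real r *\<^sub>C T x) = ennreal r * \<phi> T)"

definition faithful_weight ::
  "'h::chilbert_space set \<Rightarrow> ('h \<Rightarrow> 'h) set \<Rightarrow> (('h \<Rightarrow> 'h) \<Rightarrow> ennreal) \<Rightarrow> bool" where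
  "faithful_weight H M \<phi> \<longleftrightarrow> (\<forall>T\<in>positive_ops H M. \<phi> T = 0 \<longrightarrow> T = zero_op H)"

text \<open>Bounded increasing nets are rendered as upward directed sets with a least upper bound.\<close>

definition normal_weight ::
  "'h::chilbert_space set \<Rightarrow> ('h \<Rightarrow> 'h) set \<Rightarrow> (('h \<Rightarrow> 'h) \<Rightarrow> ennreal) \<Rightarrow> bool" where
  "normal_weight H M \<phi> \<longleftrightarrow>
    (\<forall>X S. X \<subseteq> positive_ops H M \<and> X \<noteq> {} \<and>
      (\<forall>T\<in>X. \<forall>T'\<in>X. \<exists>T''\<in>X. op_le H T T'' \<and> op_le H T' T'') \<and>
      S \<in> positive_ops H M \<and> (\<forall>T\<in>X. op_le H T S) \<and>
      (\<forall>S'\<in>positive_ops H M. (\<forall>T\<in>X. op_le H T S') \<longrightarrow> op_le H S S')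
      \<longrightarrow> \<phi> S = (SUP T\<in>X. \<phi> T))"

text \<open>The left ideal of all \<open>T\<close> with \<open>\<phi> (T\<^sup>* T) < \<infinity>\<close>.\<close>

definition weight_ideal :: "'h::chilbert_space set \<Rightarrow> ('h \<Rightarrow> 'h) set \<Rightarrow>
    (('h \<Rightarrow> 'h) \<Rightarrow> ennreal) \<Rightarrow> ('h \<Rightarrow> 'h) set" where
  "weight_ideal H M \<phi> = {T \<in> M. \<phi> (compose H (op_adjoint H T) T) < \<infinity>}"

text \<open>
  The left ideal has to be dense in \<open>M\<close>; for a left ideal the closures in the strong operator
  topology (used here) and in the \<open>\<sigma>\<close>-weak topology coincide.
\<close>

definition semifinite_weight ::
  "'h::chilbert_space set \<Rightarrow> ('h \<Rightarrow> 'h) set \<Rightarrow> (('h \<Rightarrow> 'h) \<Rightarrow> ennreal) \<Rightarrow> bool" where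
  "semifinite_weight H M \<phi> \<longleftrightarrow>
    (\<forall>T\<in>M. \<forall>F. finite F \<and> F \<subseteq> H \<longrightarrow>
      (\<forall>e>0. \<exists>S\<in>weight_ideal H M \<phi>. \<forall>x\<in>F. norm (S x - T x) < e))"

text \<open>
  The canonical map \<open>\<eta>\<close> of the GNS construction; by polarisation
  \<open>\<langle>\<eta> S, \<eta> T\<rangle> = \<phi> (T\<^sup>* S)\<close>. The GNS space is the closure of its range.
  It has a dense subset indexed by operators on \<open>H\<close>, so it fits into the square summable
  families of complex numbers indexed by \<open>'h \<Rightarrow> 'h\<close>, and is determined by \<open>\<phi>\<close> up to a unitary
  that carries one map \<open>\<eta>\<close> to the other.
\<close>

definition gns_map :: "'h::chilbert_space set \<Rightarrow> ('h \<Rightarrow> 'h) set \<Rightarrow> (('h \<Rightarrow> 'h) \<Rightarrow> ennreal) \<Rightarrow>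
    (('h \<Rightarrow> 'h) \<Rightarrow> ('h \<Rightarrow> 'h, complex) l2sum) \<Rightarrow> bool" where
  "gns_map H M \<phi> \<eta> \<longleftrightarrow>
    (\<forall>S\<in>weight_ideal H M \<phi>. \<forall>T\<in>weight_ideal H M \<phi>. \<eta> (\<lambda>x\<in>H. S x + T x) = \<eta> S + \<eta> T) \<and>
    (\<forall>c. \<forall>T\<in>weight_ideal H M \<phi>. \<eta> (\<lambda>x\<in>H. c *\<^sub>C T x) = c *\<^sub>C \<eta> T) \<and>
    (\<forall>T\<in>weight_ideal H M \<phi>. ennreal ((norm (\<eta> T))\<^sup>2) = \<phi> (compose H (op_adjoint H T) T))"

definition gns_space :: "'h::chilbert_space set \<Rightarrow> ('h \<Rightarrow> 'h) set \<Rightarrow> (('h \<Rightarrow> 'h) \<Rightarrow> ennreal) \<Rightarrow>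
    (('h \<Rightarrow> 'h) \<Rightarrow> ('h \<Rightarrow> 'h, complex) l2sum) \<Rightarrow> ('h \<Rightarrow> 'h, complex) l2sum set" where
  "gns_space H M \<phi> \<eta> = closure (\<eta> ` weight_ideal H M \<phi>)"

text \<open>
  Unbounded operators are given by their graphs. The first definition is the closure of the
  antilinear operator \<open>\<eta> T \<mapsto> \<eta> (T\<^sup>*)\<close>; the adjoint of an antilinear operator \<open>G\<close> satisfies
  \<open>\<langle>G x, z\<rangle> = \<langle>G\<^sup>* z, x\<rangle>\<close>; the modular operator is \<open>S\<^sup>* S\<close>.
\<close>

definition modular_involution :: "'h::chilbert_space set \<Rightarrow> ('h \<Rightarrow> 'h) set \<Rightarrow>
    (('h \<Rightarrow> 'h) \<Rightarrow> ennreal) \<Rightarrow> (('h \<Rightarrow> 'h) \<Rightarrow> ('h \<Rightarrow> 'h, complex) l2sum) \<Rightarrow>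
    ('h \<Rightarrow> 'h, complex) l2sum rel" where
  "modular_involution H M \<phi> \<eta> =
    closure {(\<eta> T, \<eta> (op_adjoint H T)) | T.
      T \<in> weight_ideal H M \<phi> \<and> op_adjoint H T \<in> weight_ideal H M \<phi>}"

definition antilinear_adjoint :: "'k::chilbert_space set \<Rightarrow> 'k rel \<Rightarrow> 'k rel" where
  "antilinear_adjoint K G =
    {(z, w) \<in> K \<times> K. \<forall>(x, y)\<in>G. cinner y z = cinner w x}"

definition modular_operator :: "'h::chilbert_space set \<Rightarrow> ('h \<Rightarrow> 'h) set \<Rightarrow>
    (('h \<Rightarrow> 'h) \<Rightarrow> ennreal) \<Rightarrow> (('h \<Rightarrow> 'h) \<Rightarrow> ('h \<Rightarrow> 'h, complex) l2sum) \<Rightarrow>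
    ('h \<Rightarrow> 'h, complex) l2sum rel" where
  "modular_operator H M \<phi> \<eta> =
    modular_involution H M \<phi> \<eta> O
    antilinear_adjoint (gns_space H M \<phi> \<eta>) (modular_involution H M \<phi> \<eta>)"

text \<open>\<open>z\<close> is in the resolvent set if \<open>D - z\<close> has a bounded inverse \<open>R\<close> defined on all of \<open>K\<close>.\<close>

definition op_spectrum :: "'k::chilbert_space set \<Rightarrow> 'k rel \<Rightarrow> complex set" where
  "op_spectrum K D =
    {z. \<not> (\<exists>R\<in>bounded_ops K. {(y - z *\<^sub>C x, x) | x y. (x, y) \<in> D} = {(u, R u) | u. u \<in> K})}"

definition connes_S :: "'h::chilbert_space set \<Rightarrow> ('h \<Rightarrow> 'h) set \<Rightarrow> complex set" where
  "connes_S H M = {z. \<forall>\<phi> \<eta>.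
    weight H M \<phi> \<and> faithful_weight H M \<phi> \<and> normal_weight H M \<phi> \<and> semifinite_weight H M \<phi> \<and>
    gns_map H M \<phi> \<eta>
    \<longrightarrow> z \<in> op_spectrum (gns_space H M \<phi> \<eta>) (modular_operator H M \<phi> \<eta>)}"

definition type_III_sub :: "real \<Rightarrow> 'h::chilbert_space set \<Rightarrow> ('h \<Rightarrow> 'h) set \<Rightarrow> bool" where
  "type_III_sub l H M \<longleftrightarrow> factor H M \<and> type_III H M \<and>
    (l = 0 \<and> connes_S H M = {0, 1} \<or>
     0 < l \<and> l < 1 \<and> connes_S H M = complex_of_real ` ({0} \<union> range (\<lambda>k::int. l powi k)) \<or>
     l = 1 \<and> connes_S H M = complex_of_real ` {0..})"

datatype vn_type = Type_I | Type_II_1 | Type_II_inf | Type_III real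

fun has_type :: "vn_type \<Rightarrow> 'h::chilbert_space set \<Rightarrow> ('h \<Rightarrow> 'h) set \<Rightarrow> bool" where
  "has_type Type_I H M = type_I H M"
| "has_type Type_II_1 H M = type_II_1 H M"
| "has_type Type_II_inf H M = type_II_inf H M"
| "has_type (Type_III l) H M = type_III_sub l H M"


section \<open>C*-algebras and Cuntz algebras\<close>

definition complex_ring :: "complex ring" where
  "complex_ring = \<lparr>carrier = UNIV, mult = (*), one = 1, zero = 0, add = (+)\<rparr>"

record 'a cstar = "(complex, 'a) module" +
  cnorm :: "'a \<Rightarrow> real"
  star :: "'a \<Rightarrow> 'a"

locale unital_cstar_algebra =
  fixes A :: "'a cstar" (structure)
  assumes ring_axioms: "ring A"
    and module_axioms: "module complex_ring A"
    and smult_mult_left: "x \<in> carrier A \<Longrightarrow> y \<in> carrier A \<Longrightarrow> (c \<odot> x) \<otimes> y = c \<odot> (x \<otimes> y)"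
    and smult_mult_right: "x \<in> carrier A \<Longrightarrow> y \<in> carrier A \<Longrightarrow> x \<otimes> (c \<odot> y) = c \<odot> (x \<otimes> y)"
    and cnorm_nonneg: "x \<in> carrier A \<Longrightarrow> 0 \<le> cnorm A x"
    and cnorm_eq_0: "x \<in> carrier A \<Longrightarrow> cnorm A x = 0 \<longleftrightarrow> x = \<zero>"
    and cnorm_add: "x \<in> carrier A \<Longrightarrow> y \<in> carrier A \<Longrightarrow> cnorm A (x \<oplus> y) \<le> cnorm A x + cnorm A y"
    and cnorm_smult: "x \<in> carrier A \<Longrightarrow> cnorm A (c \<odot> x) = cmod c * cnorm A x"
    and cnorm_mult: "x \<in> carrier A \<Longrightarrow> y \<in> carrier A \<Longrightarrow> cnorm A (x \<otimes> y) \<le> cnorm A x * cnorm A y"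
    and complete: "(\<And>k::nat. X k \<in> carrier A) \<Longrightarrow>
      (\<And>e. 0 < e \<Longrightarrow> \<exists>N. \<forall>j\<ge>N. \<forall>k\<ge>N. cnorm A (X j \<ominus> X k) < e) \<Longrightarrow>
      \<exists>l\<in>carrier A. (\<lambda>k. cnorm A (X k \<ominus> l)) \<longlonglongrightarrow> 0"
    and star_closed: "x \<in> carrier A \<Longrightarrow> star A x \<in> carrier A"
    and star_star: "x \<in> carrier A \<Longrightarrow> star A (star A x) = x"
    and star_add: "x \<in> carrier A \<Longrightarrow> y \<in> carrier A \<Longrightarrow> star A (x \<oplus> y) = star A x \<oplus> star A y"
    and star_smult: "x \<in> carrier A \<Longrightarrow> star A (c \<odot> x) = cnj c \<odot> star A x"
    and star_mult: "x \<in> carrier A \<Longrightarrow> y \<in> carrier A \<Longrightarrow> star A (x \<otimes> y) = star A y \<otimes> star A x"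
    and cstar_identity: "x \<in> carrier A \<Longrightarrow> cnorm A (star A x \<otimes> x) = (cnorm A x)\<^sup>2"

definition unital_star_hom :: "'a cstar \<Rightarrow> 'b cstar \<Rightarrow> ('a \<Rightarrow> 'b) \<Rightarrow> bool" where
  "unital_star_hom A B f \<longleftrightarrow> f \<in> extensional (carrier A) \<and> f \<in> ring_hom A B \<and>
    (\<forall>c. \<forall>x\<in>carrier A. f (c \<odot>\<^bsub>A\<^esub> x) = c \<odot>\<^bsub>B\<^esub> f x) \<and>
    (\<forall>x\<in>carrier A. f (star A x) = star B (f x))"

definition cstar_subalgebra :: "'a cstar \<Rightarrow> 'a set \<Rightarrow> bool" where
  "cstar_subalgebra A S \<longleftrightarrow> subring S A \<and> (\<forall>c. \<forall>x\<in>S. c \<odot>\<^bsub>A\<^esub> x \<in> S) \<and>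
    (\<forall>x\<in>S. star A x \<in> S) \<and>
    (\<forall>X l. (\<forall>k::nat. X k \<in> S) \<and> l \<in> carrier A \<and> (\<lambda>k. cnorm A (X k \<ominus>\<^bsub>A\<^esub> l)) \<longlonglongrightarrow> 0 \<longrightarrow> l \<in> S)"

definition generates_cstar :: "'a cstar \<Rightarrow> 'a set \<Rightarrow> bool" where
  "generates_cstar A X \<longleftrightarrow> X \<subseteq> carrier A \<and>
    (\<forall>S. cstar_subalgebra A S \<and> X \<subseteq> S \<longrightarrow> S = carrier A)"

definition cstar_le :: "'a cstar \<Rightarrow> 'a \<Rightarrow> 'a \<Rightarrow> bool" where
  "cstar_le A x y \<longleftrightarrow> (\<exists>b\<in>carrier A. y \<ominus>\<^bsub>A\<^esub> x = star A b \<otimes>\<^bsub>A\<^esub> b)"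

definition cuntz_family :: "nat \<Rightarrow> 'a cstar \<Rightarrow> (nat \<Rightarrow> 'a) \<Rightarrow> bool" where
  "cuntz_family n A s \<longleftrightarrow> s \<in> {1..n} \<rightarrow> carrier A \<and>
    (\<forall>i\<in>{1..n}. \<forall>j\<in>{1..n}. star A (s i) \<otimes>\<^bsub>A\<^esub> s j = (if i = j then \<one>\<^bsub>A\<^esub> else \<zero>\<^bsub>A\<^esub>)) \<and>
    (\<Oplus>\<^bsub>A\<^esub>i\<in>{1..n}. s i \<otimes>\<^bsub>A\<^esub> star A (s i)) = \<one>\<^bsub>A\<^esub>"

definition cuntz_family_inf :: "'a cstar \<Rightarrow> (nat \<Rightarrow> 'a) \<Rightarrow> bool" where
  "cuntz_family_inf A t \<longleftrightarrow> t \<in> {1..} \<rightarrow> carrier A \<and>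
    (\<forall>i\<ge>1. \<forall>j\<ge>1. star A (t i) \<otimes>\<^bsub>A\<^esub> t j = (if i = j then \<one>\<^bsub>A\<^esub> else \<zero>\<^bsub>A\<^esub>)) \<and>
    (\<forall>k\<ge>1. cstar_le A (\<Oplus>\<^bsub>A\<^esub>j\<in>{1..k}. t j \<otimes>\<^bsub>A\<^esub> star A (t j)) \<one>\<^bsub>A\<^esub>)"

text \<open>
  Universality is tested on the C*-algebras carried by subsets of \<open>nat \<Rightarrow> nat\<close>. This is no
  restriction: the C*-subalgebra generated by a sequence in an arbitrary C*-algebra has at most
  continuum many elements, so it is isomorphic to such an algebra.
\<close>

definition cuntz_algebra :: "nat \<Rightarrow> 'a cstar \<Rightarrow> (nat \<Rightarrow> 'a) \<Rightarrow> bool" where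
  "cuntz_algebra n A s \<longleftrightarrow> unital_cstar_algebra A \<and> cuntz_family n A s \<and>
    generates_cstar A (s ` {1..n}) \<and>
    (\<forall>(D :: (nat \<Rightarrow> nat) cstar) d. unital_cstar_algebra D \<and> cuntz_family n D d \<longrightarrow>
      (\<exists>!f. unital_star_hom A D f \<and> (\<forall>i\<in>{1..n}. f (s i) = d i)))"

definition cuntz_algebra_inf :: "'a cstar \<Rightarrow> (nat \<Rightarrow> 'a) \<Rightarrow> bool" where
  "cuntz_algebra_inf A t \<longleftrightarrow> unital_cstar_algebra A \<and> cuntz_family_inf A t \<and>
    generates_cstar A (t ` {1..}) \<and>
    (\<forall>(D :: (nat \<Rightarrow> nat) cstar) d. unital_cstar_algebra D \<and> cuntz_family_inf D d \<longrightarrow>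
      (\<exists>!f. unital_star_hom A D f \<and> (\<forall>i\<ge>1. f (t i) = d i)))"


section \<open>Representations\<close>

record ('a, 'h) rep =
  rep_space :: "'h set"
  rep_op :: "'a \<Rightarrow> 'h \<Rightarrow> 'h"

text \<open>
  The last clause is nondegeneracy: for unital \<open>A\<close> it means that \<open>\<one>\<close> acts as the identity.
  The zero representation is the one on the zero space.
\<close>

definition is_rep :: "'a cstar \<Rightarrow> ('a, 'h::chilbert_space) rep \<Rightarrow> bool" where
  "is_rep A \<pi> \<longleftrightarrow> hilbert_subspace (rep_space \<pi>) \<and>
    rep_op \<pi> \<in> carrier A \<rightarrow>\<^sub>E bounded_ops (rep_space \<pi>) \<and>
    (\<forall>a\<in>carrier A. \<forall>b\<in>carrier A. \<forall>x\<in>rep_space \<pi>.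
      rep_op \<pi> (a \<oplus>\<^bsub>A\<^esub> b) x = rep_op \<pi> a x + rep_op \<pi> b x) \<and>
    (\<forall>c. \<forall>a\<in>carrier A. \<forall>x\<in>rep_space \<pi>. rep_op \<pi> (c \<odot>\<^bsub>A\<^esub> a) x = c *\<^sub>C rep_op \<pi> a x) \<and>
    (\<forall>a\<in>carrier A. \<forall>b\<in>carrier A. \<forall>x\<in>rep_space \<pi>.
      rep_op \<pi> (a \<otimes>\<^bsub>A\<^esub> b) x = rep_op \<pi> a (rep_op \<pi> b x)) \<and>
    (\<forall>a\<in>carrier A. \<forall>x\<in>rep_space \<pi>. \<forall>y\<in>rep_space \<pi>.
      cinner (rep_op \<pi> a x) y = cinner x (rep_op \<pi> (star A a) y)) \<and>
    closed_cspan {rep_op \<pi> a x | a x. a \<in> carrier A \<and> x \<in> rep_space \<pi>} = rep_space \<pi>"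

definition rep_vn :: "'a cstar \<Rightarrow> ('a, 'h::chilbert_space) rep \<Rightarrow> ('h \<Rightarrow> 'h) set" where
  "rep_vn A \<pi> = vn_generated (rep_space \<pi>) (rep_op \<pi> ` carrier A)"

definition factor_rep :: "'a cstar \<Rightarrow> ('a, 'h::chilbert_space) rep \<Rightarrow> bool" where
  "factor_rep A \<pi> \<longleftrightarrow> factor (rep_space \<pi>) (rep_vn A \<pi>)"

definition rep_has_type :: "vn_type \<Rightarrow> 'a cstar \<Rightarrow> ('a, 'h::chilbert_space) rep \<Rightarrow> bool" where
  "rep_has_type X A \<pi> \<longleftrightarrow> has_type X (rep_space \<pi>) (rep_vn A \<pi>)"

definition irreducible_rep :: "'a cstar \<Rightarrow> ('a, 'h::chilbert_space) rep \<Rightarrow> bool" where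
  "irreducible_rep A \<pi> \<longleftrightarrow> rep_space \<pi> \<noteq> {0} \<and>
    (\<forall>K. hilbert_subspace K \<and> K \<subseteq> rep_space \<pi> \<and> (\<forall>a\<in>carrier A. rep_op \<pi> a ` K \<subseteq> K)
      \<longrightarrow> K = {0} \<or> K = rep_space \<pi>)"

definition rep_direct_sum :: "'a cstar \<Rightarrow> 'i set \<Rightarrow> ('i \<Rightarrow> ('a, 'k::chilbert_space) rep) \<Rightarrow>
    ('a, ('i, 'k) l2sum) rep" where
  "rep_direct_sum A L \<rho> =
    (let K = {x. \<forall>l. if l \<in> L then Rep_l2sum x l \<in> rep_space (\<rho> l) else Rep_l2sum x l = 0}
     in \<lparr>rep_space = K,
         rep_op = (\<lambda>a\<in>carrier A. \<lambda>x\<in>K.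
           Abs_l2sum (\<lambda>l. if l \<in> L then rep_op (\<rho> l) a (Rep_l2sum x l) else 0))\<rparr>)"

definition unitary_between ::
  "'h::chilbert_space set \<Rightarrow> 'k::chilbert_space set \<Rightarrow> ('h \<Rightarrow> 'k) \<Rightarrow> bool" where
  "unitary_between H K U \<longleftrightarrow> bij_betw U H K \<and>
    (\<forall>x\<in>H. \<forall>y\<in>H. U (x + y) = U x + U y) \<and> (\<forall>c. \<forall>x\<in>H. U (c *\<^sub>C x) = c *\<^sub>C U x) \<and>
    (\<forall>x\<in>H. \<forall>y\<in>H. cinner (U x) (U y) = cinner x y)"

definition intertwines :: "'a cstar \<Rightarrow> ('a, 'h) rep \<Rightarrow> ('a, 'k) rep \<Rightarrow> ('h \<Rightarrow> 'k) \<Rightarrow> bool" where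
  "intertwines A \<pi> \<sigma> U \<longleftrightarrow>
    (\<forall>a\<in>carrier A. \<forall>x\<in>rep_space \<pi>. U (rep_op \<pi> a x) = rep_op \<sigma> a (U x))"

definition unitarily_equivalent ::
  "'a cstar \<Rightarrow> ('a, 'h::chilbert_space) rep \<Rightarrow> ('a, 'k::chilbert_space) rep \<Rightarrow> bool" where
  "unitarily_equivalent A \<pi> \<sigma> \<longleftrightarrow>
    (\<exists>U. unitary_between (rep_space \<pi>) (rep_space \<sigma>) U \<and> intertwines A \<pi> \<sigma> U)"


section \<open>The functor\<close>

definition cuntz_embedding ::
  "nat \<Rightarrow> 'b cstar \<Rightarrow> (nat \<Rightarrow> 'b) \<Rightarrow> 'c cstar \<Rightarrow> (nat \<Rightarrow> 'c) \<Rightarrow> 'c \<Rightarrow> 'b" where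
  "cuntz_embedding m B r C t = (THE f. unital_star_hom C B f \<and>
    (\<forall>k. \<forall>i\<in>{1..m - 1}. f (t ((m - 1) * k + i)) = r m [^]\<^bsub>B\<^esub> k \<otimes>\<^bsub>B\<^esub> r i))"

text \<open>
  The sums over \<open>j \<ge> 1\<close> are shifted to start at \<open>0\<close>; they are taken pointwise, i.e. in the
  strong operator topology. On the zero space this is the zero representation.
\<close>

definition cuntz_functor :: "nat \<Rightarrow> nat \<Rightarrow> 'a cstar \<Rightarrow> (nat \<Rightarrow> 'a) \<Rightarrow> 'b cstar \<Rightarrow> (nat \<Rightarrow> 'b) \<Rightarrow>
    'c cstar \<Rightarrow> (nat \<Rightarrow> 'c) \<Rightarrow> ('b, 'h::chilbert_space) rep \<Rightarrow> ('a, 'h) rep" where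
  "cuntz_functor n m A s B r C t \<pi> =
    (let f = cuntz_embedding m B r C t; H = rep_space \<pi> in
     THE \<pi>'. is_rep A \<pi>' \<and> rep_space \<pi>' = H \<and>
      (\<forall>i\<in>{1..n - 1}. rep_op \<pi>' (s i) = rep_op \<pi> (f (t i))) \<and>
      rep_op \<pi>' (s n) = (\<lambda>x\<in>H.
        rep_op \<pi> (r m) (x - (\<Sum>j. rep_op \<pi> (f (t (Suc j) \<otimes>\<^bsub>C\<^esub> star C (t (Suc j)))) x)) +
        (\<Sum>j. rep_op \<pi> (f (t (Suc j + n - 1) \<otimes>\<^bsub>C\<^esub> star C (t (Suc j)))) x)))"

end

theory Submission
  imports Defs
begin

text \<open>
  Let \<open>R\<^sub>i = \<pi>(r\<^sub>i)\<close>, acting on \<open>H\<close>. The Wold decomposition of \<open>R\<^sub>m\<close> splits \<open>H\<close> into the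
  orthogonal ranges of the isometries \<open>R\<^sub>m\<^sup>k R\<^sub>i\<close> with \<open>i < m\<close>, listed as \<open>T\<^sub>0, T\<^sub>1, \<dots>\<close>, and a residual
  subspace on which \<open>R\<^sub>m\<close> acts as a unitary \<open>W\<close>. The data \<open>(T, W)\<close> are equivalent to the family
  \<open>R\<close>: the first \<open>m - 1\<close> operators of the family are \<open>T\<^sub>0, \<dots>, T\<^sub>m\<^sub>-\<^sub>2\<close>, and the last one is \<open>W\<close> plus the
  shift that takes the range of \<open>T\<^sub>j\<close> to that of \<open>T\<^sub>j\<^sub>+\<^sub>m\<^sub>-\<^sub>1\<close>. In this reconstruction \<open>m\<close> may be replaced
  by any \<open>n \<ge> 2\<close>, and the functor does exactly this: \<open>\<pi>'\<close> is given by the family of \<open>n\<close> operators with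
  the Wold data of \<open>\<pi>\<close>. So the passage from \<open>m\<close> to \<open>n\<close> is undone by the passage from \<open>n\<close> to \<open>m\<close>
  (\<open>transfer_transfer\<close>). Since only products, adjoints, sums and strongly convergent
  series occur in it, a bounded map that intertwines two families and their adjoints also
  intertwines the transferred families (\<open>transfer_intertwines\<close>).

  Consequently \<open>\<pi>\<close> and \<open>\<pi>'\<close> have the same commutant, hence generate the same von Neumann algebra,
  which gives the assertions on factors and types. They have the same closed invariant
  subspaces, because the transferred family restricts to any subspace that carries the original
  one; this is the assertion on irreducibility. For direct sums, the coordinate
  maps are intertwiners, so the functor commutes with direct sums, and a unitary intertwines
  \<open>\<pi>\<close> with a direct sum iff it intertwines the images.

  The functor is given by a definite description, so its values have to be shown to exist and to be
  unique. A representation is contractive: if \<open>\<parallel>a\<parallel> < 1\<close> then \<open>1 - a\<^sup>*a = b\<^sup>*b\<close> for some \<open>b\<close>, which is found by a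
  contracting iteration, and therefore \<open>\<parallel>x\<parallel>\<^sup>2 - \<parallel>\<pi>(a)x\<parallel>\<^sup>2 = \<parallel>\<pi>(b)x\<parallel>\<^sup>2 \<ge> 0\<close>. By continuity it is determined by its
  values on generators (\<open>rep_eqI\<close>). Existence comes from the universal property, which is
  stated for algebras of sequences of natural numbers. In a C*-algebra that is generated by a sequence, every
  element is the limit of *-polynomials from a countable set and so can be encoded by a
  sequence of natural numbers (\<open>countably_generated_subalgebra\<close>). This gives the universal property for arbitrary targets,
  in particular for the algebra of bounded operators on \<open>H\<close> that have an adjoint.
\<close>

section \<open>Operators on closed subspaces of a Hilbert space\<close>

lemma cinner_zero_left [simp]: "cinner 0 (y::'a::chilbert_space) = 0"
  using cinner_diff_left[of y y y] by simp

lemma cinner_zero_right [simp]: "cinner (x::'a::chilbert_space) 0 = 0"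
  using cinner_diff_right[of x x x] by simp

lemma scaleC_zero_right [simp]: "c *\<^sub>C (0::'a::chilbert_space) = 0"
  using norm_scaleC[of c "0::'a"] by simp

lemma scaleC_zero_left [simp]: "0 *\<^sub>C (x::'a::chilbert_space) = 0"
  using norm_scaleC[of 0 x] by simp

lemma bounded_linear_cinner_left: "bounded_linear (\<lambda>x. cinner x (y::'a::chilbert_space))"
  by (rule bounded_linear_intro[of _ "norm y"])
    (simp_all add: cinner_add_left scaleR_scaleC cinner_scaleC_left scaleC_complex_def norm_cinner_le)

lemma bounded_linear_cinner_right: "bounded_linear (\<lambda>y. cinner (x::'a::chilbert_space) y)"
  by (rule bounded_linear_intro[of _ "norm x"])
    (simp_all add: cinner_add_right scaleR_scaleC cinner_scaleC_right scaleC_complex_def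
      norm_cinner_le mult.commute[of _ "norm x"])

lemmas cinner_sum_left = linear_sum[OF bounded_linear.linear[OF bounded_linear_cinner_left]]
  and cinner_sum_right = linear_sum[OF bounded_linear.linear[OF bounded_linear_cinner_right]]
  and cinner_sums_left = bounded_linear.sums[OF bounded_linear_cinner_left]
  and cinner_sums_right = bounded_linear.sums[OF bounded_linear_cinner_right]

context
  fixes H :: "'h::chilbert_space set"
  assumes H: "hilbert_subspace H"
begin

lemma hilbert_subspace_zero: "0 \<in> H"
  using H unfolding hilbert_subspace_def by blast

lemma hilbert_subspace_add: "x \<in> H \<Longrightarrow> y \<in> H \<Longrightarrow> x + y \<in> H"
  using H unfolding hilbert_subspace_def by blast

lemma hilbert_subspace_scaleC: "x \<in> H \<Longrightarrow> c *\<^sub>C x \<in> H"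
  using H unfolding hilbert_subspace_def by blast

lemma hilbert_subspace_diff: "x \<in> H \<Longrightarrow> y \<in> H \<Longrightarrow> x - y \<in> H"
  using hilbert_subspace_add[of x "(-1) *\<^sub>C y"] hilbert_subspace_scaleC[of y "-1"]
  by (simp add: scaleC_minus1)

lemma hilbert_subspace_sum: "(\<And>i. i \<in> F \<Longrightarrow> f i \<in> H) \<Longrightarrow> sum f F \<in> H"
  by (induction F rule: infinite_finite_induct)
    (auto intro: hilbert_subspace_zero hilbert_subspace_add)

lemma hilbert_subspace_LIMSEQ: "(\<And>k. f k \<in> H) \<Longrightarrow> f \<longlonglongrightarrow> l \<Longrightarrow> l \<in> H"
  using H closed_sequentially unfolding hilbert_subspace_def by blast

lemma hilbert_subspace_sums: "(\<And>k. f k \<in> H) \<Longrightarrow> f sums l \<Longrightarrow> l \<in> H"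
  unfolding sums_def by (rule hilbert_subspace_LIMSEQ) (auto intro: hilbert_subspace_sum)

lemma cinner_eqI_on:
  assumes "x \<in> H" "y \<in> H" "\<And>z. z \<in> H \<Longrightarrow> cinner x z = cinner y z"
  shows "x = y"
proof -
  have "cinner (x - y) (x - y) = 0"
    using assms hilbert_subspace_diff[of x y] by (simp add: cinner_diff_left)
  then show ?thesis
    by (simp add: cinner_self)
qed

end

definition bounded_map ::
  "'h::chilbert_space set \<Rightarrow> 'k::chilbert_space set \<Rightarrow> ('h \<Rightarrow> 'k) \<Rightarrow> bool" where
  "bounded_map H K G \<longleftrightarrow> G \<in> H \<rightarrow> K \<and> (\<forall>x\<in>H. \<forall>y\<in>H. G (x + y) = G x + G y) \<and>
    (\<forall>c. \<forall>x\<in>H. G (c *\<^sub>C x) = c *\<^sub>C G x) \<and> (\<exists>b. \<forall>x\<in>H. norm (G x) \<le> b * norm x)"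

text \<open>The adjoint is carried along as a second function, so that identities between operators and
  their adjoints are pointwise statements on \<open>H\<close>. Values outside \<open>H\<close> are arbitrary.\<close>

definition adjoint_on :: "'h::chilbert_space set \<Rightarrow> ('h \<Rightarrow> 'h) \<Rightarrow> ('h \<Rightarrow> 'h) \<Rightarrow> bool" where
  "adjoint_on H X X' \<longleftrightarrow> X \<in> H \<rightarrow> H \<and> X' \<in> H \<rightarrow> H \<and>
    (\<forall>x\<in>H. \<forall>y\<in>H. cinner (X x) y = cinner x (X' y))"

lemma adjoint_onD:
  assumes "adjoint_on H X X'"
  shows "x \<in> H \<Longrightarrow> X x \<in> H" "x \<in> H \<Longrightarrow> X' x \<in> H"
    "x \<in> H \<Longrightarrow> y \<in> H \<Longrightarrow> cinner (X x) y = cinner x (X' y)"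
  using assms unfolding adjoint_on_def by blast+

lemma adjoint_on_sym: "adjoint_on H X X' \<Longrightarrow> adjoint_on H X' X"
  unfolding adjoint_on_def by (metis cinner_commute)

lemma adjoint_on_comp:
  "adjoint_on H X X' \<Longrightarrow> adjoint_on H Y Y' \<Longrightarrow>
    adjoint_on H (\<lambda>x. X (Y x)) (\<lambda>x. Y' (X' x))"
  unfolding adjoint_on_def by (simp add: Pi_iff)

lemma adjoint_on_add:
  "hilbert_subspace H \<Longrightarrow> adjoint_on H X X' \<Longrightarrow> adjoint_on H Y Y' \<Longrightarrow>
    adjoint_on H (\<lambda>x. X x + Y x) (\<lambda>x. X' x + Y' x)"
  unfolding adjoint_on_def
  by (simp add: Pi_iff cinner_add_left cinner_add_right hilbert_subspace_add)

lemma adjoint_on_diff: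
  "hilbert_subspace H \<Longrightarrow> adjoint_on H X X' \<Longrightarrow> adjoint_on H Y Y' \<Longrightarrow>
    adjoint_on H (\<lambda>x. X x - Y x) (\<lambda>x. X' x - Y' x)"
  unfolding adjoint_on_def
  by (simp add: Pi_iff cinner_diff_left cinner_diff_right hilbert_subspace_diff)

text \<open>An operator with an adjoint is automatically linear, since linearity can be tested by
  moving the operator to the other side of the inner product.\<close>

lemma bounded_map_adjoint_on:
  assumes "hilbert_subspace H" "adjoint_on H X X'" "\<And>x. x \<in> H \<Longrightarrow> norm (X x) \<le> b * norm x"
  shows "bounded_map H H X"
proof -
  note [simp] = adjoint_onD[OF assms(2)] hilbert_subspace_add[OF assms(1)]
    hilbert_subspace_scaleC[OF assms(1)]
  have "X (x + y) = X x + X y" if "x \<in> H" "y \<in> H" for x y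
    by (rule cinner_eqI_on[OF assms(1)]) (use that in \<open>simp_all add: cinner_add_left\<close>)
  moreover have "X (c *\<^sub>C x) = c *\<^sub>C X x" if "x \<in> H" for x c
    by (rule cinner_eqI_on[OF assms(1)]) (use that in \<open>simp_all add: cinner_scaleC_left\<close>)
  ultimately show ?thesis
    unfolding bounded_map_def by (intro conjI exI[of _ b]) (use assms(3) in auto)
qed

context
  fixes H :: "'h::chilbert_space set" and K :: "'k::chilbert_space set" and G
  assumes H: "hilbert_subspace H" and G: "bounded_map H K G"
begin

lemma bounded_map_in: "x \<in> H \<Longrightarrow> G x \<in> K"
  using G unfolding bounded_map_def by blast

lemma bounded_map_add: "x \<in> H \<Longrightarrow> y \<in> H \<Longrightarrow> G (x + y) = G x + G y"
  using G unfolding bounded_map_def by blast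

lemma bounded_map_scaleC: "x \<in> H \<Longrightarrow> G (c *\<^sub>C x) = c *\<^sub>C G x"
  using G unfolding bounded_map_def by blast

lemma bounded_map_zero: "G 0 = 0"
  using bounded_map_scaleC[of 0 0] hilbert_subspace_zero[OF H] by simp

lemma bounded_map_diff: "x \<in> H \<Longrightarrow> y \<in> H \<Longrightarrow> G (x - y) = G x - G y"
  using bounded_map_add[of "x - y" y] hilbert_subspace_diff[OF H, of x y] by simp

lemma bounded_map_sum: "(\<And>i. i \<in> F \<Longrightarrow> f i \<in> H) \<Longrightarrow> G (sum f F) = (\<Sum>i\<in>F. G (f i))"
  by (induction F rule: infinite_finite_induct)
    (simp_all add: bounded_map_zero bounded_map_add hilbert_subspace_sum[OF H])

lemma bounded_map_LIMSEQ:
  assumes "\<And>k. f k \<in> H" "f \<longlonglongrightarrow> l"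
  shows "(\<lambda>k. G (f k)) \<longlonglongrightarrow> G l"
proof -
  have l: "l \<in> H"
    using hilbert_subspace_LIMSEQ[OF H assms] .
  obtain b where b: "\<And>x. x \<in> H \<Longrightarrow> norm (G x) \<le> b * norm x"
    using G unfolding bounded_map_def by blast
  have "(\<lambda>k. b * norm (f k - l)) \<longlonglongrightarrow> b * norm (l - l)"
    by (intro tendsto_intros assms)
  then have "(\<lambda>k. b * norm (f k - l)) \<longlonglongrightarrow> 0"
    by simp
  then have "(\<lambda>k. G (f k) - G l) \<longlonglongrightarrow> 0"
  proof (rule Lim_null_comparison[rotated])
    show "\<forall>\<^sub>F k in sequentially. norm (G (f k) - G l) \<le> b * norm (f k - l)"
      using b[OF hilbert_subspace_diff[OF H assms(1) l]]
      by (simp add: bounded_map_diff[OF assms(1) l])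
  qed
  then show ?thesis
    by (rule LIM_zero_cancel)
qed

lemma bounded_map_sums:
  assumes "\<And>k. f k \<in> H" "f sums l"
  shows "(\<lambda>k. G (f k)) sums G l"
  using bounded_map_LIMSEQ[of "\<lambda>k. \<Sum>i<k. f i" l] assms
  by (simp add: sums_def bounded_map_sum hilbert_subspace_sum[OF H])

end


section \<open>Sequences of isometries with orthogonal ranges\<close>

text \<open>The operator \<open>\<Sum>\<^sub>j T\<^sub>j\<^sub>+\<^sub>p T\<^sub>j\<^sub>+\<^sub>q\<^sup>*\<close>, if \<open>T'\<close> are the adjoints of isometries \<open>T\<close> with orthogonal ranges. It moves the
  range of \<open>T\<^sub>j\<^sub>+\<^sub>q\<close> to that of \<open>T\<^sub>j\<^sub>+\<^sub>p\<close>; for \<open>p = q = 0\<close> it is the projection onto the closed span of all ranges.\<close>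

definition shift_series ::
  "(nat \<Rightarrow> 'h \<Rightarrow> 'h) \<Rightarrow> (nat \<Rightarrow> 'h \<Rightarrow> 'h) \<Rightarrow> nat \<Rightarrow> nat \<Rightarrow> 'h \<Rightarrow> 'h::chilbert_space" where
  "shift_series T T' p q x = (\<Sum>j. T (j + p) (T' (j + q) x))"

locale orthogonal_isometries =
  fixes H :: "'h::chilbert_space set" and T T' :: "nat \<Rightarrow> 'h \<Rightarrow> 'h"
  assumes space: "hilbert_subspace H"
    and adjoint_T: "adjoint_on H (T j) (T' j)"
    and T'_T: "x \<in> H \<Longrightarrow> T' i (T j x) = (if i = j then x else 0)"
begin

lemmas T_in [simp] = adjoint_onD(1)[OF adjoint_T]
  and T'_in [simp] = adjoint_onD(2)[OF adjoint_T]
  and cinner_T = adjoint_onD(3)[OF adjoint_T]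

lemma cinner_T_T: "x \<in> H \<Longrightarrow> y \<in> H \<Longrightarrow> cinner (T i x) (T j y) = (if i = j then cinner x y else 0)"
  by (simp add: cinner_T T'_T)

lemma norm_sum_T:
  assumes "finite F" "\<And>j. j \<in> F \<Longrightarrow> y j \<in> H"
  shows "(norm (\<Sum>j\<in>F. T (j + p) (y j)))\<^sup>2 = (\<Sum>j\<in>F. (norm (y j))\<^sup>2)"
proof -
  have "cinner (\<Sum>j\<in>F. T (j + p) (y j)) (\<Sum>j\<in>F. T (j + p) (y j)) = (\<Sum>j\<in>F. cinner (y j) (y j))"
    using assms by (simp add: cinner_sum_left cinner_sum_right cinner_T_T sum.delta)
  then show ?thesis
    by (simp only: cinner_self of_real_sum[symmetric] of_real_eq_iff)
qed

lemma norm_T: "x \<in> H \<Longrightarrow> norm (T j x) = norm x"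
  using norm_sum_T[of "{0}" "\<lambda>_. x" j] by simp

lemma bessel:
  assumes "finite F" "x \<in> H"
  shows "(\<Sum>j\<in>F. (norm (T' j x))\<^sup>2) \<le> (norm x)\<^sup>2"
proof -
  define v where "v = (\<Sum>j\<in>F. T j (T' j x))"
  define e where "e = (\<Sum>j\<in>F. (norm (T' j x))\<^sup>2)"
  have v: "v \<in> H"
    unfolding v_def using assms by (intro hilbert_subspace_sum[OF space]) simp
  have vx: "cinner v x = complex_of_real e"
    using assms by (simp add: v_def e_def cinner_sum_left cinner_T cinner_self)
  have vv: "cinner v v = complex_of_real e"
    using norm_sum_T[OF assms(1), of "\<lambda>j. T' j x" 0] assms
    by (simp add: v_def e_def cinner_self)
  have "cinner (x - v) (x - v) = cinner x x - complex_of_real e"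
    using vx vv cinner_commute[of x v] by (simp add: cinner_diff_left cinner_diff_right)
  then have "(norm (x - v))\<^sup>2 = (norm x)\<^sup>2 - e"
    by (simp only: cinner_self) (metis of_real_diff of_real_eq_iff)
  then show ?thesis
    using zero_le_power2[of "norm (x - v)"] unfolding e_def by linarith
qed

lemma norm_T'_le: "x \<in> H \<Longrightarrow> norm (T' j x) \<le> norm x"
  using bessel[of "{j}" x] by (simp add: power2_le_iff_abs_le)

lemma bounded_T: "bounded_map H H (T j)"
  by (rule bounded_map_adjoint_on[OF space adjoint_T, of _ 1]) (simp add: norm_T)

lemma bounded_T': "bounded_map H H (T' j)"
  by (rule bounded_map_adjoint_on[OF space adjoint_on_sym[OF adjoint_T], of _ 1])
    (simp add: norm_T'_le)

lemma bessel_shift: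
  assumes "x \<in> H"
  shows "(\<Sum>j<k. (norm (T' (j + q) x))\<^sup>2) \<le> (norm x)\<^sup>2"
proof -
  have "(\<Sum>j<k. (norm (T' (j + q) x))\<^sup>2) = (\<Sum>j\<in>(\<lambda>j. j + q) ` {..<k}. (norm (T' j x))\<^sup>2)"
    by (subst sum.reindex) (auto simp: inj_on_def)
  also have "\<dots> \<le> (norm x)\<^sup>2"
    by (rule bessel) (use assms in auto)
  finally show ?thesis .
qed

lemma summable_norm_T': "x \<in> H \<Longrightarrow> summable (\<lambda>j. (norm (T' (j + q) x))\<^sup>2)"
  by (rule summableI_nonneg_bounded[OF _ bessel_shift]) auto

text \<open>The terms are pairwise orthogonal, so convergence reduces to Bessel's inequality.\<close>

lemma summable_shift:
  assumes "x \<in> H"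
  shows "summable (\<lambda>j. T (j + p) (T' (j + q) x))"
  unfolding summable_Cauchy
proof (intro allI impI)
  fix e :: real
  assume "0 < e"
  then obtain N where N: "\<And>k l. k \<ge> N \<Longrightarrow> norm (\<Sum>j=k..<l. (norm (T' (j + q) x))\<^sup>2) < e\<^sup>2"
    using summable_norm_T'[OF assms, of q] unfolding summable_Cauchy by (meson zero_less_power)
  have "norm (\<Sum>j=k..<l. T (j + p) (T' (j + q) x)) < e" if "k \<ge> N" for k l
  proof -
    have "(norm (\<Sum>j=k..<l. T (j + p) (T' (j + q) x)))\<^sup>2 < e\<^sup>2"
      using N[OF that, of l] assms by (subst norm_sum_T) (auto simp: sum_nonneg)
    then show ?thesis
      by (rule power2_less_imp_less) (use \<open>0 < e\<close> in simp)
  qed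
  then show "\<exists>N. \<forall>k\<ge>N. \<forall>l. norm (\<Sum>j=k..<l. T (j + p) (T' (j + q) x)) < e"
    by blast
qed

abbreviation "shift \<equiv> shift_series T T'"

lemma shift_sums: "x \<in> H \<Longrightarrow> (\<lambda>j. T (j + p) (T' (j + q) x)) sums shift p q x"
  unfolding shift_series_def using summable_shift by (rule summable_sums)

lemma shift_in [simp]: "x \<in> H \<Longrightarrow> shift p q x \<in> H"
  by (rule hilbert_subspace_sums[OF space _ shift_sums]) auto

lemma norm_shift_le:
  assumes "x \<in> H"
  shows "norm (shift p q x) \<le> norm x"
proof (rule LIMSEQ_le_const2)
  show "(\<lambda>k. norm (\<Sum>j<k. T (j + p) (T' (j + q) x))) \<longlonglongrightarrow> norm (shift p q x)"
    using shift_sums[OF assms] unfolding sums_def by (rule tendsto_norm)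
  have "norm (\<Sum>j<k. T (j + p) (T' (j + q) x)) \<le> norm x" for k
  proof -
    have "(norm (\<Sum>j<k. T (j + p) (T' (j + q) x)))\<^sup>2 = (\<Sum>j<k. (norm (T' (j + q) x))\<^sup>2)"
      using assms by (intro norm_sum_T) auto
    also have "\<dots> \<le> (norm x)\<^sup>2"
      by (rule bessel_shift[OF assms])
    finally show ?thesis
      by (simp add: power2_le_iff_abs_le)
  qed
  then show "\<exists>N. \<forall>k\<ge>N. norm (\<Sum>j<k. T (j + p) (T' (j + q) x)) \<le> norm x"
    by blast
qed

lemma adjoint_shift: "adjoint_on H (shift p q) (shift q p)"
  unfolding adjoint_on_def
proof (intro conjI ballI)
  fix x y assume xy: "x \<in> H" "y \<in> H"
  have "(\<lambda>j. cinner (T (j + p) (T' (j + q) x)) y) sums cinner (shift p q x) y"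
    by (rule cinner_sums_left[OF shift_sums]) fact
  moreover have "cinner (T (j + p) (T' (j + q) x)) y = cinner x (T (j + q) (T' (j + p) y))" for j
    using xy by (simp add: cinner_T adjoint_onD[OF adjoint_on_sym[OF adjoint_T]])
  moreover have "(\<lambda>j. cinner x (T (j + q) (T' (j + p) y))) sums cinner x (shift q p y)"
    by (rule cinner_sums_right[OF shift_sums]) fact
  ultimately show "cinner (shift p q x) y = cinner x (shift q p y)"
    by (simp add: sums_unique2)
qed auto

lemma bounded_shift: "bounded_map H H (shift p q)"
  by (rule bounded_map_adjoint_on[OF space adjoint_shift, of _ _ 1]) (simp add: norm_shift_le)

lemma shift_T: "x \<in> H \<Longrightarrow> shift p q (T i x) = (if q \<le> i then T (i - q + p) x else 0)"
proof -
  assume x: "x \<in> H"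
  have "(\<lambda>j. T (j + p) (T' (j + q) (T i x))) = (\<lambda>j. if j = i - q \<and> q \<le> i then T (i - q + p) x else 0)"
    using x by (auto simp: T'_T fun_eq_iff bounded_map_zero[OF space bounded_T])
  moreover have "\<dots> sums (if q \<le> i then T (i - q + p) x else 0)"
    using sums_single[of "i - q" "\<lambda>_. T (i - q + p) x"] by auto
  ultimately show ?thesis
    unfolding shift_series_def by (simp add: sums_iff)
qed

lemma T'_shift: "x \<in> H \<Longrightarrow> T' i (shift p q x) = (if p \<le> i then T' (i - p + q) x else 0)"
proof -
  assume x: "x \<in> H"
  have "(\<lambda>j. T' i (T (j + p) (T' (j + q) x))) sums T' i (shift p q x)"
    by (rule bounded_map_sums[OF space bounded_T' _ shift_sums]) (use x in auto)
  moreover have "(\<lambda>j. T' i (T (j + p) (T' (j + q) x))) =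
      (\<lambda>j. if j = i - p \<and> p \<le> i then T' (i - p + q) x else 0)"
    using x by (auto simp: T'_T fun_eq_iff)
  moreover have "\<dots> sums (if p \<le> i then T' (i - p + q) x else 0)"
    using sums_single[of "i - p" "\<lambda>_. T' (i - p + q) x"] by auto
  ultimately show ?thesis
    by (simp add: sums_unique2)
qed

lemma shift_zero_split:
  assumes "x \<in> H"
  shows "shift 0 0 x = (\<Sum>j<p. T j (T' j x)) + shift p p x"
  using suminf_split_initial_segment[OF summable_shift[OF assms, of 0 0], of p]
  by (simp add: shift_series_def add.commute)

end


section \<open>Wold data and Cuntz families of operators\<close>

lemma sum_split_last:
  fixes f :: "nat \<Rightarrow> 'a::comm_monoid_add"
  assumes "0 < n"
  shows "(\<Sum>i\<in>{1..n}. f i) = f n + (\<Sum>j<n - 1. f (Suc j))"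
proof -
  obtain k where "n = Suc k"
    using assms by (cases n) auto
  then show ?thesis
    by (simp add: sum.atLeast1_atMost_eq add.commute)
qed

definition op_cuntz_family ::
  "'h::chilbert_space set \<Rightarrow> nat \<Rightarrow> (nat \<Rightarrow> 'h \<Rightarrow> 'h) \<Rightarrow> (nat \<Rightarrow> 'h \<Rightarrow> 'h) \<Rightarrow> bool" where
  "op_cuntz_family H n S S' \<longleftrightarrow> (\<forall>i\<in>{1..n}. adjoint_on H (S i) (S' i)) \<and>
    (\<forall>i\<in>{1..n}. \<forall>j\<in>{1..n}. \<forall>x\<in>H. S' i (S j x) = (if i = j then x else 0)) \<and>
    (\<forall>x\<in>H. (\<Sum>i\<in>{1..n}. S i (S' i x)) = x)"

text \<open>A Cuntz family built from isometries \<open>T\<^sub>j\<close> and an operator \<open>W\<close> on the complement of their ranges: the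
  first \<open>n - 1\<close> isometries, followed by the operator that equals \<open>W\<close> on the complement and takes
  the range of \<open>T\<^sub>j\<close> to that of \<open>T\<^sub>j\<^sub>+\<^sub>n\<^sub>-\<^sub>1\<close>. The same data serve for every \<open>n\<close>.\<close>

definition wold_family :: "nat \<Rightarrow> (nat \<Rightarrow> 'h \<Rightarrow> 'h) \<Rightarrow> (nat \<Rightarrow> 'h \<Rightarrow> 'h) \<Rightarrow> ('h \<Rightarrow> 'h) \<Rightarrow>
    nat \<Rightarrow> 'h \<Rightarrow> 'h::chilbert_space" where
  "wold_family n T T' W i x = (if i = n then W x + shift_series T T' (n - 1) 0 x else T (i - 1) x)"

definition wold_cofamily :: "nat \<Rightarrow> (nat \<Rightarrow> 'h \<Rightarrow> 'h) \<Rightarrow> (nat \<Rightarrow> 'h \<Rightarrow> 'h) \<Rightarrow> ('h \<Rightarrow> 'h) \<Rightarrow>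
    nat \<Rightarrow> 'h \<Rightarrow> 'h::chilbert_space" where
  "wold_cofamily n T T' W' i x =
    (if i = n then W' x + shift_series T T' 0 (n - 1) x else T' (i - 1) x)"

text \<open>The vector \<open>x - shift 0 0 x\<close> is the projection of \<open>x\<close> onto the complement of all ranges, so the axioms
  say that \<open>W\<close> is a unitary of this complement, extended by zero.\<close>

locale wold_data = orthogonal_isometries H T T'
  for H :: "'h::chilbert_space set" and T T' :: "nat \<Rightarrow> 'h \<Rightarrow> 'h" +
  fixes W W' :: "'h \<Rightarrow> 'h"
  assumes adjoint_W: "adjoint_on H W W'"
    and W_T: "x \<in> H \<Longrightarrow> W (T j x) = 0"
    and T'_W: "x \<in> H \<Longrightarrow> T' j (W x) = 0"
    and W'_W: "x \<in> H \<Longrightarrow> W' (W x) = x - shift 0 0 x"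
    and W_W': "x \<in> H \<Longrightarrow> W (W' x) = x - shift 0 0 x"

context orthogonal_isometries
begin

lemma shift_shift: "x \<in> H \<Longrightarrow> shift p q (shift q r x) = shift p r x"
  unfolding shift_series_def[of T T' p q] shift_series_def[of T T' p r]
  by (simp add: T'_shift)

lemma shift_eq_0:
  assumes "x \<in> H" "\<And>j. T' (j + q) x = 0"
  shows "shift p q x = 0"
  using assms unfolding shift_series_def by (simp add: bounded_map_zero[OF space bounded_T])

lemma shift_diff: "x \<in> H \<Longrightarrow> y \<in> H \<Longrightarrow> shift p q (x - y) = shift p q x - shift p q y"
  by (rule bounded_map_diff[OF space bounded_shift])

lemma shift_add: "x \<in> H \<Longrightarrow> y \<in> H \<Longrightarrow> shift p q (x + y) = shift p q x + shift p q y"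
  by (rule bounded_map_add[OF space bounded_shift])

lemma residual_in [simp]: "x \<in> H \<Longrightarrow> x - shift 0 0 x \<in> H"
  by (simp add: hilbert_subspace_diff[OF space])

lemma residual_residual:
  "x \<in> H \<Longrightarrow> (x - shift 0 0 x) - shift 0 0 (x - shift 0 0 x) = x - shift 0 0 x"
  by (simp add: shift_diff shift_shift)

lemma T'_residual: "x \<in> H \<Longrightarrow> T' j (x - shift 0 0 x) = 0"
  by (simp add: bounded_map_diff[OF space bounded_T'] T'_shift)

lemma residual_T: "x \<in> H \<Longrightarrow> T j x - shift 0 0 (T j x) = 0"
  by (simp add: shift_T)

lemma adjoint_residual: "adjoint_on H (\<lambda>x. x - shift 0 0 x) (\<lambda>x. x - shift 0 0 x)"
  by (rule adjoint_on_diff[OF space _ adjoint_shift]) (simp add: adjoint_on_def)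

lemma bounded_map_shift_eq_0:
  assumes X: "bounded_map H K X" and z: "\<And>j x. x \<in> H \<Longrightarrow> X (T j x) = 0" and x: "x \<in> H"
  shows "X (shift p q x) = 0"
proof -
  have "(\<lambda>j. X (T (j + p) (T' (j + q) x))) sums X (shift p q x)"
    by (rule bounded_map_sums[OF space X _ shift_sums]) (use x in auto)
  then show ?thesis
    using z x by (simp add: sums_iff)
qed

end

context wold_data
begin

lemmas W_in [simp] = adjoint_onD(1)[OF adjoint_W]
  and W'_in [simp] = adjoint_onD(2)[OF adjoint_W]

lemma W'_T: "x \<in> H \<Longrightarrow> W' (T j x) = 0"
  by (rule cinner_eqI_on[OF space])
    (simp_all add: adjoint_onD(3)[OF adjoint_on_sym[OF adjoint_W]] cinner_T T'_W
      hilbert_subspace_zero[OF space])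

lemma T'_W': "x \<in> H \<Longrightarrow> T' j (W' x) = 0"
  by (rule cinner_eqI_on[OF space])
    (simp_all add: adjoint_onD(3)[OF adjoint_on_sym[OF adjoint_W]] W_T
      adjoint_onD(3)[OF adjoint_on_sym[OF adjoint_T]] hilbert_subspace_zero[OF space])

text \<open>The axioms are symmetric in \<open>W\<close> and its adjoint, so each consequence for one holds for the
  other.\<close>

lemma flip: "wold_data H T T' W' W"
  by unfold_locales (simp_all add: adjoint_on_sym[OF adjoint_W] W'_T T'_W' W'_W W_W')

lemma norm_W_le:
  assumes "x \<in> H"
  shows "norm (W x) \<le> norm x"
proof -
  have "cinner (W x) (W x) = cinner x (x - shift 0 0 x)"
    using assms by (simp add: adjoint_onD(3)[OF adjoint_W] W'_W)
  also have "\<dots> = cinner x x - cinner x (shift 0 0 (shift 0 0 x))"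
    using assms by (simp add: cinner_diff_right shift_shift)
  also have "\<dots> = cinner x x - cinner (shift 0 0 x) (shift 0 0 x)"
    using assms by (simp add: adjoint_onD(3)[OF adjoint_shift])
  finally have "(norm (W x))\<^sup>2 = (norm x)\<^sup>2 - (norm (shift 0 0 x))\<^sup>2"
    by (simp only: cinner_self) (metis of_real_diff of_real_eq_iff)
  then have "(norm (W x))\<^sup>2 \<le> (norm x)\<^sup>2"
    using zero_le_power2[of "norm (shift 0 0 x)"] by linarith
  then show ?thesis
    by (simp add: power2_le_iff_abs_le)
qed

lemma bounded_W: "bounded_map H H W"
  by (rule bounded_map_adjoint_on[OF space adjoint_W, of 1]) (simp add: norm_W_le)

lemma W_shift: "x \<in> H \<Longrightarrow> W (shift p q x) = 0"
  by (rule bounded_map_shift_eq_0[OF bounded_W]) (simp_all add: W_T)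

lemma shift_W: "x \<in> H \<Longrightarrow> shift p q (W x) = 0"
  by (simp add: shift_eq_0 T'_W)

lemmas W'_shift = wold_data.W_shift[OF flip]
  and shift_W' = wold_data.shift_W[OF flip]
  and bounded_W' = wold_data.bounded_W[OF flip]

lemmas W_add = bounded_map_add[OF space bounded_W]
  and W_diff = bounded_map_diff[OF space bounded_W]
  and W'_add = bounded_map_add[OF space bounded_W']
  and T'_add = bounded_map_add[OF space bounded_T']

text \<open>The last operator maps the complement of the ranges onto itself and the span of all ranges onto
  the span of the ranges with index at least \<open>n - 1\<close>; the missing ranges are those of the first \<open>n - 1\<close>
  operators.\<close>

lemma op_cuntz_family_wold:
  assumes "2 \<le> n"
  shows "op_cuntz_family H n (wold_family n T T' W) (wold_cofamily n T T' W')"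
  unfolding op_cuntz_family_def
proof (intro conjI ballI)
  fix i assume "i \<in> {1..n}"
  show "adjoint_on H (wold_family n T T' W i) (wold_cofamily n T T' W' i)"
    unfolding wold_family_def[abs_def] wold_cofamily_def[abs_def]
    by (cases "i = n") (simp_all add: adjoint_on_add[OF space adjoint_W adjoint_shift] adjoint_T)
next
  fix i j x assume ij: "i \<in> {1..n}" "j \<in> {1..n}" and x: "x \<in> H"
  have "W x + shift (n - 1) 0 x \<in> H"
    using x by (simp add: hilbert_subspace_add[OF space])
  then show "wold_cofamily n T T' W' i (wold_family n T T' W j x) = (if i = j then x else 0)"
    using ij x unfolding wold_family_def wold_cofamily_def
    by (auto simp: W'_add T'_add shift_add W'_W W'_shift shift_W shift_shift T'_W T'_shift
        W'_T shift_T T'_T)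
next
  fix x assume x: "x \<in> H"
  have "(\<Sum>i\<in>{1..n}. wold_family n T T' W i (wold_cofamily n T T' W' i x)) =
      wold_family n T T' W n (wold_cofamily n T T' W' n x) + (\<Sum>j<n - 1. T j (T' j x))"
    using assms
    by (subst sum_split_last) (auto simp: wold_family_def wold_cofamily_def intro!: sum.cong)
  also have "wold_family n T T' W n (wold_cofamily n T T' W' n x) =
      x - shift 0 0 x + shift (n - 1) (n - 1) x"
    using x unfolding wold_family_def wold_cofamily_def
    by (simp add: W_add shift_add W_W' W_shift shift_W' shift_shift)
  finally show "(\<Sum>i\<in>{1..n}. wold_family n T T' W i (wold_cofamily n T T' W' i x)) = x"
    using shift_zero_split[OF x, of "n - 1"] by simp
qed

end


text \<open>For \<open>j = (m - 1) k + i\<close> with \<open>i < m - 1\<close> this is \<open>R\<^sub>m\<^sup>k R\<^sub>i\<^sub>+\<^sub>1\<close>. Indices \<open>j\<close> start at \<open>0\<close>, those of the family at \<open>1\<close>.\<close>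

definition iter_isometry :: "nat \<Rightarrow> (nat \<Rightarrow> 'h \<Rightarrow> 'h) \<Rightarrow> nat \<Rightarrow> 'h \<Rightarrow> 'h" where
  "iter_isometry m R j x = (R m ^^ (j div (m - 1))) (R (j mod (m - 1) + 1) x)"

definition iter_coisometry :: "nat \<Rightarrow> (nat \<Rightarrow> 'h \<Rightarrow> 'h) \<Rightarrow> nat \<Rightarrow> 'h \<Rightarrow> 'h" where
  "iter_coisometry m R' j x = R' (j mod (m - 1) + 1) ((R' m ^^ (j div (m - 1))) x)"

abbreviation iter_shift :: "nat \<Rightarrow> (nat \<Rightarrow> 'h \<Rightarrow> 'h) \<Rightarrow> (nat \<Rightarrow> 'h \<Rightarrow> 'h) \<Rightarrow>
    nat \<Rightarrow> nat \<Rightarrow> 'h \<Rightarrow> 'h::chilbert_space" where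
  "iter_shift m R R' \<equiv> shift_series (iter_isometry m R) (iter_coisometry m R')"

text \<open>The restriction of \<open>R\<^sub>m\<close> to the residual space of its Wold decomposition, extended by zero.\<close>

definition wold_unitary ::
  "nat \<Rightarrow> (nat \<Rightarrow> 'h \<Rightarrow> 'h) \<Rightarrow> (nat \<Rightarrow> 'h \<Rightarrow> 'h) \<Rightarrow> 'h \<Rightarrow> 'h::chilbert_space" where
  "wold_unitary m R R' x = R m (x - iter_shift m R R' 0 0 x)"

definition wold_counitary ::
  "nat \<Rightarrow> (nat \<Rightarrow> 'h \<Rightarrow> 'h) \<Rightarrow> (nat \<Rightarrow> 'h \<Rightarrow> 'h) \<Rightarrow> 'h \<Rightarrow> 'h::chilbert_space" where
  "wold_counitary m R R' x = R' m x - iter_shift m R R' 0 0 (R' m x)"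

text \<open>The last operator of the family raises the index of an isometry by \<open>n - 1\<close>, so its powers lead
  from the first \<open>n - 1\<close> isometries to all others; composed with the projection onto the complement it
  is \<open>W\<close>.\<close>

lemma (in wold_data) wold_data_of_family:
  assumes "2 \<le> n" "x \<in> H"
  defines "S \<equiv> wold_family n T T' W" and "S' \<equiv> wold_cofamily n T T' W'"
  shows "iter_isometry n S j x = T j x" "iter_coisometry n S' j x = T' j x"
    "wold_unitary n S S' x = W x" "wold_counitary n S S' x = W' x"
proof -
  have V: "S n (T i y) = T (i + (n - 1)) y" if "y \<in> H" for i y
    using that unfolding S_def wold_family_def by (simp add: W_T shift_T)
  have V': "T' i (S' n y) = T' (i + (n - 1)) y" if "y \<in> H" for i y
    using that unfolding S'_def wold_cofamily_def by (simp add: T'_add T'_W' T'_shift)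
  have V'_in: "S' n y \<in> H" if "y \<in> H" for y
    using that unfolding S'_def wold_cofamily_def by (simp add: hilbert_subspace_add[OF space])
  have V'_pow_in: "(S' n ^^ k) y \<in> H" if "y \<in> H" for k y
    using that by (induction k) (simp_all add: V'_in)
  have Vk: "(S n ^^ k) (T i y) = T (i + k * (n - 1)) y" if "y \<in> H" for i k y
    by (induction k) (use that V in \<open>simp_all add: ac_simps\<close>)
  have V'k: "T' i ((S' n ^^ k) y) = T' (i + k * (n - 1)) y" if "y \<in> H" for i k y
    by (induction k arbitrary: i) (use that V' V'_pow_in in \<open>simp_all add: ac_simps\<close>)
  have neq: "j mod (n - 1) + 1 \<noteq> n" for j
    using mod_less_divisor[of "n - 1" j] assms(1) by linarith
  have split: "j mod (n - 1) + j div (n - 1) * (n - 1) = j" for j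
    by (rule mod_div_mult_eq)
  have iso: "iter_isometry n S j y = T j y" if "y \<in> H" for j y
    unfolding iter_isometry_def using Vk[OF that, of "j div (n - 1)" "j mod (n - 1)"] neq[of j] split
    by (simp add: S_def wold_family_def)
  have coiso: "iter_coisometry n S' j y = T' j y" if "y \<in> H" for j y
    unfolding iter_coisometry_def
    using V'k[OF that, of "j mod (n - 1)" "j div (n - 1)"] neq[of j] split
    by (simp add: S'_def wold_cofamily_def)
  show "iter_isometry n S j x = T j x" "iter_coisometry n S' j x = T' j x"
    using iso coiso assms(2) by simp_all
  have sh: "iter_shift n S S' p q y = shift p q y" if "y \<in> H" for p q y
    unfolding shift_series_def using that by (simp add: iso coiso)
  show "wold_unitary n S S' x = W x"
    unfolding wold_unitary_def sh[OF assms(2)] using assms(2)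
    by (simp add: S_def wold_family_def W_diff W_shift shift_diff shift_shift)
  have "S' n x \<in> H"
    using assms(2) by (rule V'_in)
  then show "wold_counitary n S S' x = W' x"
    unfolding wold_counitary_def sh[OF \<open>S' n x \<in> H\<close>] using assms(2)
    by (simp add: S'_def wold_cofamily_def shift_add shift_W' shift_shift)
qed


locale op_cuntz =
  fixes H :: "'h::chilbert_space set" and m :: nat and R R' :: "nat \<Rightarrow> 'h \<Rightarrow> 'h"
  assumes space: "hilbert_subspace H" and m: "2 \<le> m" and family: "op_cuntz_family H m R R'"
begin

abbreviation "T \<equiv> iter_isometry m R"
abbreviation "T' \<equiv> iter_coisometry m R'"

lemma adjoint_R: "i \<in> {1..m} \<Longrightarrow> adjoint_on H (R i) (R' i)"
  and R'_R: "i \<in> {1..m} \<Longrightarrow> j \<in> {1..m} \<Longrightarrow> x \<in> H \<Longrightarrow> R' i (R j x) = (if i = j then x else 0)"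
  and sum_R_R': "x \<in> H \<Longrightarrow> (\<Sum>i\<in>{1..m}. R i (R' i x)) = x"
  using family unfolding op_cuntz_family_def by blast+

lemmas R_in [simp] = adjoint_onD(1)[OF adjoint_R]
  and R'_in [simp] = adjoint_onD(2)[OF adjoint_R]

lemma m_pos [simp]: "Suc 0 \<le> m" "0 < m"
  using m by simp_all

lemma m_in: "m \<in> {1..m}"
  by simp

lemma index_less: "Suc (j mod (m - Suc 0)) < m"
  using mod_less_divisor[of "m - Suc 0" j] m by linarith

lemmas index_le [simp] = less_imp_le[OF index_less]
  and index_neq [simp] = less_imp_neq[OF index_less] less_imp_neq[OF index_less, symmetric]

lemma index_in: "Suc (j mod (m - Suc 0)) \<in> {1..m}"
  by simp

lemma norm_R: "i \<in> {1..m} \<Longrightarrow> x \<in> H \<Longrightarrow> norm (R i x) = norm x"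
  using adjoint_onD(3)[OF adjoint_R, of i x "R i x"] R'_R[of i i x]
  by (simp add: norm_eq_sqrt_cinner)

lemma norm_R'_le:
  assumes "i \<in> {1..m}" "x \<in> H"
  shows "norm (R' i x) \<le> norm x"
proof -
  have "complex_of_real ((norm x)\<^sup>2) = cinner (\<Sum>i\<in>{1..m}. R i (R' i x)) x"
    by (simp only: sum_R_R'[OF assms(2)] cinner_self)
  also have "\<dots> = (\<Sum>i\<in>{1..m}. cinner (R' i x) (R' i x))"
    using assms(2) by (simp add: cinner_sum_left adjoint_onD(3)[OF adjoint_R])
  finally have "(norm x)\<^sup>2 = (\<Sum>i\<in>{1..m}. (norm (R' i x))\<^sup>2)"
    by (simp only: cinner_self of_real_sum[symmetric] of_real_eq_iff)
  then have "(norm (R' i x))\<^sup>2 \<le> (norm x)\<^sup>2"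
    using member_le_sum[OF assms(1), of "\<lambda>i. (norm (R' i x))\<^sup>2"] by simp
  then show ?thesis
    by (simp add: power2_le_iff_abs_le)
qed

lemma bounded_R: "bounded_map H H (R m)"
  by (rule bounded_map_adjoint_on[OF space adjoint_R[OF m_in], of 1]) (simp add: norm_R)

lemma bounded_R': "i \<in> {1..m} \<Longrightarrow> bounded_map H H (R' i)"
  by (rule bounded_map_adjoint_on[OF space adjoint_on_sym[OF adjoint_R], of _ 1])
    (simp_all add: norm_R'_le)

lemma adjoint_pow: "adjoint_on H (R m ^^ k) (R' m ^^ k)"
proof (induction k)
  case (Suc k)
  then show ?case
    using adjoint_on_comp[OF adjoint_R[OF m_in] Suc] by (simp add: funpow_Suc_right o_def funpow_swap1)
qed (simp add: adjoint_on_def)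

lemmas pow_in [simp] = adjoint_onD(1)[OF adjoint_pow]
  and pow'_in [simp] = adjoint_onD(2)[OF adjoint_pow]

lemma pow'_pow: "x \<in> H \<Longrightarrow> (R' m ^^ k) ((R m ^^ k) x) = x"
proof (induction k)
  case (Suc k)
  have "(R' m ^^ Suc k) ((R m ^^ Suc k) x) = (R' m ^^ k) (R' m (R m ((R m ^^ k) x)))"
    by (simp only: funpow_Suc_right[of k "R' m"] funpow.simps(2)[of k "R m"] o_apply)
  then show ?case
    using Suc by (simp add: R'_R del: funpow.simps(2))
qed simp

lemma pow'_R: "i \<in> {1..m} \<Longrightarrow> i \<noteq> m \<Longrightarrow> x \<in> H \<Longrightarrow> (R' m ^^ Suc k) (R i x) = 0"
proof -
  assume "i \<in> {1..m}" "i \<noteq> m" "x \<in> H"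
  moreover have "(R' m ^^ k) 0 = 0"
    by (induction k) (simp_all add: bounded_map_zero[OF space bounded_R'])
  ultimately show ?thesis
    by (simp add: funpow_Suc_right R'_R del: funpow.simps(2))
qed

text \<open>If two of the isometries contain different powers of \<open>R\<^sub>m\<close>, then cancelling the common power leaves
  a product of \<open>R\<^sub>m\<close> with the adjoint of some \<open>R\<^sub>i\<close>, \<open>i < m\<close>, or the adjoint of such a product; both vanish.\<close>

lemma orthogonal_isometries: "orthogonal_isometries H T T'"
proof
  show "hilbert_subspace H"
    by (rule space)
  show "adjoint_on H (T j) (T' j)" for j
    unfolding iter_isometry_def[abs_def] iter_coisometry_def[abs_def]
    using adjoint_on_comp[OF adjoint_pow adjoint_R[OF index_in]] by simp
  show "T' i (T j x) = (if i = j then x else 0)" if x: "x \<in> H" for i j x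
  proof -
    define a k b l where defs: "a = Suc (i mod (m - Suc 0))" "k = i div (m - Suc 0)"
      "b = Suc (j mod (m - Suc 0))" "l = j div (m - Suc 0)"
    have ab: "a \<in> {1..m}" "b \<in> {1..m}" "a \<noteq> m" "b \<noteq> m"
      unfolding defs by (rule index_in index_neq)+
    have ij: "i = j \<longleftrightarrow> k = l \<and> a = b"
      unfolding defs by (metis div_mod_decomp nat.inject)
    have lhs: "T' i (T j x) = R' a ((R' m ^^ k) ((R m ^^ l) (R b x)))"
      by (simp add: iter_isometry_def iter_coisometry_def defs)
    consider "k = l" | d where "l = k + Suc d" | d where "k = Suc d + l"
      by (metis less_iff_Suc_add add_Suc_right add.commute linorder_less_linear)
    then show ?thesis
    proof cases
      case 1
      then show ?thesis
        using x ab ij by (simp add: lhs pow'_pow R'_R)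
    next
      case (2 d)
      then show ?thesis
        using x ab ij unfolding lhs 2 funpow_add o_apply
        by (subst pow'_pow) (simp_all add: R'_R)
    next
      case (3 d)
      then show ?thesis
        using x ab ij pow'_R[OF ab(2,4) x, of d] unfolding lhs 3 funpow_add
        by (simp add: pow'_pow bounded_map_zero[OF space bounded_R'] del: funpow.simps(2))
    qed
  qed
qed

sublocale orthogonal_isometries H T T'
  by (rule orthogonal_isometries)

lemma R_T: "R m (T j x) = T (j + (m - 1)) x"
  using m unfolding iter_isometry_def
  by (subst div_add_self2, simp, subst mod_add_self2, simp)

lemma T'_R': "T' j (R' m x) = T' (j + (m - 1)) x"
  using m unfolding iter_coisometry_def
  by (subst div_add_self2, simp, subst mod_add_self2) (simp add: funpow_swap1)

lemma R_shift:
  assumes "x \<in> H"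
  shows "R m (shift 0 q x) = shift (m - 1) q x"
proof -
  have "(\<lambda>j. R m (T (j + 0) (T' (j + q) x))) sums R m (shift 0 q x)"
    by (rule bounded_map_sums[OF space bounded_R _ shift_sums]) (use assms in auto)
  then show ?thesis
    unfolding shift_series_def[of T T' "m - 1"] by (simp add: R_T sums_iff)
qed

lemma shift_R': "shift p q (R' m x) = shift p (q + (m - 1)) x"
  unfolding shift_series_def by (simp add: T'_R' add.assoc)

lemma initial_sum:
  assumes "x \<in> H"
  shows "(\<Sum>j<m - 1. T j (T' j x)) = x - R m (R' m x)"
proof -
  have "(\<Sum>i\<in>{1..m}. R i (R' i x)) = R m (R' m x) + (\<Sum>j<m - 1. T j (T' j x))"
    by (subst sum_split_last) (auto simp: iter_isometry_def iter_coisometry_def intro!: sum.cong)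
  then show ?thesis
    using sum_R_R'[OF assms] by (simp add: eq_diff_eq add.commute)
qed

abbreviation "W \<equiv> wold_unitary m R R'"
abbreviation "W' \<equiv> wold_counitary m R R'"

text \<open>That \<open>R\<^sub>m\<close> maps the residual space onto itself is seen from the projection \<open>P\<close> onto the other
  ranges: \<open>R\<^sub>m P R\<^sub>m\<^sup>*\<close> is \<open>P\<close> without its first \<open>m - 1\<close> summands, and these add up to \<open>I - R\<^sub>m R\<^sub>m\<^sup>*\<close> by the Cuntz
  relation.\<close>

lemma wold_data: "wold_data H T T' W W'"
proof
  show "adjoint_on H W W'"
    unfolding wold_unitary_def[abs_def] wold_counitary_def[abs_def]
    by (rule adjoint_on_comp[OF adjoint_R[OF m_in] adjoint_residual])
  fix x assume x: "x \<in> H"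
  show "W (T j x) = 0" for j
    unfolding wold_unitary_def residual_T[OF x] by (rule bounded_map_zero[OF space bounded_R])
  show "T' j (W x) = 0" for j
  proof (cases "j < m - 1")
    case True
    then have "Suc j \<noteq> m"
      by simp
    then show ?thesis
      using x True by (simp add: wold_unitary_def iter_coisometry_def[of m R' j] R'_R)
  next
    case False
    then have "T' j (W x) = T' (j - (m - 1)) (R' m (R m (x - shift 0 0 x)))"
      by (simp add: wold_unitary_def T'_R')
    then show ?thesis
      using x by (simp add: R'_R T'_residual)
  qed
  show "W' (W x) = x - shift 0 0 x"
    using x by (simp add: wold_unitary_def wold_counitary_def R'_R residual_residual)
  have "W (W' x) = R m (R' m x - shift 0 0 (R' m x))"
    using x by (simp add: wold_unitary_def wold_counitary_def residual_residual)
  also have "\<dots> = R m (R' m x) - shift (m - 1) (m - 1) x"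
    using x by (simp add: bounded_map_diff[OF space bounded_R] R_shift shift_R')
  also have "\<dots> = x - shift 0 0 x"
    using initial_sum[OF x] shift_zero_split[OF x, of "m - 1"] by (simp add: algebra_simps)
  finally show "W (W' x) = x - shift 0 0 x" .
qed

lemma family_of_wold_data:
  assumes "i \<in> {1..m}" "x \<in> H"
  shows "wold_family m T T' W i x = R i x" "wold_cofamily m T T' W' i x = R' i x"
proof -
  have "R m x = R m (x - shift 0 0 x) + R m (shift 0 0 x)"
    using assms(2) by (simp add: bounded_map_diff[OF space bounded_R])
  moreover have "i - 1 < m - 1" if "i \<noteq> m"
    using that assms(1) by auto
  ultimately show "wold_family m T T' W i x = R i x"
    using assms by (simp add: wold_family_def wold_unitary_def R_shift iter_isometry_def)
  show "wold_cofamily m T T' W' i x = R' i x"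
    using assms \<open>i \<noteq> m \<Longrightarrow> i - 1 < m - 1\<close>
    by (auto simp: wold_cofamily_def wold_counitary_def shift_R' iter_coisometry_def)
qed

end


section \<open>The correspondence between Cuntz families\<close>

definition transfer_family :: "nat \<Rightarrow> nat \<Rightarrow> (nat \<Rightarrow> 'h \<Rightarrow> 'h) \<Rightarrow> (nat \<Rightarrow> 'h \<Rightarrow> 'h) \<Rightarrow>
    nat \<Rightarrow> 'h \<Rightarrow> 'h::chilbert_space" where
  "transfer_family m n R R' =
    wold_family n (iter_isometry m R) (iter_coisometry m R') (wold_unitary m R R')"

definition transfer_cofamily :: "nat \<Rightarrow> nat \<Rightarrow> (nat \<Rightarrow> 'h \<Rightarrow> 'h) \<Rightarrow> (nat \<Rightarrow> 'h \<Rightarrow> 'h) \<Rightarrow>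
    nat \<Rightarrow> 'h \<Rightarrow> 'h::chilbert_space" where
  "transfer_cofamily m n R R' =
    wold_cofamily n (iter_isometry m R) (iter_coisometry m R') (wold_counitary m R R')"

context op_cuntz
begin

lemma op_cuntz_transfer:
  "2 \<le> n \<Longrightarrow> op_cuntz H n (transfer_family m n R R') (transfer_cofamily m n R R')"
  unfolding op_cuntz_def transfer_family_def transfer_cofamily_def
  using wold_data.op_cuntz_family_wold[OF wold_data] space by blast

text \<open>The transferred family has the same Wold data, and these determine each family.\<close>

lemma transfer_transfer:
  assumes "2 \<le> n" "i \<in> {1..m}" "x \<in> H"
  defines "S \<equiv> transfer_family m n R R'" and "S' \<equiv> transfer_cofamily m n R R'"
  shows "transfer_family n m S S' i x = R i x" "transfer_cofamily n m S S' i x = R' i x"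
proof -
  note data = wold_data.wold_data_of_family[OF wold_data assms(1), folded transfer_family_def
      transfer_cofamily_def, folded S_def S'_def]
  have sh: "iter_shift n S S' p q x = shift p q x" for p q
    unfolding shift_series_def using assms(3) by (simp add: data)
  show "transfer_family n m S S' i x = R i x"
    using family_of_wold_data(1)[OF assms(2,3)]
    unfolding transfer_family_def[of n m S S'] wold_family_def data[OF assms(3)] sh .
  show "transfer_cofamily n m S S' i x = R' i x"
    using family_of_wold_data(2)[OF assms(2,3)]
    unfolding transfer_cofamily_def[of n m S S'] wold_cofamily_def data[OF assms(3)] sh .
qed

end

text \<open>Products, adjoints and strongly convergent series all pass through a bounded linear map.\<close>

lemma transfer_intertwines:
  assumes "op_cuntz H m R R'" "op_cuntz K m Z Z'" "bounded_map H K G"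
    and R: "\<And>i x. i \<in> {1..m} \<Longrightarrow> x \<in> H \<Longrightarrow> G (R i x) = Z i (G x)"
    and R': "\<And>i x. i \<in> {1..m} \<Longrightarrow> x \<in> H \<Longrightarrow> G (R' i x) = Z' i (G x)"
    and x: "x \<in> H"
  shows "G (transfer_family m n R R' i x) = transfer_family m n Z Z' i (G x)"
    "G (transfer_cofamily m n R R' i x) = transfer_cofamily m n Z Z' i (G x)"
proof -
  interpret R: op_cuntz H m R R' by fact
  interpret Z: op_cuntz K m Z Z' by fact
  note [simp] = bounded_map_add[OF R.space assms(3)] bounded_map_diff[OF R.space assms(3)]
    bounded_map_in[OF R.space assms(3)]
  have pow: "G ((R m ^^ k) y) = (Z m ^^ k) (G y)" if "y \<in> H" for k y
    using that by (induction k) (simp_all add: R)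
  have pow': "G ((R' m ^^ k) y) = (Z' m ^^ k) (G y)" if "y \<in> H" for k y
    using that by (induction k) (simp_all add: R')
  have T: "G (R.T j y) = Z.T j (G y)" if "y \<in> H" for j y
    using that by (simp add: iter_isometry_def pow R)
  have T': "G (R.T' j y) = Z.T' j (G y)" if "y \<in> H" for j y
    using that by (simp add: iter_coisometry_def pow' R')
  have sh: "G (R.shift p q y) = Z.shift p q (G y)" if "y \<in> H" for p q y
  proof -
    have "(\<lambda>j. G (R.T (j + p) (R.T' (j + q) y))) sums G (R.shift p q y)"
      by (rule bounded_map_sums[OF R.space assms(3) _ R.shift_sums]) (use that in auto)
    then show ?thesis
      using that unfolding shift_series_def[of Z.T] by (simp add: T T' sums_iff)
  qed
  show "G (transfer_family m n R R' i x) = transfer_family m n Z Z' i (G x)"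
    using x by (simp add: transfer_family_def wold_family_def wold_unitary_def sh T R
        adjoint_onD(1)[OF wold_data.adjoint_W[OF R.wold_data], unfolded wold_unitary_def])
  show "G (transfer_cofamily m n R R' i x) = transfer_cofamily m n Z Z' i (G x)"
    using x by (simp add: transfer_cofamily_def wold_cofamily_def wold_counitary_def sh T' R'
        adjoint_onD(2)[OF wold_data.adjoint_W[OF R.wold_data], unfolded wold_counitary_def])
qed


section \<open>Elementary theory of abstract C*-algebras\<close>

lemma complex_ring_simps [simp]:
  "carrier complex_ring = UNIV" "mult complex_ring = (*)" "add complex_ring = (+)"
  "one complex_ring = 1" "zero complex_ring = 0"
  by (simp_all add: complex_ring_def)

context unital_cstar_algebra
begin

sublocale alg: ring A
  by (rule ring_axioms)

sublocale mod: module complex_ring A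
  by (rule module_axioms)

lemma smult_add_left: "x \<in> carrier A \<Longrightarrow> (c + d) \<odot> x = c \<odot> x \<oplus> d \<odot> x"
  using mod.smult_l_distr by simp

lemma smult_add_right: "x \<in> carrier A \<Longrightarrow> y \<in> carrier A \<Longrightarrow> c \<odot> (x \<oplus> y) = c \<odot> x \<oplus> c \<odot> y"
  using mod.smult_r_distr by simp

lemma smult_smult: "x \<in> carrier A \<Longrightarrow> c \<odot> (d \<odot> x) = (c * d) \<odot> x"
  using mod.smult_assoc1 by simp

lemma smult_1 [simp]: "x \<in> carrier A \<Longrightarrow> 1 \<odot> x = x"
  using mod.smult_one by simp

lemma smult_0 [simp]: "x \<in> carrier A \<Longrightarrow> 0 \<odot> x = \<zero>"
  using mod.smult_l_null by simp

lemma minus_smult: "x \<in> carrier A \<Longrightarrow> \<ominus> x = (-1) \<odot> x"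
  using alg.minus_equality[of "(-1) \<odot> x" x] smult_add_left[of x "-1" 1] by simp

lemma smult_minus: "x \<in> carrier A \<Longrightarrow> c \<odot> (\<ominus> x) = \<ominus> (c \<odot> x)"
  by (simp add: minus_smult smult_smult)

lemmas [simp] = star_closed star_star

lemma cnorm_zero [simp]: "cnorm A \<zero> = 0"
  using cnorm_eq_0[of \<zero>] by simp

lemma cnorm_uminus: "x \<in> carrier A \<Longrightarrow> cnorm A (\<ominus> x) = cnorm A x"
  by (simp add: minus_smult cnorm_smult)

lemma cnorm_minus_commute: "x \<in> carrier A \<Longrightarrow> y \<in> carrier A \<Longrightarrow> cnorm A (x \<ominus> y) = cnorm A (y \<ominus> x)"
  using cnorm_uminus[of "y \<ominus> x"] by (simp add: a_minus_def alg.minus_add alg.a_comm)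

lemma cnorm_diff_triangle:
  assumes "x \<in> carrier A" "y \<in> carrier A" "z \<in> carrier A"
  shows "cnorm A (x \<ominus> z) \<le> cnorm A (x \<ominus> y) + cnorm A (y \<ominus> z)"
proof -
  have "x \<ominus> z = (x \<ominus> y) \<oplus> (y \<ominus> z)"
    using assms by (simp add: a_minus_def alg.a_assoc alg.r_neg1)
  then show ?thesis
    using assms by (metis cnorm_add alg.minus_closed)
qed

lemma add_diff_add_cancel:
  assumes "h \<in> carrier A" "x \<in> carrier A" "y \<in> carrier A"
  shows "(h \<oplus> x) \<ominus> (h \<oplus> y) = x \<ominus> y"
proof -
  have "(h \<oplus> x) \<ominus> (h \<oplus> y) = h \<oplus> (\<ominus> h \<oplus> (x \<oplus> \<ominus> y))"
    using assms by (simp add: a_minus_def alg.minus_add alg.a_assoc alg.a_lcomm)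
  then show ?thesis
    using assms by (simp add: alg.r_neg2 a_minus_def)
qed

lemma star_zero [simp]: "star A \<zero> = \<zero>"
  using star_smult[of \<zero> 0] by simp

lemma star_one [simp]: "star A \<one> = \<one>"
  using star_mult[of "star A \<one>" \<one>] by (metis alg.one_closed alg.r_one star_closed star_star)

lemma star_uminus: "x \<in> carrier A \<Longrightarrow> star A (\<ominus> x) = \<ominus> star A x"
  by (simp add: minus_smult star_smult)

lemma star_diff: "x \<in> carrier A \<Longrightarrow> y \<in> carrier A \<Longrightarrow> star A (x \<ominus> y) = star A x \<ominus> star A y"
  by (simp add: a_minus_def star_add star_uminus)

lemma cnorm_star:
  assumes "x \<in> carrier A"
  shows "cnorm A (star A x) = cnorm A x"
proof -
  have le: "cnorm A y \<le> cnorm A (star A y)" if "y \<in> carrier A" for y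
  proof (cases "cnorm A y = 0")
    case True
    then show ?thesis
      using that by (simp add: cnorm_nonneg)
  next
    case False
    have "cnorm A y * cnorm A y \<le> cnorm A (star A y) * cnorm A y"
      using cstar_identity[OF that] cnorm_mult[of "star A y" y] that by (simp add: power2_eq_square)
    then show ?thesis
      using False cnorm_nonneg[OF that] by simp
  qed
  show ?thesis
    using le[OF assms] le[of "star A x"] assms by simp
qed

definition clim :: "(nat \<Rightarrow> 'a) \<Rightarrow> 'a \<Rightarrow> bool" where
  "clim X l \<longleftrightarrow> (\<forall>k. X k \<in> carrier A) \<and> l \<in> carrier A \<and> (\<lambda>k. cnorm A (X k \<ominus> l)) \<longlonglongrightarrow> 0"

lemma climD: "clim X l \<Longrightarrow> X k \<in> carrier A" "clim X l \<Longrightarrow> l \<in> carrier A"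
  unfolding clim_def by blast+

lemma climI:
  assumes "\<And>k. X k \<in> carrier A" "l \<in> carrier A" "\<And>k. cnorm A (X k \<ominus> l) \<le> f k" "f \<longlonglongrightarrow> 0"
  shows "clim X l"
  unfolding clim_def
proof (intro conjI allI assms)
  show "(\<lambda>k. cnorm A (X k \<ominus> l)) \<longlonglongrightarrow> 0"
    by (rule Lim_null_comparison[OF _ assms(4)]) (simp add: assms(1-3) cnorm_nonneg)
qed

lemma clim_unique:
  assumes "clim X l" "clim X l'"
  shows "l = l'"
proof -
  note [simp] = climD[OF assms(1)] climD[OF assms(2)]
  have "(\<lambda>k. cnorm A (X k \<ominus> l) + cnorm A (X k \<ominus> l')) \<longlonglongrightarrow> 0 + 0"
    using assms unfolding clim_def by (intro tendsto_add) auto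
  moreover have "cnorm A (l \<ominus> l') \<le> cnorm A (X k \<ominus> l) + cnorm A (X k \<ominus> l')" for k
    using cnorm_diff_triangle[of l "X k" l'] cnorm_minus_commute[of l "X k"] assms by simp
  ultimately have "cnorm A (l \<ominus> l') \<le> 0"
    by (auto intro: LIMSEQ_le_const)
  then have "cnorm A (l \<ominus> l') = 0"
    using cnorm_nonneg[of "l \<ominus> l'"] assms by simp
  then show ?thesis
    using assms by (simp add: cnorm_eq_0)
qed

lemma clim_const: "x \<in> carrier A \<Longrightarrow> clim (\<lambda>_. x) x"
  unfolding clim_def by (simp add: a_minus_def alg.r_neg)

lemma clim_add:
  assumes "clim X l" "clim Y k"
  shows "clim (\<lambda>i. X i \<oplus> Y i) (l \<oplus> k)"
proof (rule climI)
  note [simp] = climD[OF assms(1)] climD[OF assms(2)]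
  show "cnorm A (X i \<oplus> Y i \<ominus> (l \<oplus> k)) \<le> cnorm A (X i \<ominus> l) + cnorm A (Y i \<ominus> k)" for i
  proof -
    have "X i \<oplus> Y i \<ominus> (l \<oplus> k) = (X i \<ominus> l) \<oplus> (Y i \<ominus> k)"
      using assms by (simp add: a_minus_def alg.minus_add alg.a_ac)
    then show ?thesis
      using assms by (simp add: cnorm_add)
  qed
  show "(\<lambda>i. cnorm A (X i \<ominus> l) + cnorm A (Y i \<ominus> k)) \<longlonglongrightarrow> 0"
    using assms unfolding clim_def by (intro tendsto_add_zero) auto
qed (use climD[OF assms(1)] climD[OF assms(2)] in simp_all)

lemma clim_smult:
  assumes "clim X l"
  shows "clim (\<lambda>i. c \<odot> X i) (c \<odot> l)"
proof (rule climI)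
  note [simp] = climD[OF assms]
  show "cnorm A (c \<odot> X i \<ominus> c \<odot> l) \<le> cmod c * cnorm A (X i \<ominus> l)" for i
  proof -
    have "c \<odot> X i \<ominus> c \<odot> l = c \<odot> (X i \<ominus> l)"
      using assms by (simp add: a_minus_def smult_add_right smult_minus)
    then show ?thesis
      using assms by (simp add: cnorm_smult)
  qed
  show "(\<lambda>i. cmod c * cnorm A (X i \<ominus> l)) \<longlonglongrightarrow> 0"
    using assms unfolding clim_def by (intro tendsto_mult_right_zero) blast
qed (use climD[OF assms] in simp_all)

lemma clim_star:
  assumes "clim X l"
  shows "clim (\<lambda>i. star A (X i)) (star A l)"
  using assms unfolding clim_def by (simp add: cnorm_star flip: star_diff)

lemma mult_diff_mult:
  assumes "x \<in> carrier A" "y \<in> carrier A" "x' \<in> carrier A" "y' \<in> carrier A"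
  shows "x \<otimes> y \<ominus> x' \<otimes> y' = x \<otimes> (y \<ominus> y') \<oplus> (x \<ominus> x') \<otimes> y'"
  using assms
  by (simp add: a_minus_def alg.r_distr alg.l_distr alg.r_minus alg.l_minus alg.a_assoc alg.r_neg1)

lemma cnorm_mult_diff_le:
  assumes "x \<in> carrier A" "y \<in> carrier A" "x' \<in> carrier A" "y' \<in> carrier A"
  shows "cnorm A (x \<otimes> y \<ominus> x' \<otimes> y') \<le> cnorm A x * cnorm A (y \<ominus> y') + cnorm A (x \<ominus> x') * cnorm A y'"
proof -
  have "cnorm A (x \<otimes> y \<ominus> x' \<otimes> y') \<le> cnorm A (x \<otimes> (y \<ominus> y')) + cnorm A ((x \<ominus> x') \<otimes> y')"
    unfolding mult_diff_mult[OF assms] using assms by (intro cnorm_add) auto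
  then show ?thesis
    using cnorm_mult[of x "y \<ominus> y'"] cnorm_mult[of "x \<ominus> x'" y'] assms by simp
qed

lemma cnorm_le_add: "x \<in> carrier A \<Longrightarrow> l \<in> carrier A \<Longrightarrow> cnorm A x \<le> cnorm A (x \<ominus> l) + cnorm A l"
  using cnorm_diff_triangle[of x l \<zero>] by (simp add: a_minus_def)

lemma clim_mult:
  assumes "clim X l" "clim Y k"
  shows "clim (\<lambda>i. X i \<otimes> Y i) (l \<otimes> k)"
proof (rule climI)
  note [simp] = climD[OF assms(1)] climD[OF assms(2)]
  let ?f = "\<lambda>i. (cnorm A (X i \<ominus> l) + cnorm A l) * cnorm A (Y i \<ominus> k) + cnorm A (X i \<ominus> l) * cnorm A k"
  show "cnorm A (X i \<otimes> Y i \<ominus> l \<otimes> k) \<le> ?f i" for i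
  proof -
    have "cnorm A (X i) * cnorm A (Y i \<ominus> k) \<le> (cnorm A (X i \<ominus> l) + cnorm A l) * cnorm A (Y i \<ominus> k)"
      using assms by (intro mult_right_mono cnorm_le_add cnorm_nonneg) auto
    then show ?thesis
      using cnorm_mult_diff_le[of "X i" "Y i" l k] assms by simp
  qed
  have "?f \<longlonglongrightarrow> (0 + cnorm A l) * 0 + 0 * cnorm A k"
    using assms unfolding clim_def by (intro tendsto_intros) auto
  then show "?f \<longlonglongrightarrow> 0"
    by simp
qed (use climD[OF assms(1)] climD[OF assms(2)] in simp_all)

lemma clim_Suc: "clim X l \<Longrightarrow> clim (\<lambda>k. X (Suc k)) l"
  unfolding clim_def using LIMSEQ_Suc by blast

text \<open>Increments that decrease geometrically make a sequence Cauchy.\<close>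

lemma geometric_clim:
  assumes X: "\<And>k. X k \<in> carrier A" and q: "0 \<le> q" "q < 1"
    and le: "\<And>k. cnorm A (X (Suc k) \<ominus> X k) \<le> q ^ k"
  obtains l where "clim X l"
proof -
  have *: "cnorm A (X (k + p) \<ominus> X k) \<le> q ^ k / (1 - q)" for k p
  proof -
    have "cnorm A (X (k + p) \<ominus> X k) \<le> (\<Sum>i<p. q ^ (k + i))"
    proof (induction p)
      case (Suc p)
      then show ?case
        using cnorm_diff_triangle[of "X (Suc (k + p))" "X (k + p)" "X k"] le[of "k + p"] X
        by simp
    qed (simp add: X a_minus_def alg.r_neg)
    also have "\<dots> = q ^ k * (\<Sum>i<p. q ^ i)"
      by (simp add: power_add sum_distrib_left)
    also have "\<dots> \<le> q ^ k * (1 / (1 - q))"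
    proof (intro mult_left_mono)
      have "(\<Sum>i<p. q ^ i) = (1 - q ^ p) / (1 - q)"
        using q sum_gp_strict[of q p] by simp
      also have "\<dots> \<le> 1 / (1 - q)"
        using q by (intro divide_right_mono) auto
      finally show "(\<Sum>i<p. q ^ i) \<le> 1 / (1 - q)" .
    qed (use q in simp)
    finally show ?thesis
      by simp
  qed
  have cauchy: "\<exists>N. \<forall>j\<ge>N. \<forall>k\<ge>N. cnorm A (X j \<ominus> X k) < e" if "0 < e" for e
  proof -
    have "(\<lambda>k. q ^ k / (1 - q)) \<longlonglongrightarrow> 0 / (1 - q)"
      using q by (intro tendsto_intros LIMSEQ_realpow_zero) auto
    then have "\<forall>\<^sub>F k in sequentially. q ^ k / (1 - q) < e"
      using that by (intro order_tendstoD(2)) auto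
    then obtain N where N: "\<And>k. N \<le> k \<Longrightarrow> q ^ k / (1 - q) < e"
      unfolding eventually_sequentially by blast
    have "cnorm A (X j \<ominus> X k) < e" if "j \<ge> N" "k \<ge> N" for j k
    proof (cases "k \<le> j")
      case True
      then show ?thesis
        using *[of k "j - k"] N[OF that(2)] by simp
    next
      case False
      then show ?thesis
        using *[of j "k - j"] N[OF that(1)] cnorm_minus_commute[OF X X, of j k] by simp
    qed
    then show ?thesis
      by blast
  qed
  have "\<exists>l\<in>carrier A. (\<lambda>k. cnorm A (X k \<ominus> l)) \<longlonglongrightarrow> 0"
    by (rule complete) (simp_all add: X cauchy)
  then obtain l where "l \<in> carrier A" "(\<lambda>k. cnorm A (X k \<ominus> l)) \<longlonglongrightarrow> 0"
    ..
  then have "clim X l"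
    using X by (simp add: clim_def)
  then show thesis
    by (rule that)
qed

text \<open>The iteration for the equation \<open>c = (h + c\<^sup>2) / 2\<close>, which is equivalent to \<open>(1 - c)\<^sup>2 = 1 - h\<close>.\<close>

fun sqrt_iter :: "'a \<Rightarrow> nat \<Rightarrow> 'a" where
  "sqrt_iter h 0 = \<zero>"
| "sqrt_iter h (Suc k) = (1 / 2) \<odot> (h \<oplus> sqrt_iter h k \<otimes> sqrt_iter h k)"

text \<open>If \<open>\<parallel>h\<parallel> = q < 1\<close> then the iterates stay in the ball of radius \<open>q\<close>, where the iterated map contracts with
  factor \<open>q\<close>. They are self-adjoint, hence so is the limit.\<close>

lemma square_root_one_minus:
  assumes h: "h \<in> carrier A" "star A h = h" "cnorm A h < 1"
  obtains b where "b \<in> carrier A" "star A b \<otimes> b = \<one> \<ominus> h"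
proof -
  define q where "q = cnorm A h"
  have q: "0 \<le> q" "q < 1"
    using h by (simp_all add: q_def cnorm_nonneg)
  let ?c = "sqrt_iter h"
  have c [simp]: "?c k \<in> carrier A" for k
    by (induction k) (simp_all add: h)
  have half: "cnorm A ((1 / 2) \<odot> x) = cnorm A x / 2" if "x \<in> carrier A" for x
    using that by (simp add: cnorm_smult norm_divide)
  have c_le: "cnorm A (?c k) \<le> q" for k
  proof (induction k)
    case (Suc k)
    have "cnorm A (?c k \<otimes> ?c k) \<le> q * q"
      using cnorm_mult[OF c c, of k k] mult_mono[OF Suc Suc q(1)] by (simp add: cnorm_nonneg)
    also have "\<dots> \<le> q"
      using q by (simp add: mult_left_le)
    finally have "cnorm A (h \<oplus> ?c k \<otimes> ?c k) \<le> q + q"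
      using cnorm_add[of h "?c k \<otimes> ?c k"] h by (simp add: q_def)
    then show ?case
      using h by (simp add: half)
  qed (simp add: q)
  have diff: "?c (Suc (Suc k)) \<ominus> ?c (Suc k) =
      (1 / 2) \<odot> (?c (Suc k) \<otimes> ?c (Suc k) \<ominus> ?c k \<otimes> ?c k)" for k
  proof -
    have *: "(1 / 2) \<odot> (h \<oplus> x) \<ominus> (1 / 2) \<odot> (h \<oplus> y) = (1 / 2) \<odot> (x \<ominus> y)"
      if "x \<in> carrier A" "y \<in> carrier A" for x y
      using that h add_diff_add_cancel[of "(1 / 2) \<odot> h" "(1 / 2) \<odot> x" "(1 / 2) \<odot> y"]
      by (simp add: smult_add_right) (simp add: a_minus_def smult_add_right smult_minus)
    show ?thesis
      unfolding sqrt_iter.simps(2)[of h "Suc k"]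
      by (subst sqrt_iter.simps(2)[of h k], subst *) (simp_all add: h del: sqrt_iter.simps)
  qed
  have "cnorm A (?c (Suc k) \<ominus> ?c k) \<le> q ^ k" for k
  proof (induction k)
    case 0
    show ?case
      using h q half[of h] by (simp add: a_minus_def flip: q_def)
  next
    case (Suc k)
    have "cnorm A (?c (Suc k) \<otimes> ?c (Suc k) \<ominus> ?c k \<otimes> ?c k) \<le>
        cnorm A (?c (Suc k)) * cnorm A (?c (Suc k) \<ominus> ?c k) +
        cnorm A (?c (Suc k) \<ominus> ?c k) * cnorm A (?c k)"
      by (rule cnorm_mult_diff_le) (rule c)+
    also have "\<dots> \<le> q * q ^ k + q ^ k * q"
      by (intro add_mono mult_mono c_le Suc q cnorm_nonneg alg.minus_closed c zero_le_power)
    finally show ?case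
      unfolding diff by (subst half) (simp_all del: sqrt_iter.simps)
  qed
  then obtain l where l: "clim ?c l"
    using geometric_clim[of ?c q] q by auto
  note [simp] = climD[OF l]
  have l_eq: "l = (1 / 2) \<odot> (h \<oplus> l \<otimes> l)"
    using clim_unique[OF clim_Suc[OF l]] clim_smult[OF clim_add[OF clim_const[OF h(1)] clim_mult[OF l l]]]
    by simp
  have "star A (?c k) = ?c k" for k
    by (induction k) (simp_all add: h star_smult star_add star_mult)
  then have l_star: "star A l = l"
    using clim_unique[OF clim_star[OF l]] l by simp
  have "l \<oplus> l = (2 * (1 / 2)) \<odot> (h \<oplus> l \<otimes> l)"
    using l_eq l h smult_add_left[of "h \<oplus> l \<otimes> l" "1/2" "1/2"] by simp
  then have ll: "l \<oplus> l = h \<oplus> l \<otimes> l"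
    using l h by simp
  have "(\<one> \<ominus> l) \<otimes> (\<one> \<ominus> l) = \<one> \<ominus> (l \<oplus> l) \<oplus> l \<otimes> l"
    using l by (simp add: a_minus_def alg.l_distr alg.r_distr alg.l_minus alg.r_minus alg.minus_add alg.a_ac)
  also have "\<dots> = \<one> \<ominus> h"
    unfolding ll using l h by (simp add: a_minus_def alg.minus_add alg.a_ac alg.r_neg alg.l_neg)
  finally have "star A (\<one> \<ominus> l) \<otimes> (\<one> \<ominus> l) = \<one> \<ominus> h"
    using l l_star by (simp add: star_diff)
  then show thesis
    using that[of "\<one> \<ominus> l"] l by simp
qed

lemma generates_cstar_induct [consumes 2, case_names gen one add mult smult star lim]:
  assumes "generates_cstar A X" "a \<in> carrier A"
    and gen: "\<And>x. x \<in> X \<Longrightarrow> P x" and one: "P \<one>"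
    and add: "\<And>x y. x \<in> carrier A \<Longrightarrow> y \<in> carrier A \<Longrightarrow> P x \<Longrightarrow> P y \<Longrightarrow> P (x \<oplus> y)"
    and mult: "\<And>x y. x \<in> carrier A \<Longrightarrow> y \<in> carrier A \<Longrightarrow> P x \<Longrightarrow> P y \<Longrightarrow> P (x \<otimes> y)"
    and smult: "\<And>c x. x \<in> carrier A \<Longrightarrow> P x \<Longrightarrow> P (c \<odot> x)"
    and star: "\<And>x. x \<in> carrier A \<Longrightarrow> P x \<Longrightarrow> P (star A x)"
    and lim: "\<And>Y l. clim Y l \<Longrightarrow> (\<And>k. P (Y k)) \<Longrightarrow> P l"
  shows "P a"
proof -
  have "subring {x \<in> carrier A. P x} A"
    by (rule alg.subringI) (auto simp: one add mult minus_smult smult)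
  moreover have "l \<in> {x \<in> carrier A. P x}"
    if "(\<forall>k. Y k \<in> {x \<in> carrier A. P x}) \<and> l \<in> carrier A \<and> (\<lambda>k. cnorm A (Y k \<ominus> l)) \<longlonglongrightarrow> 0" for Y l
    using lim[of Y l] that unfolding clim_def by simp
  ultimately have "cstar_subalgebra A {x \<in> carrier A. P x}"
    unfolding cstar_subalgebra_def using smult star by (intro conjI allI impI ballI) auto
  then have "{x \<in> carrier A. P x} = carrier A"
    using assms(1) gen unfolding generates_cstar_def by blast
  then show ?thesis
    using assms(2) by blast
qed

end


section \<open>Separable C*-algebras and the universal property\<close>

text \<open>Formal *-polynomials in a sequence of generators. The scalar in \<open>Smult j\<close> stands for the \<open>j\<close>-th
  member of a dense sequence of complex numbers, which keeps the type countable.\<close>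

datatype star_term =
  Gen nat | One | Add star_term star_term | Mult star_term star_term | Star star_term
  | Smult nat star_term

instance star_term :: countable
  by countable_datatype

context unital_cstar_algebra
begin

primrec eval_term :: "(nat \<Rightarrow> complex) \<Rightarrow> (nat \<Rightarrow> 'a) \<Rightarrow> star_term \<Rightarrow> 'a" where
  "eval_term q d (Gen i) = d i"
| "eval_term q d One = \<one>"
| "eval_term q d (Add x y) = eval_term q d x \<oplus> eval_term q d y"
| "eval_term q d (Mult x y) = eval_term q d x \<otimes> eval_term q d y"
| "eval_term q d (Star x) = star A (eval_term q d x)"
| "eval_term q d (Smult j x) = q j \<odot> eval_term q d x"

lemma clim_scalar_smult:
  assumes "c \<longlonglongrightarrow> b" "clim X l"
  shows "clim (\<lambda>k. c k \<odot> X k) (b \<odot> l)"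
proof -
  have "clim (\<lambda>k. c k \<odot> \<one>) (b \<odot> \<one>)"
  proof (rule climI)
    have "c k \<odot> \<one> \<ominus> b \<odot> \<one> = (c k - b) \<odot> \<one>" for k
      using smult_add_left[of \<one> "c k" "- b"]
      by (simp add: a_minus_def minus_smult smult_smult)
    then show "cnorm A (c k \<odot> \<one> \<ominus> b \<odot> \<one>) \<le> cmod (c k - b) * cnorm A \<one>" for k
      by (simp add: cnorm_smult)
    show "(\<lambda>k. cmod (c k - b) * cnorm A \<one>) \<longlonglongrightarrow> 0"
      using assms(1) by (intro tendsto_mult_left_zero tendsto_norm_zero LIM_zero)
  qed simp_all
  from clim_mult[OF this assms(2)] show ?thesis
    using climD[OF assms(2)] by (simp add: smult_mult_left)
qed

text \<open>A countable set of *-polynomials in the generators, with coefficients in a countable dense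
  set, is dense in the algebra that they generate; so an element of that algebra is
  encoded by a sequence of natural numbers.\<close>

lemma countably_generated_subalgebra:
  fixes d :: "nat \<Rightarrow> 'a"
  assumes d: "\<And>i. d i \<in> carrier A"
  obtains S and \<phi> :: "'a \<Rightarrow> nat \<Rightarrow> nat"
  where "cstar_subalgebra A S" "range d \<subseteq> S" "inj_on \<phi> S"
proof -
  obtain D :: "complex set"
    where D: "countable D" "\<And>U. open U \<Longrightarrow> U \<noteq> {} \<Longrightarrow> \<exists>x\<in>D. x \<in> U"
    using countable_dense_setE by blast
  define q where "q = from_nat_into D"
  have "D \<noteq> {}"
    using D(2)[of UNIV] by auto
  then have q: "range q = D"
    using D(1) by (simp add: q_def range_from_nat_into)
  have q_dense: "\<exists>j. (\<lambda>k. q (j k)) \<longlonglongrightarrow> c" for c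
  proof -
    have "\<exists>j. cmod (q j - c) \<le> inverse (real (Suc k))" for k
    proof -
      obtain x where "x \<in> D" "cmod (x - c) < inverse (real (Suc k))"
        using D(2)[of "ball c (inverse (real (Suc k)))"] by (auto simp: dist_norm norm_minus_commute)
      then show ?thesis
        using q less_imp_le by blast
    qed
    then obtain j where "\<And>k. cmod (q (j k) - c) \<le> inverse (real (Suc k))"
      by metis
    then have "(\<lambda>k. q (j k) - c) \<longlonglongrightarrow> 0"
      by (intro Lim_null_comparison[OF _ LIMSEQ_inverse_real_of_nat]) simp
    then have "(\<lambda>k. q (j k)) \<longlonglongrightarrow> c"
      by (rule LIM_zero_cancel)
    then show ?thesis
      by (rule exI[of _ j])
  qed
  define e where "e = eval_term q d"
  have e [simp]: "e \<tau> \<in> carrier A" for \<tau>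
    unfolding e_def by (induction \<tau>) (simp_all add: d)
  define S where "S = {l. \<exists>\<tau>. clim (\<lambda>k. e (\<tau> k)) l}"
  have S_I: "clim (\<lambda>k. e (\<tau> k)) l \<Longrightarrow> l \<in> S" for \<tau> l
    unfolding S_def by blast
  have S_D: "\<exists>\<tau>. clim (\<lambda>k. e (\<tau> k)) l" if "l \<in> S" for l
    using that unfolding S_def by blast
  have closed: "c \<odot> x \<in> S" "star A x \<in> S" if "x \<in> S" for c x
  proof -
    from S_D[OF that] obtain \<sigma> where \<sigma>: "clim (\<lambda>k. e (\<sigma> k)) x" ..
    obtain j where "(\<lambda>k. q (j k)) \<longlonglongrightarrow> c"
      using q_dense by blast
    from clim_scalar_smult[OF this \<sigma>] show "c \<odot> x \<in> S"
      by (intro S_I[of "\<lambda>k. Smult (j k) (\<sigma> k)"]) (simp add: e_def)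
    show "star A x \<in> S"
      using clim_star[OF \<sigma>] by (intro S_I[of "\<lambda>k. Star (\<sigma> k)"]) (simp add: e_def)
  qed
  have S_carrier: "x \<in> carrier A" if "x \<in> S" for x
    using S_D[OF that] climD(2) by blast
  have "subring S A"
  proof (rule alg.subringI)
    show "\<one> \<in> S"
      by (rule S_I[of "\<lambda>_. One"]) (simp add: e_def clim_const)
    show "\<ominus> x \<in> S" if "x \<in> S" for x
      using closed(1)[OF that] S_carrier[OF that] by (simp add: minus_smult)
    fix x y assume "x \<in> S" "y \<in> S"
    then obtain \<sigma> \<tau> where *: "clim (\<lambda>k. e (\<sigma> k)) x" "clim (\<lambda>k. e (\<tau> k)) y"
      using S_D by blast
    show "x \<otimes> y \<in> S"
      using clim_mult[OF *] by (intro S_I[of "\<lambda>k. Mult (\<sigma> k) (\<tau> k)"]) (simp add: e_def)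
    show "x \<oplus> y \<in> S"
      using clim_add[OF *] by (intro S_I[of "\<lambda>k. Add (\<sigma> k) (\<tau> k)"]) (simp add: e_def)
  qed (use S_carrier in blast)
  moreover have "l \<in> S"
    if asm: "(\<forall>k. X k \<in> S) \<and> l \<in> carrier A \<and> (\<lambda>k. cnorm A (X k \<ominus> l)) \<longlonglongrightarrow> 0" for X l
  proof -
    have X: "X k \<in> S" for k
      using asm by blast
    have l: "clim X l"
      using asm S_carrier[OF X] unfolding clim_def by blast
    note [simp] = climD[OF l]
    have "\<exists>\<tau>. cnorm A (e \<tau> \<ominus> X k) < inverse (real (Suc k))" for k
    proof -
      obtain \<sigma> where "clim (\<lambda>i. e (\<sigma> i)) (X k)"
        using X[of k] unfolding S_def by blast
      then have "\<forall>\<^sub>F i in sequentially. cnorm A (e (\<sigma> i) \<ominus> X k) < inverse (real (Suc k))"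
        unfolding clim_def by (intro order_tendstoD(2)) auto
      then show ?thesis
        unfolding eventually_sequentially by blast
    qed
    then obtain \<tau> where \<tau>: "\<And>k. cnorm A (e (\<tau> k) \<ominus> X k) < inverse (real (Suc k))"
      by metis
    have "clim (\<lambda>k. e (\<tau> k)) l"
    proof (rule climI)
      show "cnorm A (e (\<tau> k) \<ominus> l) \<le> inverse (real (Suc k)) + cnorm A (X k \<ominus> l)" for k
        using cnorm_diff_triangle[of "e (\<tau> k)" "X k" l] \<tau>[of k] by simp
      show "(\<lambda>k. inverse (real (Suc k)) + cnorm A (X k \<ominus> l)) \<longlonglongrightarrow> 0"
        using l unfolding clim_def by (intro tendsto_add_zero LIMSEQ_inverse_real_of_nat) auto
    qed simp_all
    then show ?thesis
      by (rule S_I)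
  qed
  ultimately have sub: "cstar_subalgebra A S"
    unfolding cstar_subalgebra_def using closed by (intro conjI allI ballI impI) blast+
  define term_seq where "term_seq l = (SOME \<tau>. clim (\<lambda>k. e (\<tau> k)) l)" for l
  have seq: "clim (\<lambda>k. e (term_seq l k)) l" if "l \<in> S" for l
    unfolding term_seq_def by (rule someI_ex[OF S_D[OF that]])
  have "inj_on (\<lambda>l k. to_nat (term_seq l k)) S"
  proof (rule inj_onI)
    fix x y assume xy: "x \<in> S" "y \<in> S" "(\<lambda>k. to_nat (term_seq x k)) = (\<lambda>k. to_nat (term_seq y k))"
    then have "term_seq x = term_seq y"
      by (auto simp: fun_eq_iff)
    then show "x = y"
      using seq[OF xy(1)] seq[OF xy(2)] clim_unique by metis
  qed
  moreover have "range d \<subseteq> S"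
    using S_I[of "\<lambda>_. Gen _"] clim_const[OF d] by (auto simp: e_def)
  ultimately show thesis
    by (intro that[OF sub])
qed

lemma finitely_generated_subalgebra:
  fixes d :: "nat \<Rightarrow> 'a"
  assumes "d \<in> {1..n} \<rightarrow> carrier A"
  obtains S and \<phi> :: "'a \<Rightarrow> nat \<Rightarrow> nat"
  where "cstar_subalgebra A S" "d ` {1..n} \<subseteq> S" "inj_on \<phi> S"
proof (rule countably_generated_subalgebra[of "\<lambda>i. if i \<in> {1..n} then d i else \<one>"])
  fix S and \<phi> :: "'a \<Rightarrow> nat \<Rightarrow> nat"
  assume S: "cstar_subalgebra A S" "inj_on \<phi> S"
    and "range (\<lambda>i. if i \<in> {1..n} then d i else \<one>) \<subseteq> S"
  then have "d ` {1..n} \<subseteq> S"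
    by (auto simp: image_subset_iff split: if_splits)
  with S show thesis
    using that by blast
qed (use assms in auto)

end

definition transport :: "'a cstar \<Rightarrow> 'a set \<Rightarrow> ('a \<Rightarrow> 'b) \<Rightarrow> 'b cstar" where
  "transport A S \<phi> = (let \<psi> = inv_into S \<phi> in
    \<lparr>carrier = \<phi> ` S, mult = (\<lambda>a b. \<phi> (\<psi> a \<otimes>\<^bsub>A\<^esub> \<psi> b)), one = \<phi> \<one>\<^bsub>A\<^esub>, zero = \<phi> \<zero>\<^bsub>A\<^esub>,
     add = (\<lambda>a b. \<phi> (\<psi> a \<oplus>\<^bsub>A\<^esub> \<psi> b)), smult = (\<lambda>c a. \<phi> (c \<odot>\<^bsub>A\<^esub> \<psi> a)),
     cnorm = (\<lambda>a. cnorm A (\<psi> a)), star = (\<lambda>a. \<phi> (star A (\<psi> a)))\<rparr>)"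

lemma complex_cring: "cring complex_ring"
proof (rule cringI)
  show "abelian_group complex_ring"
    by (rule abelian_groupI) (auto intro!: exI[of _ "- _"])
  show "comm_monoid complex_ring"
    by (rule comm_monoidI) auto
qed (simp add: distrib_right)

context unital_cstar_algebra
begin

context
  fixes S and \<phi> :: "'a \<Rightarrow> 'b"
  assumes sub: "cstar_subalgebra A S" and inj: "inj_on \<phi> S"
begin

lemma subalgebra_in_carrier: "x \<in> S \<Longrightarrow> x \<in> carrier A"
  using sub subringE(1)[of S A] unfolding cstar_subalgebra_def by auto

lemma subalgebra_closed:
  "\<one> \<in> S" "\<zero> \<in> S" "x \<in> S \<Longrightarrow> y \<in> S \<Longrightarrow> x \<oplus> y \<in> S" "x \<in> S \<Longrightarrow> y \<in> S \<Longrightarrow> x \<otimes> y \<in> S"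
  "x \<in> S \<Longrightarrow> c \<odot> x \<in> S" "x \<in> S \<Longrightarrow> star A x \<in> S" "x \<in> S \<Longrightarrow> \<ominus> x \<in> S"
proof -
  have ring: "subring S A" and star: "x \<in> S \<Longrightarrow> c \<odot> x \<in> S" "x \<in> S \<Longrightarrow> star A x \<in> S" for x c
    using sub unfolding cstar_subalgebra_def by simp_all
  note subringE[OF ring, simp]
  show "\<one> \<in> S" "\<zero> \<in> S" "x \<in> S \<Longrightarrow> y \<in> S \<Longrightarrow> x \<oplus> y \<in> S" "x \<in> S \<Longrightarrow> y \<in> S \<Longrightarrow> x \<otimes> y \<in> S"
    "x \<in> S \<Longrightarrow> c \<odot> x \<in> S" "x \<in> S \<Longrightarrow> star A x \<in> S" "x \<in> S \<Longrightarrow> \<ominus> x \<in> S"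
    using star by simp_all
qed

abbreviation "D \<equiv> transport A S \<phi>"

lemma transport_simps:
  "carrier D = \<phi> ` S"
  "\<one>\<^bsub>D\<^esub> = \<phi> \<one>" "\<zero>\<^bsub>D\<^esub> = \<phi> \<zero>"
  "x \<in> S \<Longrightarrow> y \<in> S \<Longrightarrow> \<phi> x \<oplus>\<^bsub>D\<^esub> \<phi> y = \<phi> (x \<oplus> y)"
  "x \<in> S \<Longrightarrow> y \<in> S \<Longrightarrow> \<phi> x \<otimes>\<^bsub>D\<^esub> \<phi> y = \<phi> (x \<otimes> y)"
  "x \<in> S \<Longrightarrow> c \<odot>\<^bsub>D\<^esub> \<phi> x = \<phi> (c \<odot> x)"
  "x \<in> S \<Longrightarrow> star D (\<phi> x) = \<phi> (star A x)"
  "x \<in> S \<Longrightarrow> cnorm D (\<phi> x) = cnorm A x"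
  by (simp_all add: transport_def Let_def inj)

lemma transport_eq_iff: "x \<in> S \<Longrightarrow> y \<in> S \<Longrightarrow> \<phi> x = \<phi> y \<longleftrightarrow> x = y"
  using inj by (simp add: inj_on_eq_iff)

lemmas trans_simps [simp] = transport_simps transport_eq_iff subalgebra_in_carrier subalgebra_closed

lemma abelian_group_transport: "abelian_group D"
proof (rule abelian_groupI)
  fix x assume "x \<in> carrier D"
  then obtain y where "x = \<phi> y" "y \<in> S"
    by auto
  then show "\<exists>z\<in>carrier D. z \<oplus>\<^bsub>D\<^esub> x = \<zero>\<^bsub>D\<^esub>"
    by (intro bexI[of _ "\<phi> (\<ominus> y)"]) (simp_all add: alg.l_neg)
qed (auto simp: alg.a_ac)

lemma ring_transport: "ring D"
proof (rule ringI)
  show "abelian_group D"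
    by (rule abelian_group_transport)
  show "monoid D"
    by (rule monoidI) (auto simp: alg.m_assoc)
qed (auto simp: alg.l_distr alg.r_distr)

lemma module_transport: "module complex_ring D"
  by (rule moduleI[OF complex_cring abelian_group_transport])
    (auto simp: smult_add_left smult_add_right smult_smult)

lemma transport_minus:
  assumes "x \<in> S" "y \<in> S"
  shows "\<phi> x \<ominus>\<^bsub>D\<^esub> \<phi> y = \<phi> (x \<ominus> y)"
proof -
  interpret T: abelian_group D
    by (rule abelian_group_transport)
  have "\<ominus>\<^bsub>D\<^esub> \<phi> y = \<phi> (\<ominus> y)"
    using assms by (intro T.minus_equality) (simp_all add: alg.l_neg)
  then show ?thesis
    using assms by (simp add: a_minus_def)
qed

lemma subalgebra_diff [simp]: "x \<in> S \<Longrightarrow> y \<in> S \<Longrightarrow> x \<ominus> y \<in> S"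
  by (simp add: a_minus_def)

lemma unital_cstar_algebra_transport: "unital_cstar_algebra D"
proof (rule unital_cstar_algebra.intro)
  show "ring D" "module complex_ring D"
    by (rule ring_transport module_transport)+
  fix X :: "nat \<Rightarrow> 'b"
  assume X: "\<And>k. X k \<in> carrier D"
    and cauchy: "\<And>e. 0 < e \<Longrightarrow> \<exists>N. \<forall>j\<ge>N. \<forall>k\<ge>N. cnorm D (X j \<ominus>\<^bsub>D\<^esub> X k) < e"
  have "\<exists>y\<in>S. X k = \<phi> y" for k
    using X[of k] by auto
  then obtain Y where Y: "\<And>k. Y k \<in> S" "\<And>k. X k = \<phi> (Y k)"
    by metis
  have "\<exists>l\<in>carrier A. (\<lambda>k. cnorm A (Y k \<ominus> l)) \<longlonglongrightarrow> 0"
    by (rule complete) (use cauchy Y in \<open>simp_all add: transport_minus\<close>)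
  then obtain l where l: "l \<in> carrier A" "(\<lambda>k. cnorm A (Y k \<ominus> l)) \<longlonglongrightarrow> 0"
    by (rule bexE)
  have "l \<in> S"
    using sub Y(1) l unfolding cstar_subalgebra_def by blast
  then show "\<exists>l\<in>carrier D. (\<lambda>k. cnorm D (X k \<ominus>\<^bsub>D\<^esub> l)) \<longlonglongrightarrow> 0"
    using l Y by (intro bexI[of _ "\<phi> l"]) (simp_all add: transport_minus)
qed (auto simp: smult_mult_left smult_mult_right cnorm_nonneg cnorm_eq_0 cnorm_add cnorm_smult
    cnorm_mult star_add star_smult star_mult cstar_identity)

lemma transport_inv_hom:
  "unital_star_hom D A (restrict (inv_into S \<phi>) (carrier D))"
  unfolding unital_star_hom_def ring_hom_def using inj by auto

lemma transport_hom:
  assumes "S = carrier A"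
  shows "unital_star_hom A D (restrict \<phi> (carrier A))"
  unfolding unital_star_hom_def ring_hom_def assms[symmetric] by auto

end

end

lemma unital_star_hom_compose:
  assumes "unital_star_hom A B f" "unital_star_hom B D g" "unital_cstar_algebra A"
  shows "unital_star_hom A D (restrict (\<lambda>x. g (f x)) (carrier A))"
proof -
  interpret unital_cstar_algebra A by fact
  show ?thesis
    using assms(1,2) unfolding unital_star_hom_def ring_hom_def by (auto simp: Pi_iff)
qed

text \<open>Additivity on a subset \<open>S\<close> suffices; \<open>h\<close> will be an encoding that is injective on a subalgebra only.\<close>

lemma finsum_hom:
  assumes "abelian_group A" "abelian_group B" "finite I"
    and "\<And>x. x \<in> S \<Longrightarrow> x \<in> carrier A" "\<zero>\<^bsub>A\<^esub> \<in> S"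
    and "\<And>x y. x \<in> S \<Longrightarrow> y \<in> S \<Longrightarrow> x \<oplus>\<^bsub>A\<^esub> y \<in> S"
    and "\<And>x. x \<in> S \<Longrightarrow> h x \<in> carrier B" "h \<zero>\<^bsub>A\<^esub> = \<zero>\<^bsub>B\<^esub>"
    and add: "\<And>x y. x \<in> S \<Longrightarrow> y \<in> S \<Longrightarrow> h (x \<oplus>\<^bsub>A\<^esub> y) = h x \<oplus>\<^bsub>B\<^esub> h y"
    and g: "\<And>i. i \<in> I \<Longrightarrow> g i \<in> S"
  shows "finsum A g I \<in> S \<and> h (finsum A g I) = finsum B (\<lambda>i. h (g i)) I"
proof -
  interpret A: abelian_group A by fact
  interpret B: abelian_group B by fact
  show ?thesis
    using assms(3) g
  proof (induction I rule: finite_induct)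
    case (insert i I)
    then show ?case
      using assms(4,6,7) by (simp add: A.finsum_insert B.finsum_insert add Pi_iff)
  qed (use assms(5,8) in simp)
qed

lemma cuntz_family_transport:
  assumes "unital_cstar_algebra A" "cstar_subalgebra A S" "inj_on \<phi> S"
    and fam: "cuntz_family n A d" and d: "\<And>i. i \<in> {1..n} \<Longrightarrow> d i \<in> S"
  shows "cuntz_family n (transport A S \<phi>) (\<lambda>i. \<phi> (d i))"
proof -
  interpret unital_cstar_algebra A by fact
  note [simp] = trans_simps[OF assms(2,3)]
  have "\<phi> (\<Oplus>\<^bsub>A\<^esub>i\<in>{1..n}. d i \<otimes>\<^bsub>A\<^esub> star A (d i)) =
      (\<Oplus>\<^bsub>transport A S \<phi>\<^esub>i\<in>{1..n}. \<phi> (d i \<otimes>\<^bsub>A\<^esub> star A (d i)))"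
    using finsum_hom[OF alg.abelian_group_axioms abelian_group_transport[OF assms(2,3)],
        of "{1..n}" S \<phi> "\<lambda>i. d i \<otimes>\<^bsub>A\<^esub> star A (d i)"] d by simp
  also have "\<dots> = (\<Oplus>\<^bsub>transport A S \<phi>\<^esub>i\<in>{1..n}.
      \<phi> (d i) \<otimes>\<^bsub>transport A S \<phi>\<^esub> star (transport A S \<phi>) (\<phi> (d i)))"
    by (rule abelian_monoid.finsum_cong'
        [OF abelian_group.axioms(1)[OF abelian_group_transport[OF assms(2,3)]]]) (use d in auto)
  finally show ?thesis
    using fam d unfolding cuntz_family_def by auto
qed

text \<open>The family lies in a countably generated subalgebra of the target. This is isomorphic
  to an algebra of sequences, to which the universal property applies.\<close>

lemma cuntz_algebra_universal:
  fixes D :: "'d cstar"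
  assumes "cuntz_algebra n A s" "unital_cstar_algebra D" "cuntz_family n D d"
  obtains f where "unital_star_hom A D f" "\<And>i. i \<in> {1..n} \<Longrightarrow> f (s i) = d i"
proof -
  interpret A: unital_cstar_algebra A
    using assms(1) unfolding cuntz_algebra_def by blast
  interpret D: unital_cstar_algebra D by fact
  have "d \<in> {1..n} \<rightarrow> carrier D"
    using assms(3) unfolding cuntz_family_def by blast
  then obtain S and \<phi> :: "'d \<Rightarrow> nat \<Rightarrow> nat"
    where S: "cstar_subalgebra D S" "d ` {1..n} \<subseteq> S" "inj_on \<phi> S"
    by (rule D.finitely_generated_subalgebra)
  have dS: "d i \<in> S" if "i \<in> {1..n}" for i
    using S(2) that by blast
  obtain f where f: "unital_star_hom A (transport D S \<phi>) f" "\<forall>i\<in>{1..n}. f (s i) = \<phi> (d i)"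
    using assms(1) D.unital_cstar_algebra_transport[OF S(1,3)]
      cuntz_family_transport[OF assms(2) S(1,3) assms(3) dS]
    unfolding cuntz_algebra_def by metis
  let ?g = "restrict (inv_into S \<phi>) (carrier (transport D S \<phi>))"
  have "unital_star_hom A D (restrict (\<lambda>x. ?g (f x)) (carrier A))"
    by (rule unital_star_hom_compose[OF f(1) D.transport_inv_hom[OF S(1,3)] A.unital_cstar_algebra_axioms])
  moreover have "restrict (\<lambda>x. ?g (f x)) (carrier A) (s i) = d i" if "i \<in> {1..n}" for i
    using that f(2) dS[OF that] assms(1) S(3)
    by (auto simp: cuntz_algebra_def cuntz_family_def D.transport_simps[OF S(1,3)] Pi_iff)
  ultimately show thesis
    using that by blast
qed

lemma star_hom_cuntz_family_inf:
  assumes "unital_cstar_algebra A" "unital_cstar_algebra B" "unital_star_hom A B g"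
    "cuntz_family_inf A d"
  shows "cuntz_family_inf B (\<lambda>i. g (d i))"
proof -
  let ?p = "\<lambda>k. \<Oplus>\<^bsub>A\<^esub>j\<in>{1..k}. d j \<otimes>\<^bsub>A\<^esub> star A (d j)"
  let ?q = "\<lambda>k. \<Oplus>\<^bsub>B\<^esub>j\<in>{1..k}. g (d j) \<otimes>\<^bsub>B\<^esub> star B (g (d j))"
  interpret A: unital_cstar_algebra A by fact
  interpret B: unital_cstar_algebra B by fact
  have g: "x \<in> carrier A \<Longrightarrow> g x \<in> carrier B"
    "x \<in> carrier A \<Longrightarrow> y \<in> carrier A \<Longrightarrow> g (x \<oplus>\<^bsub>A\<^esub> y) = g x \<oplus>\<^bsub>B\<^esub> g y"
    "x \<in> carrier A \<Longrightarrow> y \<in> carrier A \<Longrightarrow> g (x \<otimes>\<^bsub>A\<^esub> y) = g x \<otimes>\<^bsub>B\<^esub> g y"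
    "x \<in> carrier A \<Longrightarrow> g (c \<odot>\<^bsub>A\<^esub> x) = c \<odot>\<^bsub>B\<^esub> g x"
    "x \<in> carrier A \<Longrightarrow> g (star A x) = star B (g x)" "g \<one>\<^bsub>A\<^esub> = \<one>\<^bsub>B\<^esub>" for x y c
    using assms(3) unfolding unital_star_hom_def ring_hom_def by auto
  have g0: "g \<zero>\<^bsub>A\<^esub> = \<zero>\<^bsub>B\<^esub>"
    using g(4)[of "\<one>\<^bsub>A\<^esub>" 0] by (simp add: g)
  have gm: "g (x \<ominus>\<^bsub>A\<^esub> y) = g x \<ominus>\<^bsub>B\<^esub> g y" if "x \<in> carrier A" "y \<in> carrier A" for x y
    using that by (simp add: a_minus_def A.minus_smult B.minus_smult g)
  have d: "d i \<in> carrier A" if "i \<ge> 1" for i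
    using assms(4) that unfolding cuntz_family_inf_def by auto
  have sum: "g (?p k) = ?q k" for k
  proof -
    have "g (?p k) =
        (\<Oplus>\<^bsub>B\<^esub>j\<in>{1..k}. g (d j \<otimes>\<^bsub>A\<^esub> star A (d j)))"
      using finsum_hom[OF A.alg.abelian_group_axioms B.alg.abelian_group_axioms,
          of "{1..k}" "carrier A" g "\<lambda>i. d i \<otimes>\<^bsub>A\<^esub> star A (d i)"] d by (simp add: g g0)
    also have "\<dots> = ?q k"
      by (rule B.alg.finsum_cong') (use d in \<open>auto simp: g\<close>)
    finally show ?thesis .
  qed
  have mono: "cstar_le B (g x) (g y)" if "cstar_le A x y" "x \<in> carrier A" "y \<in> carrier A" for x y
    using that unfolding cstar_le_def by (metis g(1,3,5) gm A.star_closed)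
  have closed: "?p k \<in> carrier A" for k
    using d by (intro A.alg.finsum_closed) auto
  have "cstar_le B (?q k) \<one>\<^bsub>B\<^esub>" if "k \<ge> 1" for k
  proof -
    have "cstar_le A (?p k) \<one>\<^bsub>A\<^esub>"
      using assms(4) that unfolding cuntz_family_inf_def by blast
    from mono[OF this closed A.alg.one_closed] show ?thesis
      unfolding sum g(6) .
  qed
  moreover have "star B (g (d i)) \<otimes>\<^bsub>B\<^esub> g (d j) = (if i = j then \<one>\<^bsub>B\<^esub> else \<zero>\<^bsub>B\<^esub>)"
    if "i \<ge> 1" "j \<ge> 1" for i j
  proof -
    have "star A (d i) \<otimes>\<^bsub>A\<^esub> d j = (if i = j then \<one>\<^bsub>A\<^esub> else \<zero>\<^bsub>A\<^esub>)"
      using assms(4) that unfolding cuntz_family_inf_def by blast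
    then have "g (star A (d i) \<otimes>\<^bsub>A\<^esub> d j) = (if i = j then \<one>\<^bsub>B\<^esub> else \<zero>\<^bsub>B\<^esub>)"
      by (simp add: g g0)
    then show ?thesis
      using d that by (simp add: g)
  qed
  ultimately show ?thesis
    unfolding cuntz_family_inf_def using d g by auto
qed

text \<open>A Cuntz algebra with finitely many generators is isomorphic, as a whole, to an algebra of sequences.
  Along the isomorphism both existence and uniqueness are inherited.\<close>

lemma cuntz_algebra_inf_universal:
  fixes C :: "'c cstar" and B :: "'b cstar"
  assumes C: "cuntz_algebra_inf C t" and B: "cuntz_algebra m B r"
    and d: "cuntz_family_inf B d"
  shows "\<exists>!f. unital_star_hom C B f \<and> (\<forall>i\<ge>1. f (t i) = d i)"
proof -
  interpret C: unital_cstar_algebra C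
    using C unfolding cuntz_algebra_inf_def by blast
  interpret B: unital_cstar_algebra B
    using B unfolding cuntz_algebra_def by blast
  have "r \<in> {1..m} \<rightarrow> carrier B"
    using B unfolding cuntz_algebra_def cuntz_family_def by blast
  then obtain S and \<phi> :: "'b \<Rightarrow> nat \<Rightarrow> nat"
    where S: "cstar_subalgebra B S" "r ` {1..m} \<subseteq> S" "inj_on \<phi> S"
    by (rule B.finitely_generated_subalgebra)
  have SB: "S = carrier B"
    using B S(1,2) unfolding cuntz_algebra_def generates_cstar_def by blast
  define D where "D = transport B S \<phi>"
  have D: "unital_cstar_algebra D"
    unfolding D_def by (rule B.unital_cstar_algebra_transport[OF S(1,3)])
  have carrier_D: "carrier D = \<phi> ` carrier B"
    using B.transport_simps(1)[OF S(1,3)] unfolding D_def by (simp add: SB)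
  let ?\<phi> = "restrict \<phi> (carrier B)"
  let ?\<psi> = "restrict (inv_into S \<phi>) (carrier D)"
  have \<phi>: "unital_star_hom B D ?\<phi>"
    unfolding D_def by (rule B.transport_hom[OF S(1,3) SB])
  have \<psi>: "unital_star_hom D B ?\<psi>"
    unfolding D_def by (rule B.transport_inv_hom[OF S(1,3)])
  have t: "t i \<in> carrier C" if "i \<ge> 1" for i
    using C that unfolding cuntz_algebra_inf_def cuntz_family_inf_def by auto
  have dB: "d i \<in> carrier B" if "i \<ge> 1" for i
    using d that unfolding cuntz_family_inf_def by auto
  have ex1: "\<exists>!f. unital_star_hom C D f \<and> (\<forall>i\<ge>1. f (t i) = ?\<phi> (d i))"
    using C D star_hom_cuntz_family_inf[OF B.unital_cstar_algebra_axioms D \<phi> d]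
    unfolding cuntz_algebra_inf_def by blast
  show ?thesis
  proof (rule ex_ex1I)
    obtain f where f: "unital_star_hom C D f" "\<forall>i\<ge>1. f (t i) = ?\<phi> (d i)"
      using ex1 by blast
    have "unital_star_hom C B (restrict (\<lambda>x. ?\<psi> (f x)) (carrier C))"
      by (rule unital_star_hom_compose[OF f(1) \<psi> C.unital_cstar_algebra_axioms])
    moreover have "restrict (\<lambda>x. ?\<psi> (f x)) (carrier C) (t i) = d i" if "i \<ge> 1" for i
      using that f(2) t dB S(3) by (simp add: carrier_D SB)
    ultimately show "\<exists>f. unital_star_hom C B f \<and> (\<forall>i\<ge>1. f (t i) = d i)"
      by blast
  next
    fix f g
    assume f: "unital_star_hom C B f \<and> (\<forall>i\<ge>1. f (t i) = d i)"
      and g: "unital_star_hom C B g \<and> (\<forall>i\<ge>1. g (t i) = d i)"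
    have "restrict (\<lambda>x. ?\<phi> (f x)) (carrier C) = restrict (\<lambda>x. ?\<phi> (g x)) (carrier C)"
    proof -
      have "unital_star_hom C D (restrict (\<lambda>x. ?\<phi> (h x)) (carrier C)) \<and>
          (\<forall>i\<ge>1. restrict (\<lambda>x. ?\<phi> (h x)) (carrier C) (t i) = ?\<phi> (d i))"
        if "unital_star_hom C B h \<and> (\<forall>i\<ge>1. h (t i) = d i)" for h
        using unital_star_hom_compose[OF _ \<phi> C.unital_cstar_algebra_axioms, of h] that t by simp
      from this[OF f] this[OF g] show ?thesis
        using ex1 by blast
    qed
    then have *: "?\<phi> (f x) = ?\<phi> (g x)" if "x \<in> carrier C" for x
      using that by (simp only: fun_eq_iff restrict_apply split: if_splits) metis
    show "f = g"
    proof (rule extensionalityI)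
      show "f \<in> extensional (carrier C)" "g \<in> extensional (carrier C)"
        using f g unfolding unital_star_hom_def by blast+
      fix x assume x: "x \<in> carrier C"
      have "f x \<in> S" "g x \<in> S"
        using f g x unfolding unital_star_hom_def SB by (blast intro: ring_hom_closed)+
      then show "f x = g x"
        using *[OF x] inj_onD[OF S(3)] unfolding SB by simp
    qed
  qed
qed


section \<open>The C*-algebra of adjointable operators\<close>

text \<open>Having an adjoint is part of the definition, so that closure under the star is immediate.
  Linearity follows from it.\<close>

definition adjointable_ops :: "'h::chilbert_space set \<Rightarrow> ('h \<Rightarrow> 'h) set" where
  "adjointable_ops H = {X \<in> extensional H. (\<exists>X'. adjoint_on H X X') \<and>
    (\<exists>b. \<forall>x\<in>H. norm (X x) \<le> b * norm x)}"

definition op_norm :: "'h::chilbert_space set \<Rightarrow> ('h \<Rightarrow> 'h) \<Rightarrow> real" where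
  "op_norm H X = Inf {b. 0 \<le> b \<and> (\<forall>x\<in>H. norm (X x) \<le> b * norm x)}"

definition adjointable_algebra :: "'h::chilbert_space set \<Rightarrow> ('h \<Rightarrow> 'h) cstar" where
  "adjointable_algebra H = \<lparr>carrier = adjointable_ops H, mult = compose H, one = (\<lambda>x\<in>H. x),
    zero = (\<lambda>x\<in>H. 0), add = (\<lambda>X Y. \<lambda>x\<in>H. X x + Y x), smult = (\<lambda>c X. \<lambda>x\<in>H. c *\<^sub>C X x),
    cnorm = op_norm H, star = op_adjoint H\<rparr>"

lemma adjointable_algebra_simps [simp]:
  "carrier (adjointable_algebra H) = adjointable_ops H"
  "mult (adjointable_algebra H) = compose H"
  "\<one>\<^bsub>adjointable_algebra H\<^esub> = (\<lambda>x\<in>H. x)" "\<zero>\<^bsub>adjointable_algebra H\<^esub> = (\<lambda>x\<in>H. 0)"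
  "X \<oplus>\<^bsub>adjointable_algebra H\<^esub> Y = (\<lambda>x\<in>H. X x + Y x)"
  "c \<odot>\<^bsub>adjointable_algebra H\<^esub> X = (\<lambda>x\<in>H. c *\<^sub>C X x)"
  "cnorm (adjointable_algebra H) = op_norm H" "star (adjointable_algebra H) = op_adjoint H"
  by (simp_all add: adjointable_algebra_def)

lemma bounded_ops_iff: "X \<in> bounded_ops H \<longleftrightarrow> X \<in> extensional H \<and> bounded_map H H X"
  unfolding bounded_ops_def bounded_map_def by auto

lemma adjoint_on_restrict: "adjoint_on H X X' \<Longrightarrow> adjoint_on H (restrict X H) (restrict X' H)"
  unfolding adjoint_on_def by auto

lemma adjoint_on_restrict_left: "adjoint_on H X X' \<Longrightarrow> adjoint_on H (restrict X H) X'"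
  unfolding adjoint_on_def by auto

text \<open>Cancel \<open>\<parallel>X' y\<parallel>\<close> in \<open>\<parallel>X' y\<parallel>\<^sup>2 = \<langle>X (X' y), y\<rangle> \<le> b \<parallel>X' y\<parallel> \<parallel>y\<parallel>\<close>.\<close>

lemma adjoint_bound:
  assumes "adjoint_on H X X'" "\<And>x. x \<in> H \<Longrightarrow> norm (X x) \<le> b * norm x" "y \<in> H"
  shows "norm (X' y) \<le> b * norm y"
proof (cases "X' y = 0")
  case True
  show ?thesis
  proof (cases "y = 0")
    case False
    then have "0 \<le> b * norm y"
      using assms(2)[OF assms(3)] by (meson norm_ge_zero order_trans)
    then show ?thesis
      using True by simp
  qed (use True in simp)
next
  case False
  have "complex_of_real ((norm (X' y))\<^sup>2) = cinner (X (X' y)) y"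
    using adjoint_onD[OF assms(1)] assms(3) by (simp add: cinner_self)
  then have "(norm (X' y))\<^sup>2 = cmod (cinner (X (X' y)) y)"
    by (metis abs_power2 norm_of_real real_norm_def)
  also have "\<dots> \<le> (b * norm (X' y)) * norm y"
    using norm_cinner_le[of "X (X' y)" y] assms(2)[OF adjoint_onD(2)[OF assms(1,3)]]
    by (meson mult_right_mono norm_ge_zero order_trans)
  finally have "norm (X' y) * norm (X' y) \<le> (b * norm y) * norm (X' y)"
    by (simp add: power2_eq_square ac_simps)
  then show ?thesis
    using False by simp
qed

context
  fixes H :: "'h::chilbert_space set"
  assumes H: "hilbert_subspace H"
begin

lemma op_adjointI:
  assumes "adjoint_on H X X'" "\<And>x. x \<in> H \<Longrightarrow> norm (X x) \<le> b * norm x"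
  shows "op_adjoint H X = restrict X' H"
  unfolding op_adjoint_def
proof (rule the_equality)
  have "bounded_map H H X'"
    by (rule bounded_map_adjoint_on[OF H adjoint_on_sym[OF assms(1)]])
      (rule adjoint_bound[OF assms])
  then have "bounded_map H H (restrict X' H)"
    using H unfolding bounded_map_def by (auto simp: hilbert_subspace_add hilbert_subspace_scaleC)
  then show "restrict X' H \<in> bounded_ops H \<and>
      (\<forall>x\<in>H. \<forall>y\<in>H. cinner (X x) y = cinner x (restrict X' H y))"
    using adjoint_onD(3)[OF assms(1)] by (simp add: bounded_ops_iff)
next
  fix S assume S: "S \<in> bounded_ops H \<and> (\<forall>x\<in>H. \<forall>y\<in>H. cinner (X x) y = cinner x (S y))"
  show "S = restrict X' H"
  proof (rule extensionalityI)
    fix y assume y: "y \<in> H"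
    have "S y = X' y"
    proof (rule cinner_eqI_on[OF H])
      show "S y \<in> H"
        using S y unfolding bounded_ops_def by blast
      show "X' y \<in> H"
        by (rule adjoint_onD(2)[OF assms(1) y])
      fix z assume "z \<in> H"
      then have "cinner z (S y) = cinner z (X' y)"
        using S y adjoint_onD(3)[OF assms(1)] by metis
      then show "cinner (S y) z = cinner (X' y) z"
        by (metis cinner_commute)
    qed
    then show "S y = restrict X' H y"
      using y by simp
  qed (use S in \<open>auto simp: bounded_ops_def\<close>)
qed

abbreviation "Ops \<equiv> adjointable_ops H"

lemma adjointable_opsI:
  assumes "adjoint_on H X X'" "\<And>x. x \<in> H \<Longrightarrow> norm (X x) \<le> b * norm x"
  shows "restrict X H \<in> Ops" "op_adjoint H (restrict X H) = restrict X' H"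
  using assms adjoint_on_restrict[OF assms(1)] op_adjointI[of "restrict X H" X' b]
  by (auto simp: adjointable_ops_def adjoint_on_restrict_left)

lemma adjointable_opsE:
  assumes "X \<in> Ops"
  obtains b where "0 \<le> b" "\<And>x. x \<in> H \<Longrightarrow> norm (X x) \<le> b * norm x"
proof -
  obtain b where b: "\<forall>x\<in>H. norm (X x) \<le> b * norm x"
    using assms unfolding adjointable_ops_def by blast
  have "norm (X x) \<le> \<bar>b\<bar> * norm x" if "x \<in> H" for x
    using b that by (meson abs_ge_self mult_right_mono norm_ge_zero order_trans)
  then show thesis
    using that[of "\<bar>b\<bar>"] by simp
qed

lemma adjoint_on_op_adjoint:
  assumes "X \<in> Ops"
  shows "adjoint_on H X (op_adjoint H X)" "op_adjoint H X \<in> Ops"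
    "op_adjoint H (op_adjoint H X) = X"
proof -
  obtain X' where X': "adjoint_on H X X'"
    using assms unfolding adjointable_ops_def by blast
  obtain b where b: "\<And>x. x \<in> H \<Longrightarrow> norm (X x) \<le> b * norm x"
    by (rule adjointable_opsE[OF assms]) blast
  have X: "X = restrict X H"
    using assms unfolding adjointable_ops_def by (simp add: extensional_restrict)
  note eq = op_adjointI[OF X' b]
  show "adjoint_on H X (op_adjoint H X)"
    using adjoint_on_restrict[OF X'] X eq by simp
  note adj' = adjointable_opsI[OF adjoint_on_sym[OF X'] adjoint_bound[OF X' b]]
  show "op_adjoint H X \<in> Ops" "op_adjoint H (op_adjoint H X) = X"
    using adj' X eq by simp_all
qed

lemma bounded_map_adjointable: "X \<in> Ops \<Longrightarrow> bounded_map H H X"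
  by (metis adjointable_opsE bounded_map_adjoint_on[OF H] adjoint_on_op_adjoint(1))

lemma adjointable_bounded_ops: "X \<in> Ops \<Longrightarrow> X \<in> bounded_ops H"
  using bounded_map_adjointable unfolding bounded_ops_iff adjointable_ops_def by blast

lemma op_norm_le: "0 \<le> b \<Longrightarrow> (\<And>x. x \<in> H \<Longrightarrow> norm (X x) \<le> b * norm x) \<Longrightarrow> op_norm H X \<le> b"
  unfolding op_norm_def by (rule cInf_lower) (auto intro: bdd_belowI)

lemma op_norm_bounds_nonempty:
  "X \<in> Ops \<Longrightarrow> {b. 0 \<le> b \<and> (\<forall>x\<in>H. norm (X x) \<le> b * norm x)} \<noteq> {}"
  by (erule adjointable_opsE) auto

lemma op_norm_nonneg: "X \<in> Ops \<Longrightarrow> 0 \<le> op_norm H X"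
  unfolding op_norm_def by (rule cInf_greatest[OF op_norm_bounds_nonempty]) auto

lemma op_norm_bound:
  assumes "X \<in> Ops" "x \<in> H"
  shows "norm (X x) \<le> op_norm H X * norm x"
proof (cases "norm x = 0")
  case True
  then show ?thesis
    using adjointable_opsE[OF assms(1)] assms(2) by (metis mult_zero_right)
next
  case False
  then have "norm (X x) / norm x \<le> op_norm H X"
    unfolding op_norm_def
    by (intro cInf_greatest[OF op_norm_bounds_nonempty[OF assms(1)]])
      (use assms(2) in \<open>auto simp: divide_le_eq\<close>)
  then show ?thesis
    using False by (simp add: divide_le_eq)
qed

lemma adjointable_in [simp]: "X \<in> Ops \<Longrightarrow> x \<in> H \<Longrightarrow> X x \<in> H"
  using bounded_map_adjointable bounded_map_in[OF H] by blast

lemma op_adjoint_in [simp]: "X \<in> Ops \<Longrightarrow> op_adjoint H X \<in> Ops"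
  by (rule adjoint_on_op_adjoint)

lemma cinner_op_adjoint:
  "X \<in> Ops \<Longrightarrow> x \<in> H \<Longrightarrow> y \<in> H \<Longrightarrow> cinner (X x) y = cinner x (op_adjoint H X y)"
  using adjoint_on_op_adjoint(1) adjoint_onD(3) by blast

lemma adjointable_ext:
  "X \<in> Ops \<Longrightarrow> Y \<in> Ops \<Longrightarrow> (\<And>x. x \<in> H \<Longrightarrow> X x = Y x) \<Longrightarrow> X = Y"
  unfolding adjointable_ops_def by (auto intro: extensionalityI)

lemma adjointable_add:
  assumes "X \<in> Ops" "Y \<in> Ops"
  shows "(\<lambda>x\<in>H. X x + Y x) \<in> Ops"
    "op_adjoint H (\<lambda>x\<in>H. X x + Y x) = (\<lambda>x\<in>H. op_adjoint H X x + op_adjoint H Y x)"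
    "op_norm H (\<lambda>x\<in>H. X x + Y x) \<le> op_norm H X + op_norm H Y"
proof -
  have le: "norm (X x + Y x) \<le> (op_norm H X + op_norm H Y) * norm x" if "x \<in> H" for x
    using norm_triangle_ineq[of "X x" "Y x"] op_norm_bound[OF assms(1) that]
      op_norm_bound[OF assms(2) that] by (simp add: algebra_simps)
  show "(\<lambda>x\<in>H. X x + Y x) \<in> Ops"
    "op_adjoint H (\<lambda>x\<in>H. X x + Y x) = (\<lambda>x\<in>H. op_adjoint H X x + op_adjoint H Y x)"
    by (rule adjointable_opsI[OF adjoint_on_add[OF H adjoint_on_op_adjoint(1)[OF assms(1)]
          adjoint_on_op_adjoint(1)[OF assms(2)]] le]; assumption)+
  show "op_norm H (\<lambda>x\<in>H. X x + Y x) \<le> op_norm H X + op_norm H Y"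
    by (rule op_norm_le) (use le op_norm_nonneg assms in auto)
qed

lemma adjoint_on_scaleC: "adjoint_on H X X' \<Longrightarrow> adjoint_on H (\<lambda>x. c *\<^sub>C X x) (\<lambda>x. cnj c *\<^sub>C X' x)"
  unfolding adjoint_on_def
  by (auto simp: Pi_iff cinner_scaleC_left cinner_scaleC_right hilbert_subspace_scaleC[OF H])

lemma adjointable_scaleC:
  assumes "X \<in> Ops"
  shows "(\<lambda>x\<in>H. c *\<^sub>C X x) \<in> Ops"
    "op_adjoint H (\<lambda>x\<in>H. c *\<^sub>C X x) = (\<lambda>x\<in>H. cnj c *\<^sub>C op_adjoint H X x)"
    "op_norm H (\<lambda>x\<in>H. c *\<^sub>C X x) \<le> cmod c * op_norm H X"
proof -
  have le: "norm (c *\<^sub>C X x) \<le> (cmod c * op_norm H X) * norm x" if "x \<in> H" for x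
    using op_norm_bound[OF assms that] by (simp add: norm_scaleC mult.assoc mult_left_mono)
  show "(\<lambda>x\<in>H. c *\<^sub>C X x) \<in> Ops"
    "op_adjoint H (\<lambda>x\<in>H. c *\<^sub>C X x) = (\<lambda>x\<in>H. cnj c *\<^sub>C op_adjoint H X x)"
    by (rule adjointable_opsI[OF adjoint_on_scaleC[OF adjoint_on_op_adjoint(1)[OF assms]] le];
        assumption)+
  show "op_norm H (\<lambda>x\<in>H. c *\<^sub>C X x) \<le> cmod c * op_norm H X"
    by (rule op_norm_le) (use le op_norm_nonneg assms in auto)
qed

lemma adjointable_uminus: "X \<in> Ops \<Longrightarrow> (\<lambda>x\<in>H. - X x) \<in> Ops"
  using adjointable_scaleC(1)[of X "-1"] by (simp add: scaleC_minus1)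

lemma adjointable_compose:
  assumes "X \<in> Ops" "Y \<in> Ops"
  shows "compose H X Y \<in> Ops"
    "op_adjoint H (compose H X Y) = compose H (op_adjoint H Y) (op_adjoint H X)"
    "op_norm H (compose H X Y) \<le> op_norm H X * op_norm H Y"
proof -
  have le: "norm (X (Y x)) \<le> (op_norm H X * op_norm H Y) * norm x" if "x \<in> H" for x
  proof -
    have "norm (X (Y x)) \<le> op_norm H X * norm (Y x)"
      by (rule op_norm_bound) (use assms that in auto)
    also have "\<dots> \<le> op_norm H X * (op_norm H Y * norm x)"
      by (intro mult_left_mono op_norm_bound op_norm_nonneg assms that)
    finally show ?thesis
      by (simp add: mult.assoc)
  qed
  show "compose H X Y \<in> Ops"
    "op_adjoint H (compose H X Y) = compose H (op_adjoint H Y) (op_adjoint H X)"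
    unfolding compose_def
    by (rule adjointable_opsI[OF adjoint_on_comp[OF adjoint_on_op_adjoint(1)[OF assms(1)]
          adjoint_on_op_adjoint(1)[OF assms(2)]] le]; assumption)+
  show "op_norm H (compose H X Y) \<le> op_norm H X * op_norm H Y"
    by (rule op_norm_le) (use le op_norm_nonneg assms in \<open>auto simp: compose_def\<close>)
qed

lemma adjointable_one: "(\<lambda>x\<in>H. x) \<in> Ops" "op_adjoint H (\<lambda>x\<in>H. x) = (\<lambda>x\<in>H. x)"
  by (rule adjointable_opsI[of "\<lambda>x. x" "\<lambda>x. x" 1]; simp add: adjoint_on_def)+

lemma adjointable_zero: "(\<lambda>x\<in>H. 0) \<in> Ops" "op_adjoint H (\<lambda>x\<in>H. 0) = (\<lambda>x\<in>H. 0)"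
  by (rule adjointable_opsI[of "\<lambda>x. 0" "\<lambda>x. 0" 1];
      simp add: adjoint_on_def hilbert_subspace_zero[OF H])+

lemmas adjointable_simps = adjointable_add(1) adjointable_uminus adjointable_scaleC(1) adjointable_compose(1)
  adjointable_one(1) adjointable_zero(1)

abbreviation "Alg \<equiv> adjointable_algebra H"

lemma abelian_group_adjointable: "abelian_group Alg"
proof (rule abelian_groupI)
  fix X assume "X \<in> carrier Alg"
  then show "\<exists>Y\<in>carrier Alg. Y \<oplus>\<^bsub>Alg\<^esub> X = \<zero>\<^bsub>Alg\<^esub>"
    by (intro bexI[of _ "\<lambda>x\<in>H. (-1) *\<^sub>C X x"])
      (auto simp: adjointable_simps scaleC_minus1 fun_eq_iff)
qed (auto intro!: adjointable_ext simp: adjointable_simps ac_simps hilbert_subspace_zero[OF H]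
    restrict_apply' simp del: restrict_apply)

lemma adjointable_restrict: "X \<in> Ops \<Longrightarrow> restrict X H = X"
  unfolding adjointable_ops_def by (simp add: extensional_restrict)

lemma compose_adjointable: "x \<in> H \<Longrightarrow> compose H X Y x = X (Y x)"
  by (simp add: compose_def)

lemma monoid_adjointable: "monoid Alg"
proof (rule monoidI)
  fix X Y Z assume "X \<in> carrier Alg" "Y \<in> carrier Alg" "Z \<in> carrier Alg"
  then show "X \<otimes>\<^bsub>Alg\<^esub> Y \<otimes>\<^bsub>Alg\<^esub> Z = X \<otimes>\<^bsub>Alg\<^esub> (Y \<otimes>\<^bsub>Alg\<^esub> Z)"
    by (intro adjointable_ext) (auto simp: adjointable_simps compose_adjointable)
next
  fix X assume "X \<in> carrier Alg"
  then show "\<one>\<^bsub>Alg\<^esub> \<otimes>\<^bsub>Alg\<^esub> X = X" "X \<otimes>\<^bsub>Alg\<^esub> \<one>\<^bsub>Alg\<^esub> = X"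
    by (intro adjointable_ext; auto simp: adjointable_simps compose_adjointable)+
qed (auto simp: adjointable_simps)

lemma ring_adjointable: "ring Alg"
proof (rule ringI)
  fix X Y Z assume "X \<in> carrier Alg" "Y \<in> carrier Alg" "Z \<in> carrier Alg"
  then show "(X \<oplus>\<^bsub>Alg\<^esub> Y) \<otimes>\<^bsub>Alg\<^esub> Z = X \<otimes>\<^bsub>Alg\<^esub> Z \<oplus>\<^bsub>Alg\<^esub> Y \<otimes>\<^bsub>Alg\<^esub> Z"
    "Z \<otimes>\<^bsub>Alg\<^esub> (X \<oplus>\<^bsub>Alg\<^esub> Y) = Z \<otimes>\<^bsub>Alg\<^esub> X \<oplus>\<^bsub>Alg\<^esub> Z \<otimes>\<^bsub>Alg\<^esub> Y"
    by (intro adjointable_ext; auto simp: adjointable_simps compose_adjointable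
        bounded_map_add[OF H bounded_map_adjointable])+
qed (rule abelian_group_adjointable monoid_adjointable)+

lemma module_adjointable: "module complex_ring Alg"
  by (rule moduleI[OF complex_cring abelian_group_adjointable])
    (auto simp: adjointable_simps scaleC_add_left scaleC_add_right scaleC_scaleC fun_eq_iff
      hilbert_subspace_scaleC[OF H] hilbert_subspace_add[OF H] adjointable_restrict)

lemma adjointable_minus:
  assumes "X \<in> Ops" "Y \<in> Ops"
  shows "X \<ominus>\<^bsub>Alg\<^esub> Y = (\<lambda>x\<in>H. X x - Y x)"
proof -
  interpret abelian_group Alg
    by (rule abelian_group_adjointable)
  have "\<ominus>\<^bsub>Alg\<^esub> Y = (\<lambda>x\<in>H. (-1) *\<^sub>C Y x)"
    using assms by (intro minus_equality) (auto simp: adjointable_simps scaleC_minus1 fun_eq_iff)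
  then show ?thesis
    by (auto simp: a_minus_def scaleC_minus1 fun_eq_iff)
qed

text \<open>A Cauchy sequence converges pointwise, and so does the sequence of adjoints by \<open>adjoint_bound\<close>; the
  two pointwise limits are adjoint to each other, and the convergence is uniform on bounded sets.\<close>

lemma adjointable_complete:
  assumes X: "\<And>k. X k \<in> Ops"
    and cauchy: "\<And>e. 0 < e \<Longrightarrow> \<exists>N. \<forall>j\<ge>N. \<forall>k\<ge>N. op_norm H (X j \<ominus>\<^bsub>Alg\<^esub> X k) < e"
  shows "\<exists>Y\<in>Ops. (\<lambda>k. op_norm H (X k \<ominus>\<^bsub>Alg\<^esub> Y)) \<longlonglongrightarrow> 0"
proof -
  interpret alg: abelian_group Alg
    by (rule abelian_group_adjointable)
  have diff_in: "X j \<ominus>\<^bsub>Alg\<^esub> X k \<in> Ops" for j k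
    using alg.minus_closed[of "X j" "X k"] X by simp
  have close: "\<exists>N. \<forall>j\<ge>N. \<forall>k\<ge>N. \<forall>x\<in>H. norm (X j x - X k x) \<le> e * norm x" if e: "0 < e" for e
  proof -
    obtain N where N: "\<And>j k. j \<ge> N \<Longrightarrow> k \<ge> N \<Longrightarrow> op_norm H (X j \<ominus>\<^bsub>Alg\<^esub> X k) < e"
      using cauchy[OF e] by blast
    have "norm (X j x - X k x) \<le> e * norm x" if "j \<ge> N" "k \<ge> N" "x \<in> H" for j k x
    proof -
      have "norm (X j x - X k x) \<le> op_norm H (X j \<ominus>\<^bsub>Alg\<^esub> X k) * norm x"
        using op_norm_bound[OF diff_in that(3), of j k] that(3) X
        by (simp add: adjointable_minus)
      also have "\<dots> \<le> e * norm x"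
        using N[OF that(1,2)] by (intro mult_right_mono) auto
      finally show ?thesis .
    qed
    then show ?thesis
      by blast
  qed
  let ?X' = "\<lambda>k. op_adjoint H (X k)"
  have adj: "adjoint_on H (X k) (?X' k)" for k
    by (rule adjoint_on_op_adjoint(1)[OF X])
  have conv: "convergent (\<lambda>k. Z k x)"
    if x: "x \<in> H" and Z: "\<And>e. 0 < e \<Longrightarrow> \<exists>N. \<forall>j\<ge>N. \<forall>k\<ge>N. \<forall>x\<in>H. norm (Z j x - Z k x) \<le> e * norm x"
    for x and Z :: "nat \<Rightarrow> 'h \<Rightarrow> 'h"
  proof (rule Cauchy_convergent, rule CauchyI)
    fix e :: real assume "0 < e"
    define d where "d = e / (norm x + 1)"
    have d: "0 < d"
      using \<open>0 < e\<close> norm_ge_zero[of x] unfolding d_def by (intro divide_pos_pos) linarith+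
    have "d * norm x < d * (norm x + 1)"
      using d by simp
    also have "\<dots> = e"
      using norm_ge_zero[of x] unfolding d_def by (simp add: add_nonneg_eq_0_iff)
    finally show "\<exists>N. \<forall>j\<ge>N. \<forall>k\<ge>N. norm (Z j x - Z k x) < e"
      using Z[OF d] x by (meson le_less_trans)
  qed
  have close': "\<exists>N. \<forall>j\<ge>N. \<forall>k\<ge>N. \<forall>x\<in>H. norm (?X' j x - ?X' k x) \<le> e * norm x" if e: "0 < e" for e
  proof -
    obtain N where N: "\<And>j k x. j \<ge> N \<Longrightarrow> k \<ge> N \<Longrightarrow> x \<in> H \<Longrightarrow> norm (X j x - X k x) \<le> e * norm x"
      using close[OF e] by blast
    have "norm (?X' j x - ?X' k x) \<le> e * norm x" if "j \<ge> N" "k \<ge> N" "x \<in> H" for j k x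
      by (rule adjoint_bound[OF adjoint_on_diff[OF H adj[of j] adj[of k]]]) (use N that in auto)
    then show ?thesis
      by blast
  qed
  define Y where "Y = (\<lambda>x. lim (\<lambda>k. X k x))"
  define Y' where "Y' = (\<lambda>x. lim (\<lambda>k. ?X' k x))"
  have Y: "(\<lambda>k. X k x) \<longlonglongrightarrow> Y x" if "x \<in> H" for x
    using conv[OF that close] unfolding Y_def convergent_LIMSEQ_iff by blast
  have Y': "(\<lambda>k. ?X' k x) \<longlonglongrightarrow> Y' x" if "x \<in> H" for x
    using conv[OF that close'] unfolding Y'_def convergent_LIMSEQ_iff by blast
  have adj_Y: "adjoint_on H Y Y'"
    unfolding adjoint_on_def
  proof (intro conjI ballI funcsetI)
    fix x y assume xy: "x \<in> H" "y \<in> H"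
    have "(\<lambda>k. cinner (X k x) y) \<longlonglongrightarrow> cinner (Y x) y"
      by (rule bounded_linear.tendsto[OF bounded_linear_cinner_left Y]) fact
    moreover have "(\<lambda>k. cinner x (?X' k y)) \<longlonglongrightarrow> cinner x (Y' y)"
      by (rule bounded_linear.tendsto[OF bounded_linear_cinner_right Y']) fact
    moreover have "cinner (X k x) y = cinner x (?X' k y)" for k
      by (rule adjoint_onD(3)[OF adj xy])
    ultimately show "cinner (Y x) y = cinner x (Y' y)"
      using LIMSEQ_unique by simp
  next
    fix x assume "x \<in> H"
    then show "Y x \<in> H" "Y' x \<in> H"
      by (auto intro!: hilbert_subspace_LIMSEQ[OF H _ Y] hilbert_subspace_LIMSEQ[OF H _ Y'] simp: X)
  qed
  have lim: "\<exists>N. \<forall>j\<ge>N. \<forall>x\<in>H. norm (X j x - Y x) \<le> e * norm x" if e: "0 < e" for e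
  proof -
    obtain N where N: "\<And>j k x. j \<ge> N \<Longrightarrow> k \<ge> N \<Longrightarrow> x \<in> H \<Longrightarrow> norm (X j x - X k x) \<le> e * norm x"
      using close[OF e] by blast
    have "norm (X j x - Y x) \<le> e * norm x" if "j \<ge> N" "x \<in> H" for j x
    proof (rule LIMSEQ_le_const2)
      show "(\<lambda>k. norm (X j x - X k x)) \<longlonglongrightarrow> norm (X j x - Y x)"
        by (intro tendsto_intros Y that)
    qed (use N that in blast)
    then show ?thesis
      by blast
  qed
  obtain N where N: "\<And>x. x \<in> H \<Longrightarrow> norm (X N x - Y x) \<le> 1 * norm x"
    using lim[of 1] by auto
  have "norm (Y x) \<le> (op_norm H (X N) + 1) * norm x" if "x \<in> H" for x
    using N[OF that] op_norm_bound[OF X that, of N] norm_triangle_ineq2[of "Y x" "X N x"]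
    by (simp add: norm_minus_commute algebra_simps)
  then have Y_in: "restrict Y H \<in> Ops"
    by (rule adjointable_opsI(1)[OF adj_Y])
  have "(\<lambda>k. op_norm H (X k \<ominus>\<^bsub>Alg\<^esub> restrict Y H)) \<longlonglongrightarrow> 0"
  proof (rule LIMSEQ_I)
    fix e :: real assume e: "0 < e"
    obtain N where N: "\<And>j x. j \<ge> N \<Longrightarrow> x \<in> H \<Longrightarrow> norm (X j x - Y x) \<le> (e / 2) * norm x"
      using lim[of "e / 2"] e by auto
    have "norm (op_norm H (X j \<ominus>\<^bsub>Alg\<^esub> restrict Y H) - 0) < e" if "j \<ge> N" for j
    proof -
      have "op_norm H (X j \<ominus>\<^bsub>Alg\<^esub> restrict Y H) \<le> e / 2"
        using N[OF that] e by (intro op_norm_le) (auto simp: adjointable_minus[OF X Y_in])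
      moreover have "0 \<le> op_norm H (X j \<ominus>\<^bsub>Alg\<^esub> restrict Y H)"
        using alg.minus_closed[of "X j" "restrict Y H"] X Y_in by (intro op_norm_nonneg) simp
      ultimately show ?thesis
        using e by simp
    qed
    then show "\<exists>N. \<forall>j\<ge>N. norm (op_norm H (X j \<ominus>\<^bsub>Alg\<^esub> restrict Y H) - 0) < e"
      by blast
  qed
  then show ?thesis
    using Y_in by blast
qed

lemma unital_cstar_algebra_adjointable: "unital_cstar_algebra Alg"
proof (rule unital_cstar_algebra.intro)
  show "ring Alg" "module complex_ring Alg"
    by (rule ring_adjointable module_adjointable)+
next
  fix X Y c assume "X \<in> carrier Alg" "Y \<in> carrier Alg"
  then have X: "X \<in> Ops" and Y: "Y \<in> Ops"
    by simp_all
  show "(c \<odot>\<^bsub>Alg\<^esub> X) \<otimes>\<^bsub>Alg\<^esub> Y = c \<odot>\<^bsub>Alg\<^esub> (X \<otimes>\<^bsub>Alg\<^esub> Y)" "X \<otimes>\<^bsub>Alg\<^esub> (c \<odot>\<^bsub>Alg\<^esub> Y) = c \<odot>\<^bsub>Alg\<^esub> (X \<otimes>\<^bsub>Alg\<^esub> Y)"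
    using X Y by (auto simp: compose_def fun_eq_iff bounded_map_scaleC[OF H bounded_map_adjointable])
  show "cnorm Alg (X \<oplus>\<^bsub>Alg\<^esub> Y) \<le> cnorm Alg X + cnorm Alg Y"
    "star Alg (X \<oplus>\<^bsub>Alg\<^esub> Y) = star Alg X \<oplus>\<^bsub>Alg\<^esub> star Alg Y"
    using adjointable_add[OF X Y] by simp_all
  show "cnorm Alg (X \<otimes>\<^bsub>Alg\<^esub> Y) \<le> cnorm Alg X * cnorm Alg Y"
    "star Alg (X \<otimes>\<^bsub>Alg\<^esub> Y) = star Alg Y \<otimes>\<^bsub>Alg\<^esub> star Alg X"
    using adjointable_compose[OF X Y] by simp_all
next
  fix X c assume "X \<in> carrier Alg"
  then have X: "X \<in> Ops"
    by simp
  show "0 \<le> cnorm Alg X"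
    using op_norm_nonneg[OF X] by simp
  show "star Alg (c \<odot>\<^bsub>Alg\<^esub> X) = cnj c \<odot>\<^bsub>Alg\<^esub> star Alg X" "star Alg X \<in> carrier Alg"
    "star Alg (star Alg X) = X"
    using adjointable_scaleC[OF X] adjoint_on_op_adjoint[OF X] by simp_all
  show "cnorm Alg X = 0 \<longleftrightarrow> X = \<zero>\<^bsub>Alg\<^esub>"
  proof
    assume "cnorm Alg X = 0"
    then show "X = \<zero>\<^bsub>Alg\<^esub>"
      using op_norm_bound[OF X] X adjointable_zero(1) by (auto intro!: adjointable_ext)
  next
    assume "X = \<zero>\<^bsub>Alg\<^esub>"
    then show "cnorm Alg X = 0"
      using op_norm_le[of 0 X] op_norm_nonneg[OF X] by simp
  qed
  show "cnorm Alg (c \<odot>\<^bsub>Alg\<^esub> X) = cmod c * cnorm Alg X"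
  proof (cases "c = 0")
    case True
    then have "op_norm H (\<lambda>x\<in>H. c *\<^sub>C X x) \<le> 0"
      by (intro op_norm_le) auto
    then show ?thesis
      using op_norm_nonneg[OF adjointable_scaleC(1)[OF X, of c]] True by simp
  next
    case False
    have "(\<lambda>x\<in>H. inverse c *\<^sub>C (\<lambda>x\<in>H. c *\<^sub>C X x) x) = X"
      by (rule adjointable_ext[OF adjointable_scaleC(1)[OF adjointable_scaleC(1)[OF X]] X])
        (use False in \<open>simp add: scaleC_scaleC\<close>)
    then have "op_norm H X \<le> cmod (inverse c) * op_norm H (\<lambda>x\<in>H. c *\<^sub>C X x)"
      using adjointable_scaleC(3)[OF adjointable_scaleC(1)[OF X, of c], of "inverse c"] by simp
    from mult_left_mono[OF this, of "cmod c"]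
    have "cmod c * op_norm H X \<le> op_norm H (\<lambda>x\<in>H. c *\<^sub>C X x)"
      using False by (simp add: norm_inverse flip: mult.assoc)
    then show ?thesis
      using adjointable_scaleC(3)[OF X, of c] by simp
  qed
  show "cnorm Alg (star Alg X \<otimes>\<^bsub>Alg\<^esub> X) = (cnorm Alg X)\<^sup>2"
  proof -
    have X': "op_adjoint H X \<in> Ops"
      using X by simp
    let ?Z = "compose H (op_adjoint H X) X"
    have Z: "?Z \<in> Ops"
      by (rule adjointable_compose(1)[OF X' X])
    have "op_norm H (op_adjoint H X) \<le> op_norm H X"
      by (rule op_norm_le[OF op_norm_nonneg[OF X]])
        (rule adjoint_bound[OF adjoint_on_op_adjoint(1)[OF X] op_norm_bound[OF X]])
    then have "op_norm H ?Z \<le> op_norm H X * op_norm H X"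
      using adjointable_compose(3)[OF X' X] op_norm_nonneg[OF X] mult_right_mono order_trans by blast
    \<comment> \<open>The other estimate comes from \<open>\<parallel>X x\<parallel>\<^sup>2 = \<langle>x, X\<^sup>* X x\<rangle>\<close>.\<close>
    moreover have "op_norm H X \<le> sqrt (op_norm H ?Z)"
    proof (rule op_norm_le)
      show "0 \<le> sqrt (op_norm H ?Z)"
        using op_norm_nonneg[OF Z] by simp
      fix x assume x: "x \<in> H"
      have "complex_of_real ((norm (X x))\<^sup>2) = cinner x (?Z x)"
        using cinner_op_adjoint[OF X x, of "X x"] X x by (simp add: cinner_self compose_adjointable)
      then have "(norm (X x))\<^sup>2 = cmod (cinner x (?Z x))"
        by (metis abs_power2 norm_of_real real_norm_def)
      also have "\<dots> \<le> norm x * (op_norm H ?Z * norm x)"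
        using norm_cinner_le[of x "?Z x"] mult_left_mono[OF op_norm_bound[OF Z x], of "norm x"]
        by simp
      also have "\<dots> = (sqrt (op_norm H ?Z) * norm x)\<^sup>2"
        using op_norm_nonneg[OF Z] by (simp add: power2_eq_square algebra_simps)
      finally show "norm (X x) \<le> sqrt (op_norm H ?Z) * norm x"
        using op_norm_nonneg[OF Z] by (simp add: power2_le_iff_abs_le)
    qed
    then have "(op_norm H X)\<^sup>2 \<le> op_norm H ?Z"
      using op_norm_nonneg[OF X] op_norm_nonneg[OF Z] by (metis power_mono real_sqrt_pow2)
    ultimately show ?thesis
      by (simp add: power2_eq_square)
  qed
next
  fix X :: "nat \<Rightarrow> 'h \<Rightarrow> 'h"
  assume "\<And>k. X k \<in> carrier Alg"
    "\<And>e. 0 < e \<Longrightarrow> \<exists>N. \<forall>j\<ge>N. \<forall>k\<ge>N. cnorm Alg (X j \<ominus>\<^bsub>Alg\<^esub> X k) < e"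
  then show "\<exists>l\<in>carrier Alg. (\<lambda>k. cnorm Alg (X k \<ominus>\<^bsub>Alg\<^esub> l)) \<longlonglongrightarrow> 0"
    using adjointable_complete[of X] by simp
qed

lemma cuntz_family_adjointable:
  assumes "op_cuntz_family H n S S'" "\<And>i x. i \<in> {1..n} \<Longrightarrow> x \<in> H \<Longrightarrow> norm (S i x) \<le> norm x"
  shows "cuntz_family n Alg (\<lambda>i. restrict (S i) H)"
proof -
  let ?P = "\<lambda>i. compose H (restrict (S i) H) (restrict (S' i) H)"
  interpret alg: ring Alg
    by (rule ring_adjointable)
  have adj: "adjoint_on H (S i) (S' i)" if "i \<in> {1..n}" for i
    using assms(1) that unfolding op_cuntz_family_def by blast
  have in1: "restrict (S i) H \<in> Ops"
    and star1: "op_adjoint H (restrict (S i) H) = restrict (S' i) H" if "i \<in> {1..n}" for i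
    using adjointable_opsI[OF adj[OF that], of 1] assms(2)[OF that] by simp_all
  have in2: "restrict (S' i) H \<in> Ops" if "i \<in> {1..n}" for i
    using op_adjoint_in[OF in1[OF that]] star1[OF that] by simp
  note S_in = adjoint_onD(1,2)[OF adj]
  have sum: "finsum Alg ?P I =
      (\<lambda>x\<in>H. \<Sum>i\<in>I. S i (S' i x))" if "I \<subseteq> {1..n}" for I
    using finite_subset[OF that finite_atLeastAtMost] that
  proof (induction I rule: finite_induct)
    case (insert i I)
    have cl: "?P j \<in> carrier Alg"
      if "j \<in> insert i I" for j
    proof -
      have "j \<in> {1..n}"
        using that insert.prems by blast
      then show ?thesis
        using adjointable_compose(1)[OF in1 in2] by simp
    qed
    have eq: "finsum Alg ?P (insert i I) =
        ?P i \<oplus>\<^bsub>Alg\<^esub>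
        finsum Alg ?P I"
      using insert.hyps cl by (intro alg.finsum_insert) blast+
    have IH: "finsum Alg ?P I =
        (\<lambda>x\<in>H. \<Sum>i\<in>I. S i (S' i x))"
      using insert.IH insert.prems by blast
    have "i \<in> {1..n}"
      using insert.prems by blast
    then show ?case
      unfolding eq IH using insert.hyps S_in(2)[of i] by (intro ext) (simp add: compose_def)
  qed simp
  have "(\<Oplus>\<^bsub>Alg\<^esub>i\<in>{1..n}. restrict (S i) H \<otimes>\<^bsub>Alg\<^esub> star Alg (restrict (S i) H)) =
      finsum Alg ?P {1..n}"
    by (rule alg.finsum_cong') (auto simp: star1 in1 in2 adjointable_simps)
  also have "\<dots> = \<one>\<^bsub>Alg\<^esub>"
    using assms(1) unfolding sum[OF subset_refl] op_cuntz_family_def by (auto simp: fun_eq_iff)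
  finally show ?thesis
    using assms(1) S_in unfolding cuntz_family_def op_cuntz_family_def
    by (auto simp: star1 in1 compose_def fun_eq_iff)
qed

end


section \<open>Representations\<close>

lemma adjoint_on_unique:
  assumes "hilbert_subspace H" "adjoint_on H X X'" "adjoint_on H Y Y'"
    and "\<And>x. x \<in> H \<Longrightarrow> X x = Y x" "y \<in> H"
  shows "X' y = Y' y"
  by (rule cinner_eqI_on[OF assms(1)])
    (use assms in \<open>simp_all add: adjoint_onD[OF assms(2)] adjoint_onD[OF assms(3)]
      adjoint_onD(3)[OF adjoint_on_sym[OF assms(2)]] adjoint_onD(3)[OF adjoint_on_sym[OF assms(3)]]\<close>)

locale star_rep = unital_cstar_algebra A
  for A :: "'a cstar" (structure) +
  fixes \<pi> :: "('a, 'h::chilbert_space) rep"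
  assumes rep: "is_rep A \<pi>"
begin

abbreviation "H \<equiv> rep_space \<pi>"
abbreviation "op \<equiv> rep_op \<pi>"

lemma space: "hilbert_subspace H"
  using rep unfolding is_rep_def by blast

lemma op_bounded_ops: "a \<in> carrier A \<Longrightarrow> op a \<in> bounded_ops H"
  using rep unfolding is_rep_def by blast

lemma bounded_op: "a \<in> carrier A \<Longrightarrow> bounded_map H H (op a)"
  using op_bounded_ops bounded_ops_iff by blast

lemma op_in [simp]: "a \<in> carrier A \<Longrightarrow> x \<in> H \<Longrightarrow> op a x \<in> H"
  using bounded_map_in[OF space bounded_op] .

lemma op_add: "a \<in> carrier A \<Longrightarrow> b \<in> carrier A \<Longrightarrow> x \<in> H \<Longrightarrow> op (a \<oplus> b) x = op a x + op b x"
  and op_smult: "a \<in> carrier A \<Longrightarrow> x \<in> H \<Longrightarrow> op (c \<odot> a) x = c *\<^sub>C op a x"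
  and op_mult: "a \<in> carrier A \<Longrightarrow> b \<in> carrier A \<Longrightarrow> x \<in> H \<Longrightarrow> op (a \<otimes> b) x = op a (op b x)"
  and cinner_op: "a \<in> carrier A \<Longrightarrow> x \<in> H \<Longrightarrow> y \<in> H \<Longrightarrow> cinner (op a x) y = cinner x (op (star A a) y)"
  using rep unfolding is_rep_def by blast+

lemma adjoint_op: "a \<in> carrier A \<Longrightarrow> adjoint_on H (op a) (op (star A a))"
  unfolding adjoint_on_def by (simp add: cinner_op)

lemma op_diff: "a \<in> carrier A \<Longrightarrow> b \<in> carrier A \<Longrightarrow> x \<in> H \<Longrightarrow> op (a \<ominus> b) x = op a x - op b x"
  by (simp add: a_minus_def minus_smult op_add op_smult scaleC_minus1)

lemma op_zero: "x \<in> H \<Longrightarrow> op \<zero> x = 0"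
  using op_smult[of \<zero> x 0] by simp

text \<open>Nondegeneracy: the vectors fixed by the unit form a closed subspace, and it contains
  all vectors \<open>op a x\<close>.\<close>

lemma op_one: "x \<in> H \<Longrightarrow> op \<one> x = x"
proof -
  note [simp] = bounded_map_add[OF space bounded_op] bounded_map_scaleC[OF space bounded_op]
    bounded_map_zero[OF space bounded_op]
  define K where "K = {y \<in> H. op \<one> y = y}"
  have "closed K"
    unfolding closed_sequential_limits
  proof (intro allI impI)
    fix f l assume f: "(\<forall>k. f k \<in> K) \<and> f \<longlonglongrightarrow> l"
    then have in_H: "f k \<in> H" and fixed: "op \<one> (f k) = f k" for k
      unfolding K_def by blast+
    have "l \<in> H"
      by (rule hilbert_subspace_LIMSEQ[OF space, of f]) (use f in_H in auto)
    moreover have "(\<lambda>k. op \<one> (f k)) \<longlonglongrightarrow> op \<one> l"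
      by (rule bounded_map_LIMSEQ[OF space bounded_op[OF alg.one_closed], where f = f])
        (use f in_H in auto)
    ultimately show "l \<in> K"
      using f LIMSEQ_unique unfolding K_def fixed by blast
  qed
  then have "hilbert_subspace K"
    unfolding hilbert_subspace_def K_def
    using hilbert_subspace_zero[OF space] hilbert_subspace_add[OF space]
      hilbert_subspace_scaleC[OF space] by auto
  moreover have "{op a x | a x. a \<in> carrier A \<and> x \<in> H} \<subseteq> K"
    unfolding K_def by (auto simp flip: op_mult)
  ultimately have "closed_cspan {op a x | a x. a \<in> carrier A \<and> x \<in> H} \<subseteq> K"
    unfolding closed_cspan_def by blast
  moreover have "closed_cspan {op a x | a x. a \<in> carrier A \<and> x \<in> H} = H"
    using rep unfolding is_rep_def by blast
  ultimately show "x \<in> H \<Longrightarrow> op \<one> x = x"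
    unfolding K_def by blast
qed

text \<open>With \<open>1 - a\<^sup>*a = b\<^sup>*b\<close> one gets \<open>\<parallel>x\<parallel>\<^sup>2 - \<parallel>op a x\<parallel>\<^sup>2 = \<langle>op (b\<^sup>*b) x, x\<rangle> = \<parallel>op b x\<parallel>\<^sup>2\<close>.\<close>

lemma op_contractive_strict:
  assumes a: "a \<in> carrier A" "cnorm A a < 1" and x: "x \<in> H"
  shows "norm (op a x) \<le> norm x"
proof -
  have "cnorm A (star A a \<otimes> a) < 1"
    using a cnorm_nonneg[of a] by (simp add: cstar_identity power_less_one_iff abs_square_less_1)
  then obtain b where b: "b \<in> carrier A" "star A b \<otimes> b = \<one> \<ominus> star A a \<otimes> a"
    using square_root_one_minus[of "star A a \<otimes> a"] a(1) by (auto simp: star_mult)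
  have sq: "cinner (op (star A c \<otimes> c) x) x = complex_of_real ((norm (op c x))\<^sup>2)"
    if "c \<in> carrier A" for c
    using that x by (simp add: op_mult cinner_op cinner_self)
  have "complex_of_real ((norm (op b x))\<^sup>2) = cinner (op (\<one> \<ominus> star A a \<otimes> a) x) x"
    using sq[OF b(1)] b(2) by simp
  also have "\<dots> = complex_of_real ((norm x)\<^sup>2) - complex_of_real ((norm (op a x))\<^sup>2)"
    using a x sq[OF a(1)] by (simp add: op_diff op_one cinner_diff_left cinner_self)
  finally have "(norm (op b x))\<^sup>2 = (norm x)\<^sup>2 - (norm (op a x))\<^sup>2"
    by (metis of_real_diff of_real_eq_iff)
  then have "(norm (op a x))\<^sup>2 \<le> (norm x)\<^sup>2"
    using zero_le_power2[of "norm (op b x)"] by linarith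
  then show ?thesis
    by (simp add: power2_le_iff_abs_le)
qed

lemma op_contractive:
  assumes a: "a \<in> carrier A" and x: "x \<in> H"
  shows "norm (op a x) \<le> cnorm A a * norm x"
proof (rule LIMSEQ_le_const)
  have "(\<lambda>k. (cnorm A a + inverse (real (Suc k))) * norm x) \<longlonglongrightarrow> (cnorm A a + 0) * norm x"
    by (intro tendsto_intros LIMSEQ_inverse_real_of_nat)
  then show "(\<lambda>k. (cnorm A a + inverse (real (Suc k))) * norm x) \<longlonglongrightarrow> cnorm A a * norm x"
    by simp
  have "norm (op a x) \<le> c * norm x" if c: "cnorm A a < c" for c
  proof -
    have pos: "0 < c"
      using c cnorm_nonneg[OF a] by linarith
    define d where "d = complex_of_real (inverse c)"
    have d: "cmod d = inverse c"
      unfolding d_def norm_of_real using pos by simp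
    have "norm (op (d \<odot> a) x) \<le> norm x"
      by (rule op_contractive_strict) (use a x c pos in \<open>simp_all add: cnorm_smult d field_simps\<close>)
    then show ?thesis
      using a x pos by (simp add: op_smult norm_scaleC d field_simps)
  qed
  then show "\<exists>N. \<forall>k\<ge>N. norm (op a x) \<le> (cnorm A a + inverse (real (Suc k))) * norm x"
    by simp
qed

lemma op_clim:
  assumes "clim X l" "x \<in> H"
  shows "(\<lambda>k. op (X k) x) \<longlonglongrightarrow> op l x"
proof (rule LIM_zero_cancel, rule Lim_null_comparison)
  have "norm (op (X k) x - op l x) \<le> cnorm A (X k \<ominus> l) * norm x" for k
    using op_contractive[of "X k \<ominus> l" x] assms climD[OF assms(1)] by (simp add: op_diff)
  then show "\<forall>\<^sub>F k in sequentially. norm (op (X k) x - op l x) \<le> cnorm A (X k \<ominus> l) * norm x"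
    by simp
  show "(\<lambda>k. cnorm A (X k \<ominus> l) * norm x) \<longlonglongrightarrow> 0"
    using assms(1) unfolding clim_def by (intro tendsto_mult_left_zero) blast
qed

lemma op_invariant:
  assumes gen: "generates_cstar A X" and K: "hilbert_subspace K" "K \<subseteq> H"
    and X: "\<And>a. a \<in> X \<Longrightarrow> op a ` K \<subseteq> K \<and> op (star A a) ` K \<subseteq> K" and a: "a \<in> carrier A"
  shows "op a ` K \<subseteq> K"
proof -
  have "(\<forall>x\<in>K. op a x \<in> K) \<and> (\<forall>x\<in>K. op (star A a) x \<in> K)"
    using gen a
  proof (induction a rule: generates_cstar_induct[where X = X])
    case (lim Y l)
    have closed: "op b x \<in> K" if x: "x \<in> K" and Z: "clim Z b" and in_K: "\<And>k. op (Z k) x \<in> K" for x Z b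
      by (rule hilbert_subspace_LIMSEQ[OF K(1) in_K op_clim[OF Z]]) (use x K(2) in blast)
    have Y: "op (Y k) x \<in> K" "op (star A (Y k)) x \<in> K" if "x \<in> K" for k x
      using lim(2) that by blast+
    show ?case
      by (intro conjI ballI closed[OF _ lim(1)] closed[OF _ clim_star[OF lim(1)]] Y)
  next
    case (gen a)
    then show ?case
      using X by blast
  qed (simp_all add: subsetD[OF K(2)] op_add op_mult op_smult op_one star_add star_mult star_smult
      hilbert_subspace_add[OF K(1)] hilbert_subspace_scaleC[OF K(1)])
  then show ?thesis
    by blast
qed

lemma op_cuntz_rep:
  assumes "cuntz_family n A s"
  shows "op_cuntz_family H n (\<lambda>i. op (s i)) (\<lambda>i. op (star A (s i)))"
proof -
  have s: "s i \<in> carrier A" if "i \<in> {1..n}" for i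
    using assms that unfolding cuntz_family_def by blast
  have rel: "star A (s i) \<otimes> s j = (if i = j then \<one> else \<zero>)" if "i \<in> {1..n}" "j \<in> {1..n}" for i j
    using assms that unfolding cuntz_family_def by blast
  have "op (\<Oplus>i\<in>I. s i \<otimes> star A (s i)) x = (\<Sum>i\<in>I. op (s i) (op (star A (s i)) x))"
    if x: "x \<in> H" and "I \<subseteq> {1..n}" for x I
    using finite_subset[OF that(2) finite_atLeastAtMost] that(2)
  proof (induction I rule: finite_induct)
    case (insert i I)
    have "s j \<in> carrier A" if "j \<in> insert i I" for j
      using s that insert.prems by blast
    then have I: "(\<lambda>i. s i \<otimes> star A (s i)) \<in> I \<rightarrow> carrier A" "s i \<in> carrier A"
      by simp_all
    then have "(\<Oplus>i\<in>insert i I. s i \<otimes> star A (s i)) =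
        s i \<otimes> star A (s i) \<oplus> (\<Oplus>i\<in>I. s i \<otimes> star A (s i))"
      using insert.hyps by (intro alg.finsum_insert) auto
    then show ?case
      using insert I x alg.finsum_closed[OF I(1)] by (simp add: op_add op_mult)
  qed (simp add: op_zero x)
  from this[of _ "{1..n}"] have "(\<Sum>i\<in>{1..n}. op (s i) (op (star A (s i)) x)) = x" if "x \<in> H" for x
    using that assms op_one unfolding cuntz_family_def by simp
  moreover have "op (star A (s i)) (op (s j) x) = (if i = j then x else 0)"
    if "i \<in> {1..n}" "j \<in> {1..n}" "x \<in> H" for i j x
    using op_mult[of "star A (s i)" "s j" x] that rel[OF that(1,2)] s
    by (simp add: op_one op_zero split: if_splits)
  ultimately show ?thesis
    using s adjoint_op unfolding op_cuntz_family_def by blast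
qed

end

lemma is_repI:
  fixes H :: "'h::chilbert_space set"
  assumes A: "unital_cstar_algebra A" and H: "hilbert_subspace H"
    and f: "unital_star_hom A (adjointable_algebra H) f"
  shows "is_rep A \<lparr>rep_space = H, rep_op = f\<rparr>"
proof -
  interpret unital_cstar_algebra A by fact
  have f_in: "f a \<in> adjointable_ops H" if "a \<in> carrier A" for a
    using f that unfolding unital_star_hom_def ring_hom_def by auto
  have f_simps: "a \<in> carrier A \<Longrightarrow> b \<in> carrier A \<Longrightarrow> f (a \<otimes>\<^bsub>A\<^esub> b) = compose H (f a) (f b)"
    "a \<in> carrier A \<Longrightarrow> b \<in> carrier A \<Longrightarrow> f (a \<oplus>\<^bsub>A\<^esub> b) = (\<lambda>x\<in>H. f a x + f b x)"
    "a \<in> carrier A \<Longrightarrow> f (c \<odot>\<^bsub>A\<^esub> a) = (\<lambda>x\<in>H. c *\<^sub>C f a x)"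
    "a \<in> carrier A \<Longrightarrow> f (star A a) = op_adjoint H (f a)"
    "f \<one>\<^bsub>A\<^esub> = (\<lambda>x\<in>H. x)" for a b c
    using f unfolding unital_star_hom_def ring_hom_def by auto
  have "H \<subseteq> {f a x | a x. a \<in> carrier A \<and> x \<in> H}"
    using f_simps(5) by (force intro: exI[of _ "\<one>\<^bsub>A\<^esub>"])
  moreover have "{f a x | a x. a \<in> carrier A \<and> x \<in> H} \<subseteq> H"
    using adjointable_in[OF H f_in] by blast
  ultimately have "{f a x | a x. a \<in> carrier A \<and> x \<in> H} = H"
    by blast
  moreover have "closed_cspan H = H"
    unfolding closed_cspan_def using H by blast
  moreover have "f \<in> carrier A \<rightarrow>\<^sub>E bounded_ops H"
    using f adjointable_bounded_ops[OF H f_in] unfolding unital_star_hom_def by (auto simp: PiE_def)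
  ultimately show ?thesis
    unfolding is_rep_def
    using H by (simp add: f_simps compose_def cinner_op_adjoint[OF H f_in])
qed

text \<open>For a general bounded \<open>G\<close> the elements that it intertwines form a norm closed algebra, by
  contractivity, but not a *-algebra. Therefore the adjoints of the generators are among the hypotheses,
  and \<open>a\<close> and \<open>a\<^sup>*\<close> are treated together.\<close>

lemma rep_intertwines:
  fixes \<pi> :: "('a, 'h::chilbert_space) rep" and \<sigma> :: "('a, 'k::chilbert_space) rep"
  assumes A: "unital_cstar_algebra A" and gen: "generates_cstar A X"
    and reps: "is_rep A \<pi>" "is_rep A \<sigma>" and G: "bounded_map (rep_space \<pi>) (rep_space \<sigma>) G"
    and X: "\<And>a x. a \<in> X \<Longrightarrow> x \<in> rep_space \<pi> \<Longrightarrow> G (rep_op \<pi> a x) = rep_op \<sigma> a (G x)"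
      "\<And>a x. a \<in> X \<Longrightarrow> x \<in> rep_space \<pi> \<Longrightarrow> G (rep_op \<pi> (star A a) x) = rep_op \<sigma> (star A a) (G x)"
  shows "intertwines A \<pi> \<sigma> G"
proof -
  interpret unital_cstar_algebra A by fact
  interpret \<pi>: star_rep A \<pi> by unfold_locales fact
  interpret \<sigma>: star_rep A \<sigma> by unfold_locales fact
  note [simp] = bounded_map_in[OF \<pi>.space G] bounded_map_add[OF \<pi>.space G]
    bounded_map_scaleC[OF \<pi>.space G]
  have "(\<forall>x\<in>\<pi>.H. G (\<pi>.op a x) = \<sigma>.op a (G x)) \<and>
      (\<forall>x\<in>\<pi>.H. G (\<pi>.op (star A a) x) = \<sigma>.op (star A a) (G x))" if "a \<in> carrier A" for a
    using gen that
  proof (induction a rule: generates_cstar_induct[where X = X])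
    case (lim Y l)
    have closed: "G (\<pi>.op b x) = \<sigma>.op b (G x)"
      if x: "x \<in> \<pi>.H" and Z: "clim Z b" and eq: "\<And>k. G (\<pi>.op (Z k) x) = \<sigma>.op (Z k) (G x)" for x Z b
    proof -
      have "(\<lambda>k. G (\<pi>.op (Z k) x)) \<longlonglongrightarrow> G (\<pi>.op b x)"
        by (rule bounded_map_LIMSEQ[OF \<pi>.space G _ \<pi>.op_clim[OF Z x]]) (use x climD[OF Z] in simp)
      moreover have "(\<lambda>k. \<sigma>.op (Z k) (G x)) \<longlonglongrightarrow> \<sigma>.op b (G x)"
        by (rule \<sigma>.op_clim[OF Z]) (use x in simp)
      ultimately show ?thesis
        unfolding eq by (rule LIMSEQ_unique)
    qed
    show ?case
      using lim(2) by (intro conjI ballI closed[OF _ lim(1)] closed[OF _ clim_star[OF lim(1)]]) blast+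
  next
    case (gen a)
    then show ?case
      using X by blast
  qed (simp_all add: \<pi>.op_add \<pi>.op_mult \<pi>.op_smult \<pi>.op_one star_add star_mult star_smult
      \<sigma>.op_add \<sigma>.op_mult \<sigma>.op_smult \<sigma>.op_one)
  then show ?thesis
    unfolding intertwines_def by blast
qed

lemma rep_eqI:
  fixes \<pi> \<sigma> :: "('a, 'h::chilbert_space) rep"
  assumes A: "unital_cstar_algebra A" and gen: "generates_cstar A X"
    and reps: "is_rep A \<pi>" "is_rep A \<sigma>" and H: "rep_space \<pi> = rep_space \<sigma>"
    and X: "\<And>a x. a \<in> X \<Longrightarrow> x \<in> rep_space \<pi> \<Longrightarrow> rep_op \<pi> a x = rep_op \<sigma> a x"
  shows "\<pi> = \<sigma>"
proof -
  interpret unital_cstar_algebra A by fact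
  interpret \<pi>: star_rep A \<pi> by unfold_locales fact
  interpret \<sigma>: star_rep A \<sigma> by unfold_locales fact
  have X_in: "a \<in> carrier A" if "a \<in> X" for a
    using gen that unfolding generates_cstar_def by blast
  have "rep_op \<pi> (star A a) x = rep_op \<sigma> (star A a) x" if "a \<in> X" "x \<in> \<pi>.H" for a x
    by (rule adjoint_on_unique[OF \<pi>.space \<pi>.adjoint_op[OF X_in[OF that(1)]]
          \<sigma>.adjoint_op[OF X_in[OF that(1)], folded H]]) (use X that in auto)
  then have "intertwines A \<pi> \<sigma> (\<lambda>x. x)"
    using X by (intro rep_intertwines[OF A gen reps]) (auto simp: H bounded_map_def intro!: exI[of _ 1])
  then have eq: "rep_op \<pi> a x = rep_op \<sigma> a x" if "a \<in> carrier A" "x \<in> \<pi>.H" for a x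
    using that unfolding intertwines_def by blast
  have "rep_op \<pi> = rep_op \<sigma>"
  proof (rule extensionalityI)
    show "rep_op \<pi> \<in> extensional (carrier A)" "rep_op \<sigma> \<in> extensional (carrier A)"
      using reps unfolding is_rep_def PiE_def by blast+
    fix a assume a: "a \<in> carrier A"
    show "rep_op \<pi> a = rep_op \<sigma> a"
    proof (rule extensionalityI)
      show "rep_op \<pi> a \<in> extensional \<pi>.H" "rep_op \<sigma> a \<in> extensional \<pi>.H"
        using \<pi>.op_bounded_ops[OF a] \<sigma>.op_bounded_ops[OF a] H unfolding bounded_ops_def by auto
    qed (rule eq[OF a])
  qed
  then show ?thesis
    using H by simp
qed

lemma bounded_map_unitary:
  assumes "unitary_between H K U"
  shows "bounded_map H K U"
proof -
  have "norm (U x) = norm x" if "x \<in> H" for x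
    using assms that unfolding unitary_between_def norm_eq_sqrt_cinner by simp
  then show ?thesis
    using assms unfolding unitary_between_def bounded_map_def
    by (auto simp: bij_betw_def intro!: exI[of _ 1])
qed


subsection \<open>Direct sums\<close>

lemma bounded_map_coordinate:
  assumes "\<And>x. x \<in> K \<Longrightarrow> Rep_l2sum x l \<in> H"
  shows "bounded_map K H (\<lambda>x. Rep_l2sum x l)"
  unfolding bounded_map_def using assms
  by (auto simp: Rep_l2sum_simps Rep_l2sum_scaleC norm_nth_le intro!: exI[of _ 1])

context
  fixes A :: "'a cstar" and L :: "'i set" and \<rho> :: "'i \<Rightarrow> ('a, 'k::chilbert_space) rep"
  assumes A: "unital_cstar_algebra A" and \<rho>: "\<And>l. l \<in> L \<Longrightarrow> is_rep A (\<rho> l)"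
begin

interpretation unital_cstar_algebra A
  by (rule A)

lemma star_rep_summand: "l \<in> L \<Longrightarrow> star_rep A (\<rho> l)"
  by unfold_locales (rule \<rho>)

lemmas summand_space = star_rep.space[OF star_rep_summand]

lemma direct_sum_space_iff:
  "x \<in> rep_space (rep_direct_sum A L \<rho>) \<longleftrightarrow>
    (\<forall>l\<in>L. Rep_l2sum x l \<in> rep_space (\<rho> l)) \<and> (\<forall>l. l \<notin> L \<longrightarrow> Rep_l2sum x l = 0)"
  unfolding rep_direct_sum_def Let_def by auto

lemma direct_sum_space: "hilbert_subspace (rep_space (rep_direct_sum A L \<rho>))"
  unfolding hilbert_subspace_def
proof (intro conjI)
  show "closed (rep_space (rep_direct_sum A L \<rho>))"
    unfolding closed_sequential_limits
  proof (intro allI impI)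
    fix f x assume f: "(\<forall>k. f k \<in> rep_space (rep_direct_sum A L \<rho>)) \<and> f \<longlonglongrightarrow> x"
    have lim: "(\<lambda>k. Rep_l2sum (f k) l) \<longlonglongrightarrow> Rep_l2sum x l" for l
    proof (rule LIM_zero_cancel, rule Lim_null_comparison)
      show "\<forall>\<^sub>F k in sequentially. norm (Rep_l2sum (f k) l - Rep_l2sum x l) \<le> norm (f k - x)"
        using norm_nth_le[of "f _ - x" l] by (simp add: Rep_l2sum_simps)
      show "(\<lambda>k. norm (f k - x)) \<longlonglongrightarrow> 0"
        using f by (simp add: LIM_zero_iff tendsto_norm_zero_iff)
    qed
    show "x \<in> rep_space (rep_direct_sum A L \<rho>)"
      unfolding direct_sum_space_iff
    proof (intro conjI ballI allI impI)
      fix l assume "l \<in> L"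
      then show "Rep_l2sum x l \<in> rep_space (\<rho> l)"
        using f by (intro hilbert_subspace_LIMSEQ[OF summand_space _ lim])
          (auto simp: direct_sum_space_iff)
    next
      fix l assume "l \<notin> L"
      then have "(\<lambda>k. Rep_l2sum (f k) l) = (\<lambda>_. 0)"
        using f by (auto simp: direct_sum_space_iff)
      then show "Rep_l2sum x l = 0"
        using lim[of l] LIMSEQ_unique tendsto_const by metis
    qed
  qed
qed (auto simp: direct_sum_space_iff Rep_l2sum_simps Rep_l2sum_scaleC
    hilbert_subspace_zero[OF summand_space] hilbert_subspace_add[OF summand_space]
    hilbert_subspace_scaleC[OF summand_space])

text \<open>The summands are uniformly bounded by the norm of the algebra element.\<close>

lemma summand_bound:
  assumes "a \<in> carrier A" "x \<in> rep_space (rep_direct_sum A L \<rho>)"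
  shows "(norm (if l \<in> L then rep_op (\<rho> l) a (Rep_l2sum x l) else 0))\<^sup>2
    \<le> (cnorm A a)\<^sup>2 * (norm (Rep_l2sum x l))\<^sup>2"
proof (cases "l \<in> L")
  case True
  then have "norm (rep_op (\<rho> l) a (Rep_l2sum x l)) \<le> cnorm A a * norm (Rep_l2sum x l)"
    using assms by (intro star_rep.op_contractive[OF star_rep_summand])
      (auto simp: direct_sum_space_iff)
  then show ?thesis
    using True power_mono[OF _ norm_ge_zero, of _ _ 2] by (fastforce simp flip: power_mult_distrib)
qed simp

lemma summable_summand_bound:
  "(\<lambda>l. b * (norm (Rep_l2sum (x :: ('i, 'k) l2sum) l))\<^sup>2) summable_on UNIV"
  using square_summable_Rep[of x] unfolding square_summable_def by (rule summable_on_cmult_right)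

lemma square_summable_direct_sum:
  assumes "a \<in> carrier A" "x \<in> rep_space (rep_direct_sum A L \<rho>)"
  shows "square_summable (\<lambda>l. if l \<in> L then rep_op (\<rho> l) a (Rep_l2sum x l) else 0)"
  unfolding square_summable_def
  by (rule summable_on_comparison_test[OF summable_summand_bound summand_bound[OF assms]]) simp

lemma Rep_direct_sum_op:
  assumes "a \<in> carrier A" "x \<in> rep_space (rep_direct_sum A L \<rho>)"
  shows "Rep_l2sum (rep_op (rep_direct_sum A L \<rho>) a x) l =
    (if l \<in> L then rep_op (\<rho> l) a (Rep_l2sum x l) else 0)"
proof -
  have "rep_op (rep_direct_sum A L \<rho>) a x =
      Abs_l2sum (\<lambda>l. if l \<in> L then rep_op (\<rho> l) a (Rep_l2sum x l) else 0)"
    using assms unfolding rep_direct_sum_def Let_def by simp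
  then show ?thesis
    using square_summable_direct_sum[OF assms] by (simp add: Abs_l2sum_inverse)
qed

lemma is_rep_direct_sum: "is_rep A (rep_direct_sum A L \<rho>)"
proof -
  let ?K = "rep_space (rep_direct_sum A L \<rho>)" and ?op = "rep_op (rep_direct_sum A L \<rho>)"
  have coord: "Rep_l2sum x l \<in> rep_space (\<rho> l)" if "x \<in> ?K" "l \<in> L" for x l
    using that by (simp add: direct_sum_space_iff)
  have op_in: "?op a x \<in> ?K" if "a \<in> carrier A" "x \<in> ?K" for a x
    using that unfolding direct_sum_space_iff[of "?op a x"]
    by (simp add: Rep_direct_sum_op coord star_rep.op_in[OF star_rep_summand])
  note K_closed = hilbert_subspace_add[OF direct_sum_space]
    hilbert_subspace_scaleC[OF direct_sum_space]
  have off: "Rep_l2sum x l = 0" if "x \<in> ?K" "l \<notin> L" for x l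
    using that by (simp add: direct_sum_space_iff)
  have norm_op: "norm (?op a x) \<le> cnorm A a * norm x" if "a \<in> carrier A" "x \<in> ?K" for a x
  proof -
    have "(\<Sum>\<^sub>\<infinity>l. (norm (Rep_l2sum (?op a x) l))\<^sup>2) \<le>
        (\<Sum>\<^sub>\<infinity>l. (cnorm A a)\<^sup>2 * (norm (Rep_l2sum x l))\<^sup>2)"
    proof (rule infsum_mono[OF _ summable_summand_bound])
      show "(\<lambda>l. (norm (Rep_l2sum (?op a x) l))\<^sup>2) summable_on UNIV"
        using square_summable_Rep unfolding square_summable_def .
    qed (use summand_bound[OF that] in \<open>simp add: Rep_direct_sum_op[OF that]\<close>)
    also have "\<dots> = (cnorm A a)\<^sup>2 * (\<Sum>\<^sub>\<infinity>l. (norm (Rep_l2sum x l))\<^sup>2)"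
      by (rule infsum_cmult_right')
    finally have "norm (?op a x) \<le> sqrt ((cnorm A a)\<^sup>2 * (\<Sum>\<^sub>\<infinity>l. (norm (Rep_l2sum x l))\<^sup>2))"
      unfolding norm_l2sum_def by (rule real_sqrt_le_mono)
    then show ?thesis
      using that cnorm_nonneg by (simp add: norm_l2sum_def real_sqrt_mult)
  qed
  have add: "?op a (x + y) = ?op a x + ?op a y" if "a \<in> carrier A" "x \<in> ?K" "y \<in> ?K" for a x y
    using that by (intro l2sum_eqI)
      (simp add: Rep_direct_sum_op K_closed Rep_l2sum_simps coord
        bounded_map_add[OF summand_space star_rep.bounded_op[OF star_rep_summand]])
  have scale: "?op a (c *\<^sub>C x) = c *\<^sub>C ?op a x" if "a \<in> carrier A" "x \<in> ?K" for a c x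
    using that by (intro l2sum_eqI)
      (simp add: Rep_direct_sum_op K_closed Rep_l2sum_scaleC coord
        bounded_map_scaleC[OF summand_space star_rep.bounded_op[OF star_rep_summand]])
  have "?op a \<in> extensional ?K" if "a \<in> carrier A" for a
    using that unfolding rep_direct_sum_def Let_def by simp
  then have bounded: "?op a \<in> bounded_ops ?K" if "a \<in> carrier A" for a
    using that norm_op[OF that] unfolding bounded_ops_def by (auto simp: op_in add scale)
  moreover have "?op \<in> extensional (carrier A)"
    unfolding rep_direct_sum_def Let_def by simp
  ultimately have PiE: "?op \<in> carrier A \<rightarrow>\<^sub>E bounded_ops ?K"
    by (auto simp: PiE_def)
  have cinner: "cinner (?op a x) y = cinner x (?op (star A a) y)"
    if "a \<in> carrier A" "x \<in> ?K" "y \<in> ?K" for a x y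
    unfolding cinner_l2sum_def
    by (rule infsum_cong)
      (use that in \<open>simp add: Rep_direct_sum_op off coord star_rep.cinner_op[OF star_rep_summand]\<close>)
  have one: "?op \<one>\<^bsub>A\<^esub> x = x" if "x \<in> ?K" for x
    using that by (intro l2sum_eqI)
      (simp add: Rep_direct_sum_op coord off star_rep.op_one[OF star_rep_summand])
  have "{?op a x | a x. a \<in> carrier A \<and> x \<in> ?K} = ?K"
    using op_in one[symmetric] alg.one_closed by blast
  moreover have "closed_cspan ?K = ?K"
    unfolding closed_cspan_def using direct_sum_space by blast
  moreover have "?op (a \<oplus>\<^bsub>A\<^esub> b) x = ?op a x + ?op b x" "?op (a \<otimes>\<^bsub>A\<^esub> b) x = ?op a (?op b x)"
    if "a \<in> carrier A" "b \<in> carrier A" "x \<in> ?K" for a b x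
    using that by (auto intro!: l2sum_eqI simp: Rep_direct_sum_op Rep_l2sum_simps coord op_in
        star_rep.op_add[OF star_rep_summand] star_rep.op_mult[OF star_rep_summand])
  moreover have "?op (c \<odot>\<^bsub>A\<^esub> a) x = c *\<^sub>C ?op a x" if "a \<in> carrier A" "x \<in> ?K" for a c x
    using that by (auto intro!: l2sum_eqI simp: Rep_direct_sum_op Rep_l2sum_scaleC coord
        star_rep.op_smult[OF star_rep_summand])
  ultimately show ?thesis
    unfolding is_rep_def using direct_sum_space PiE cinner by simp
qed

end


section \<open>The embedding of the infinite Cuntz algebra\<close>

context unital_cstar_algebra
begin

text \<open>The sum \<open>p\<close> of the first range projections satisfies \<open>p\<^sup>* = p = p\<^sup>2\<close>, so \<open>1 - p = (1 - p)\<^sup>* (1 - p)\<close> is positive.\<close>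

lemma cuntz_family_infI:
  assumes d: "\<And>i. 1 \<le> i \<Longrightarrow> d i \<in> carrier A"
    and rel: "\<And>i j. 1 \<le> i \<Longrightarrow> 1 \<le> j \<Longrightarrow> star A (d i) \<otimes> d j = (if i = j then \<one> else \<zero>)"
  shows "cuntz_family_inf A d"
proof -
  define p where "p k = (\<Oplus>j\<in>{1..k}. d j \<otimes> star A (d j))" for k
  have p_closed [simp]: "p k \<in> carrier A" for k
    unfolding p_def using d by (intro alg.finsum_closed) auto
  have p_Suc: "p (Suc k) = d (Suc k) \<otimes> star A (d (Suc k)) \<oplus> p k" for k
  proof -
    have "{1..Suc k} = insert (Suc k) {1..k}"
      by auto
    then show ?thesis
      unfolding p_def using d by (simp only:) (subst alg.finsum_insert; auto)
  qed
  have p_star: "star A (p k) = p k" for k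
  proof (induction k)
    case (Suc k)
    then show ?case
      using d[of "Suc k"] by (simp add: p_Suc star_add star_mult)
  qed (simp add: p_def)
  have p_d: "p k \<otimes> d j = \<zero>" if "k < j" for k j
    using that
  proof (induction k)
    case 0
    then show ?case
      using d[of j] by (simp add: p_def)
  next
    case (Suc k)
    then show ?case
      using d[of "Suc k"] d[of j] rel[of "Suc k" j]
      by (simp add: p_Suc alg.l_distr alg.m_assoc)
  qed
  have p_p: "p k \<otimes> p k = p k" for k
  proof (induction k)
    case (Suc k)
    let ?e = "d (Suc k) \<otimes> star A (d (Suc k))"
    have e: "?e \<in> carrier A" "?e \<otimes> ?e = ?e"
    proof -
      have "?e \<otimes> ?e = d (Suc k) \<otimes> ((star A (d (Suc k)) \<otimes> d (Suc k)) \<otimes> star A (d (Suc k)))"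
        using d[of "Suc k"] by (simp add: alg.m_assoc)
      then show "?e \<otimes> ?e = ?e"
        using d[of "Suc k"] rel[of "Suc k" "Suc k"] by simp
    qed (use d in simp)
    have pe: "p k \<otimes> ?e = \<zero>"
      using p_d[of k "Suc k"] d[of "Suc k"] by (simp flip: alg.m_assoc)
    have "star A (p k \<otimes> ?e) = ?e \<otimes> p k"
      using d[of "Suc k"] by (simp add: star_mult p_star)
    then have "?e \<otimes> p k = \<zero>"
      using pe by simp
    then show ?case
      using pe e Suc by (simp add: p_Suc alg.l_distr alg.r_distr)
  qed (simp add: p_def)
  have "cstar_le A (p k) \<one>" for k
    unfolding cstar_le_def
  proof (rule bexI[of _ "\<one> \<ominus> p k"])
    have "(\<one> \<ominus> p k) \<otimes> (\<one> \<ominus> p k) = (\<one> \<ominus> p k) \<ominus> (p k \<ominus> p k \<otimes> p k)"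
      by (simp add: a_minus_def alg.l_distr alg.r_distr alg.l_minus alg.r_minus alg.minus_add
          alg.a_ac)
    also have "\<dots> = \<one> \<ominus> p k"
      by (simp add: p_p a_minus_def alg.r_neg)
    finally show "\<one> \<ominus> p k = star A (\<one> \<ominus> p k) \<otimes> (\<one> \<ominus> p k)"
      by (simp add: star_diff p_star)
  qed simp
  then show ?thesis
    unfolding cuntz_family_inf_def p_def using d rel by auto
qed

lemma isometry_pow:
  assumes x: "x \<in> carrier A" "star A x \<otimes> x = \<one>"
  shows "star A (x [^] (k::nat)) \<otimes> x [^] k = \<one>"
proof (induction k)
  case (Suc k)
  have "star A (x [^] Suc k) \<otimes> x [^] Suc k = star A x \<otimes> ((star A (x [^] k) \<otimes> x [^] k) \<otimes> x)"
    using x(1) by (simp add: star_mult alg.m_assoc)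
  then show ?case
    using Suc x by simp
qed simp

text \<open>Orthogonality holds for the same reason as for operators: cancel the common power of \<open>r\<^sub>m\<close>. If the power
  in the adjoint factor is the larger one, pass to the adjoint of the product.\<close>

lemma cuntz_family_inf_of_family:
  assumes m: "2 \<le> m" and r: "cuntz_family m A r"
  shows "cuntz_family_inf A (\<lambda>j. r m [^] ((j - 1) div (m - 1)) \<otimes> r ((j - 1) mod (m - 1) + 1))"
    (is "cuntz_family_inf A ?d")
proof (rule cuntz_family_infI)
  have in_A [simp]: "r i \<in> carrier A" if "i \<in> {1..m}" for i
    using r that unfolding cuntz_family_def by blast
  have rel: "star A (r i) \<otimes> r j = (if i = j then \<one> else \<zero>)" if "i \<in> {1..m}" "j \<in> {1..m}" for i j
    using r that unfolding cuntz_family_def by blast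
  have "j mod (m - 1) + 1 < m" for j
    using mod_less_divisor[of "m - 1" j] m by linarith
  then have index: "j mod (m - 1) + 1 \<in> {1..m}" "j mod (m - 1) + 1 \<noteq> m" for j
    using less_imp_le by (auto simp: less_imp_neq)
  have rm: "r m \<in> carrier A" "star A (r m) \<otimes> r m = \<one>"
    using rel[of m m] m by simp_all
  show d: "?d j \<in> carrier A" for j
    using rm(1) in_A[OF index(1)] by simp
  have le: "star A (?d i) \<otimes> ?d j = (if i = j then \<one> else \<zero>)"
    if ij: "1 \<le> i" "1 \<le> j" and kl: "(i - 1) div (m - 1) \<le> (j - 1) div (m - 1)" for i j
  proof -
    define a k b l where defs: "a = (i - 1) mod (m - 1) + 1" "k = (i - 1) div (m - 1)"
      "b = (j - 1) mod (m - 1) + 1" "l = (j - 1) div (m - 1)"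
    have ab: "a \<in> {1..m}" "b \<in> {1..m}" "a \<noteq> m" "b \<noteq> m"
      unfolding defs by (rule index)+
    have "i - 1 = j - 1 \<longleftrightarrow> k = l \<and> a = b"
      unfolding defs by (metis div_mod_decomp add_right_cancel)
    then have eq: "i = j \<longleftrightarrow> k = l \<and> a = b"
      using ij by auto
    note [simp] = in_A[OF ab(1)] in_A[OF ab(2)] rm
    obtain p where p: "l = k + p"
      using kl unfolding defs by (metis le_Suc_ex)
    have "star A (?d i) \<otimes> ?d j =
        star A (r a) \<otimes> ((star A (r m [^] k) \<otimes> r m [^] k) \<otimes> (r m [^] p \<otimes> r b))"
      unfolding defs[symmetric] p by (simp add: star_mult alg.m_assoc flip: alg.nat_pow_mult)
    also have "\<dots> = star A (r a) \<otimes> (r m [^] p \<otimes> r b)"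
      by (simp add: isometry_pow)
    also have "\<dots> = (if i = j then \<one> else \<zero>)"
    proof (cases p)
      case 0
      then show ?thesis
        using p eq rel[OF ab(1,2)] by simp
    next
      case (Suc q)
      have "star A (r a) \<otimes> (r m [^] p \<otimes> r b) = (star A (r a) \<otimes> r m) \<otimes> (r m [^] q \<otimes> r b)"
        unfolding Suc by (subst alg.nat_pow_Suc2) (simp_all add: alg.m_assoc)
      also have "star A (r a) \<otimes> r m = \<zero>"
        using rel[OF ab(1), of m] ab(3) m by simp
      finally show ?thesis
        using p eq Suc by simp
    qed
    finally show ?thesis .
  qed
  fix i j :: nat assume ij: "1 \<le> i" "1 \<le> j"
  show "star A (?d i) \<otimes> ?d j = (if i = j then \<one> else \<zero>)"
  proof (cases "(i - 1) div (m - 1) \<le> (j - 1) div (m - 1)")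
    case False
    then have "star A (star A (?d j) \<otimes> ?d i) = star A (if j = i then \<one> else \<zero>)"
      using le[OF ij(2,1)] by simp
    then show ?thesis
      using d[of i] d[of j] by (simp add: star_mult split: if_splits)
  qed (rule le[OF ij])
qed

end


section \<open>The functor\<close>

locale cuntz_algebras =
  fixes n m :: nat and A :: "'a cstar" and s :: "nat \<Rightarrow> 'a"
    and B :: "'b cstar" and r :: "nat \<Rightarrow> 'b" and C :: "'c cstar" and t :: "nat \<Rightarrow> 'c"
  assumes n: "2 \<le> n" and m: "2 \<le> m" and cuntz_A: "cuntz_algebra n A s"
    and cuntz_B: "cuntz_algebra m B r" and cuntz_C: "cuntz_algebra_inf C t"
begin

sublocale A: unital_cstar_algebra A
  using cuntz_A unfolding cuntz_algebra_def by blast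

sublocale B: unital_cstar_algebra B
  using cuntz_B unfolding cuntz_algebra_def by blast

sublocale C: unital_cstar_algebra C
  using cuntz_C unfolding cuntz_algebra_inf_def by blast

lemma family_A: "cuntz_family n A s" and family_B: "cuntz_family m B r"
  and generates_A: "generates_cstar A (s ` {1..n})" and generates_B: "generates_cstar B (r ` {1..m})"
  using cuntz_A cuntz_B unfolding cuntz_algebra_def by blast+

lemma s_in [simp]: "i \<in> {1..n} \<Longrightarrow> s i \<in> carrier A" and r_in [simp]: "i \<in> {1..m} \<Longrightarrow> r i \<in> carrier B"
  using family_A family_B unfolding cuntz_family_def by blast+

lemma t_in [simp]: "t (Suc j) \<in> carrier C"
  using cuntz_C unfolding cuntz_algebra_inf_def cuntz_family_inf_def by auto

abbreviation "inclusion \<equiv> cuntz_embedding m B r C t"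

text \<open>The exponent and the index of the defining condition are quotient and remainder of \<open>j - 1\<close> by
  \<open>m - 1\<close>, so the condition prescribes the value at each generator exactly once.\<close>

lemma embed_hom: "unital_star_hom C B inclusion"
  and embed_t: "inclusion (t (Suc j)) = r m [^]\<^bsub>B\<^esub> (j div (m - 1)) \<otimes>\<^bsub>B\<^esub> r (j mod (m - 1) + 1)"
proof -
  define d where "d j = r m [^]\<^bsub>B\<^esub> ((j - 1) div (m - 1)) \<otimes>\<^bsub>B\<^esub> r ((j - 1) mod (m - 1) + 1)" for j
  have iff: "(\<forall>k. \<forall>i\<in>{1..m - 1}. f (t ((m - 1) * k + i)) = r m [^]\<^bsub>B\<^esub> k \<otimes>\<^bsub>B\<^esub> r i) \<longleftrightarrow>
      (\<forall>j\<ge>1. f (t j) = d j)" for f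
  proof (intro iffI allI impI ballI)
    fix j :: nat
    assume f: "\<forall>k. \<forall>i\<in>{1..m - 1}. f (t ((m - 1) * k + i)) = r m [^]\<^bsub>B\<^esub> k \<otimes>\<^bsub>B\<^esub> r i" and j: "1 \<le> j"
    have "(j - 1) mod (m - 1) < m - 1"
      using m by simp
    then have "(j - 1) mod (m - 1) + 1 \<in> {1..m - 1}"
      by simp
    moreover have "(m - 1) * ((j - 1) div (m - 1)) + ((j - 1) mod (m - 1) + 1) = j"
      using j by (simp flip: add.assoc)
    ultimately show "f (t j) = d j"
      using f unfolding d_def by metis
  next
    fix k i assume f: "\<forall>j\<ge>1. f (t j) = d j" and i: "i \<in> {1..m - 1}"
    have *: "(m - 1) * k + i - 1 = (m - 1) * k + (i - 1)" "i - 1 < m - 1"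
      using i by auto
    have "(p * k + q) div p = k" "(p * k + q) mod p = q" if "q < p" for p q :: nat
      using that by simp_all
    from this[OF *(2)]
    have "((m - 1) * k + i - 1) div (m - 1) = k" "((m - 1) * k + i - 1) mod (m - 1) = i - 1"
      unfolding *(1) by blast+
    moreover have "i - 1 + 1 = i"
      using i by simp
    moreover have "1 \<le> (m - 1) * k + i"
      using i by simp
    ultimately show "f (t ((m - 1) * k + i)) = r m [^]\<^bsub>B\<^esub> k \<otimes>\<^bsub>B\<^esub> r i"
      using f unfolding d_def by metis
  qed
  have "cuntz_family_inf B d"
    unfolding d_def[abs_def] by (rule B.cuntz_family_inf_of_family[OF m family_B])
  from cuntz_algebra_inf_universal[OF cuntz_C cuntz_B this]
  have "unital_star_hom C B inclusion \<and> (\<forall>j\<ge>1. inclusion (t j) = d j)"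
    unfolding cuntz_embedding_def iff by (rule theI')
  then show "unital_star_hom C B inclusion"
    "inclusion (t (Suc j)) = r m [^]\<^bsub>B\<^esub> (j div (m - 1)) \<otimes>\<^bsub>B\<^esub> r (j mod (m - 1) + 1)"
    unfolding d_def by simp_all
qed

abbreviation rep_family :: "('b, 'h::chilbert_space) rep \<Rightarrow> nat \<Rightarrow> 'h \<Rightarrow> 'h" where
  "rep_family \<pi> \<equiv> (\<lambda>i. rep_op \<pi> (r i))"

abbreviation rep_cofamily :: "('b, 'h::chilbert_space) rep \<Rightarrow> nat \<Rightarrow> 'h \<Rightarrow> 'h" where
  "rep_cofamily \<pi> \<equiv> (\<lambda>i. rep_op \<pi> (star B (r i)))"

abbreviation transferred :: "('b, 'h::chilbert_space) rep \<Rightarrow> nat \<Rightarrow> 'h \<Rightarrow> 'h" where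
  "transferred \<pi> \<equiv> transfer_family m n (rep_family \<pi>) (rep_cofamily \<pi>)"

abbreviation cotransferred :: "('b, 'h::chilbert_space) rep \<Rightarrow> nat \<Rightarrow> 'h \<Rightarrow> 'h" where
  "cotransferred \<pi> \<equiv> transfer_cofamily m n (rep_family \<pi>) (rep_cofamily \<pi>)"

text \<open>The condition covers the generators only; on their adjoints the values are then given by the
  adjoint family, see \<open>corresponds_adjoint\<close>.\<close>

definition corresponds :: "('b, 'h::chilbert_space) rep \<Rightarrow> ('a, 'h) rep \<Rightarrow> bool" where
  "corresponds \<pi> \<pi>' \<longleftrightarrow> is_rep B \<pi> \<and> is_rep A \<pi>' \<and> rep_space \<pi>' = rep_space \<pi> \<and>
    (\<forall>i\<in>{1..n}. \<forall>x\<in>rep_space \<pi>.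
      rep_op \<pi>' (s i) x = transferred \<pi> i x)"

lemma corresponds_op:
  assumes "corresponds \<pi> \<pi>'" "i \<in> {1..n}" "x \<in> rep_space \<pi>"
  shows "rep_op \<pi>' (s i) x = transferred \<pi> i x"
  using assms unfolding corresponds_def by blast

lemma op_cuntz_rep_family:
  assumes "is_rep B \<pi>"
  shows "op_cuntz (rep_space \<pi>) m (rep_family \<pi>) (rep_cofamily \<pi>)"
proof -
  interpret star_rep B \<pi>
    by unfold_locales fact
  show ?thesis
    by unfold_locales (rule space m op_cuntz_rep[OF family_B])+
qed

text \<open>On \<open>H\<close>, the images of the generators of the infinite Cuntz algebra are the isometries of the Wold
  decomposition, so the formula of the functor is the one for the transferred family. This
  is a Cuntz family of operators, so it extends to a representation by the universal property, and the
  extension is unique because representations are determined on generators.\<close>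

lemma corresponds_functor:
  assumes "is_rep B \<pi>"
  shows "corresponds \<pi> (cuntz_functor n m A s B r C t \<pi>)"
proof -
  interpret \<pi>: star_rep B \<pi>
    by unfold_locales fact
  interpret R: op_cuntz \<pi>.H m "rep_family \<pi>" "rep_cofamily \<pi>"
    by (rule op_cuntz_rep_family[OF assms])
  let ?S = "transferred \<pi>"
  let ?S' = "cotransferred \<pi>"
  have hom: "x \<in> carrier C \<Longrightarrow> inclusion x \<in> carrier B"
    "x \<in> carrier C \<Longrightarrow> y \<in> carrier C \<Longrightarrow> inclusion (x \<otimes>\<^bsub>C\<^esub> y) = inclusion x \<otimes>\<^bsub>B\<^esub> inclusion y"
    "x \<in> carrier C \<Longrightarrow> inclusion (star C x) = star B (inclusion x)" for x y
    using embed_hom unfolding unital_star_hom_def ring_hom_def by auto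
  have rm: "r m \<in> carrier B"
    using m by simp
  have pow: "\<pi>.op (r m [^]\<^bsub>B\<^esub> k) x = (\<pi>.op (r m) ^^ k) x" if "x \<in> \<pi>.H" for k :: nat and x
    using that
    by (induction k arbitrary: x) (simp_all add: \<pi>.op_one \<pi>.op_mult rm funpow_swap1)
  have T: "\<pi>.op (inclusion (t (Suc j))) x = R.T j x" if "x \<in> \<pi>.H" for j x
  proof -
    have "r (j mod (m - 1) + 1) \<in> carrier B"
      using R.index_in by simp
    then show ?thesis
      using that unfolding embed_t iter_isometry_def by (simp add: \<pi>.op_mult pow rm)
  qed
  have T': "\<pi>.op (star B (inclusion (t (Suc j)))) x = R.T' j x" if "x \<in> \<pi>.H" for j x
    by (rule adjoint_on_unique[OF \<pi>.space \<pi>.adjoint_op R.adjoint_T]) (use that T hom(1) in auto)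
  have TT': "\<pi>.op (inclusion (t (Suc i) \<otimes>\<^bsub>C\<^esub> star C (t (Suc j)))) x = R.T i (R.T' j x)"
    if "x \<in> \<pi>.H" for i j x
    using that by (simp add: hom \<pi>.op_mult T T')
  \<comment> \<open>The generators are numbered from \<open>1\<close>, the isometries from \<open>0\<close>.\<close>
  have index: "Suc j + n - 1 = Suc (j + (n - 1))" for j
    using n by simp
  define V where "V = (\<lambda>x\<in>\<pi>.H. \<pi>.op (r m)
      (x - (\<Sum>j. \<pi>.op (inclusion (t (Suc j) \<otimes>\<^bsub>C\<^esub> star C (t (Suc j)))) x)) +
      (\<Sum>j. \<pi>.op (inclusion (t (Suc j + n - 1) \<otimes>\<^bsub>C\<^esub> star C (t (Suc j)))) x))"
  have V: "V = restrict (?S n) \<pi>.H"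
    unfolding V_def index
    by (intro restrict_ext)
      (simp add: TT' transfer_family_def wold_family_def wold_unitary_def shift_series_def)
  have S_lower: "\<pi>.op (inclusion (t i)) = restrict (?S i) \<pi>.H" if "i \<in> {1..n - 1}" for i
  proof -
    obtain j where j: "i = Suc j" "i \<noteq> n"
      using \<open>i \<in> {1..n - 1}\<close> n by (cases i) auto
    show ?thesis
    proof (rule extensionalityI)
      show "\<pi>.op (inclusion (t i)) \<in> extensional \<pi>.H"
        using \<pi>.op_bounded_ops[of "inclusion (t i)"] hom(1) j unfolding bounded_ops_def by auto
    qed (use j in \<open>auto simp: T transfer_family_def wold_family_def\<close>)
  qed
  define is_image where "is_image \<pi>' \<longleftrightarrow> is_rep A \<pi>' \<and> rep_space \<pi>' = \<pi>.H \<and>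
      (\<forall>i\<in>{1..n - 1}. rep_op \<pi>' (s i) = \<pi>.op (inclusion (t i))) \<and> rep_op \<pi>' (s n) = V" for \<pi>'
  have image: "rep_op \<pi>' (s i) x = ?S i x" if "is_image \<pi>'" "i \<in> {1..n}" "x \<in> \<pi>.H" for \<pi>' i x
    using that V S_lower unfolding is_image_def by (cases "i = n") auto
  interpret S: op_cuntz \<pi>.H n ?S ?S'
    by (rule R.op_cuntz_transfer[OF n])
  have "cuntz_family n (adjointable_algebra \<pi>.H) (\<lambda>i. restrict (?S i) \<pi>.H)"
    by (rule cuntz_family_adjointable[OF \<pi>.space S.family]) (simp add: S.norm_R)
  from cuntz_algebra_universal[OF cuntz_A unital_cstar_algebra_adjointable[OF \<pi>.space] this]
  obtain f where f: "unital_star_hom A (adjointable_algebra \<pi>.H) f"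
    "\<And>i. i \<in> {1..n} \<Longrightarrow> f (s i) = restrict (?S i) \<pi>.H"
    by blast
  have "f (s i) = \<pi>.op (inclusion (t i))" if "i \<in> {1..n - 1}" for i
    using that f(2)[of i] S_lower[OF that] by auto
  then have existence: "is_image \<lparr>rep_space = \<pi>.H, rep_op = f\<rparr>"
    unfolding is_image_def
    using is_repI[OF A.unital_cstar_algebra_axioms \<pi>.space f(1)] n f(2)[of n] by (simp add: V)
  have unique: "\<pi>1 = \<pi>2" if im: "is_image \<pi>1" "is_image \<pi>2" for \<pi>1 \<pi>2
  proof (rule rep_eqI[OF A.unital_cstar_algebra_axioms generates_A])
    show "is_rep A \<pi>1" "is_rep A \<pi>2" "rep_space \<pi>1 = rep_space \<pi>2"
      using im unfolding is_image_def by simp_all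
    fix a x assume "a \<in> s ` {1..n}" and x: "x \<in> rep_space \<pi>1"
    then obtain i where i: "a = s i" "i \<in> {1..n}"
      by blast
    have "x \<in> \<pi>.H"
      using x im(1) unfolding is_image_def by simp
    then show "rep_op \<pi>1 a x = rep_op \<pi>2 a x"
      unfolding i(1) using image[OF im(1) i(2)] image[OF im(2) i(2)] by simp
  qed
  have "is_image (THE \<pi>'. is_image \<pi>')"
    by (rule theI[where P = is_image, OF existence]) (rule unique[OF _ existence])
  moreover have "(THE \<pi>'. is_image \<pi>') = cuntz_functor n m A s B r C t \<pi>"
    unfolding cuntz_functor_def Let_def is_image_def V_def ..
  ultimately have "is_image (cuntz_functor n m A s B r C t \<pi>)"
    by simp
  then show ?thesis
    using assms image unfolding corresponds_def by (simp add: is_image_def)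
qed

lemma corresponds_adjoint:
  assumes "corresponds \<pi> \<pi>'" "i \<in> {1..n}" "x \<in> rep_space \<pi>"
  shows "rep_op \<pi>' (star A (s i)) x = cotransferred \<pi> i x"
proof -
  interpret R: op_cuntz "rep_space \<pi>" m "rep_family \<pi>" "rep_cofamily \<pi>"
    by (rule op_cuntz_rep_family) (use assms(1) in \<open>simp add: corresponds_def\<close>)
  interpret S: op_cuntz "rep_space \<pi>" n "transferred \<pi>"
    "cotransferred \<pi>"
    by (rule R.op_cuntz_transfer[OF n])
  interpret \<pi>': star_rep A \<pi>'
    by unfold_locales (use assms(1) in \<open>simp add: corresponds_def\<close>)
  have H: "\<pi>'.H = rep_space \<pi>"
    using assms(1) unfolding corresponds_def by blast
  show ?thesis
    by (rule adjoint_on_unique[OF R.space \<pi>'.adjoint_op[OF s_in[OF assms(2)], unfolded H]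
          S.adjoint_R[OF assms(2)]])
      (use assms in \<open>auto simp: corresponds_def\<close>)
qed

text \<open>One direction transfers from \<open>m\<close> to \<open>n\<close>, the other one back from \<open>n\<close> to \<open>m\<close>.\<close>

lemma intertwines_iff:
  assumes \<pi>: "corresponds \<pi> \<pi>'" and \<sigma>: "corresponds \<sigma> \<sigma>'"
    and G: "bounded_map (rep_space \<pi>) (rep_space \<sigma>) G"
  shows "intertwines B \<pi> \<sigma> G \<longleftrightarrow> intertwines A \<pi>' \<sigma>' G"
proof -
  have reps: "is_rep B \<pi>" "is_rep B \<sigma>" "is_rep A \<pi>'" "is_rep A \<sigma>'"
    and spaces: "rep_space \<pi>' = rep_space \<pi>" "rep_space \<sigma>' = rep_space \<sigma>"
    using \<pi> \<sigma> unfolding corresponds_def by blast+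
  interpret R: op_cuntz "rep_space \<pi>" m "rep_family \<pi>" "rep_cofamily \<pi>"
    by (rule op_cuntz_rep_family[OF reps(1)])
  interpret Z: op_cuntz "rep_space \<sigma>" m "rep_family \<sigma>" "rep_cofamily \<sigma>"
    by (rule op_cuntz_rep_family[OF reps(2)])
  have G_in: "G x \<in> rep_space \<sigma>" if "x \<in> rep_space \<pi>" for x
    using bounded_map_in[OF R.space G that] .
  note \<pi>'_op = corresponds_op[OF \<pi>] corresponds_adjoint[OF \<pi>]
    and \<sigma>'_op = corresponds_op[OF \<sigma>] corresponds_adjoint[OF \<sigma>]
  show ?thesis
  proof
    assume int: "intertwines B \<pi> \<sigma> G"
    have eq: "G (rep_op \<pi> b x) = rep_op \<sigma> b (G x)" if "b \<in> carrier B" "x \<in> rep_space \<pi>" for b x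
      using int that unfolding intertwines_def by blast
    note transfer = transfer_intertwines[OF R.op_cuntz_axioms Z.op_cuntz_axioms G]
    show "intertwines A \<pi>' \<sigma>' G"
    proof (rule rep_intertwines[OF A.unital_cstar_algebra_axioms generates_A reps(3,4)])
      show "bounded_map (rep_space \<pi>') (rep_space \<sigma>') G"
        using G spaces by simp
      fix a x assume "a \<in> s ` {1..n}" "x \<in> rep_space \<pi>'"
      then obtain i where i: "a = s i" "i \<in> {1..n}" and x: "x \<in> rep_space \<pi>"
        using spaces by auto
      show "G (rep_op \<pi>' a x) = rep_op \<sigma>' a (G x)"
        unfolding i(1) \<pi>'_op(1)[OF i(2) x] \<sigma>'_op(1)[OF i(2) G_in[OF x]]
        by (rule transfer(1)) (simp_all add: eq x)
      show "G (rep_op \<pi>' (star A a) x) = rep_op \<sigma>' (star A a) (G x)"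
        unfolding i(1) \<pi>'_op(2)[OF i(2) x] \<sigma>'_op(2)[OF i(2) G_in[OF x]]
        by (rule transfer(2)) (simp_all add: eq x)
    qed
  next
    assume int: "intertwines A \<pi>' \<sigma>' G"
    have eq: "G (rep_op \<pi>' a x) = rep_op \<sigma>' a (G x)" if "a \<in> carrier A" "x \<in> rep_space \<pi>" for a x
      using int that spaces unfolding intertwines_def by blast
    have S: "G (transferred \<pi> i x) = transferred \<sigma> i (G x)"
      "G (cotransferred \<pi> i x) = cotransferred \<sigma> i (G x)"
      if "i \<in> {1..n}" "x \<in> rep_space \<pi>" for i x
      using eq[OF s_in[OF that(1)] that(2)] eq[OF A.star_closed[OF s_in[OF that(1)]] that(2)]
      unfolding \<pi>'_op[OF that] \<sigma>'_op[OF that(1) G_in[OF that(2)]] .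
    have transfer: "G (transfer_family n m (transferred \<pi>) (cotransferred \<pi>) i x) =
        transfer_family n m (transferred \<sigma>) (cotransferred \<sigma>) i (G x)"
      "G (transfer_cofamily n m (transferred \<pi>) (cotransferred \<pi>) i x) =
        transfer_cofamily n m (transferred \<sigma>) (cotransferred \<sigma>) i (G x)"
      if "x \<in> rep_space \<pi>" for i x
      by (rule transfer_intertwines[OF R.op_cuntz_transfer[OF n] Z.op_cuntz_transfer[OF n] G];
          (rule S that; assumption?))+
    show "intertwines B \<pi> \<sigma> G"
    proof (rule rep_intertwines[OF B.unital_cstar_algebra_axioms generates_B reps(1,2) G])
      fix b x assume "b \<in> r ` {1..m}" and x: "x \<in> rep_space \<pi>"
      then obtain i where i: "b = r i" "i \<in> {1..m}"
        by auto
      show "G (rep_op \<pi> b x) = rep_op \<sigma> b (G x)"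
        using transfer(1)[OF x, of i] x i
        by (simp only: R.transfer_transfer[OF n] Z.transfer_transfer[OF n] G_in)
      show "G (rep_op \<pi> (star B b) x) = rep_op \<sigma> (star B b) (G x)"
        using transfer(2)[OF x, of i] x i
        by (simp only: R.transfer_transfer[OF n] Z.transfer_transfer[OF n] G_in)
    qed
  qed
qed

lemma op_cuntz_subspace:
  assumes "op_cuntz H k S S'" "hilbert_subspace K" "K \<subseteq> H"
    and "\<And>i. i \<in> {1..k} \<Longrightarrow> S i ` K \<subseteq> K \<and> S' i ` K \<subseteq> K"
  shows "op_cuntz K k S S'"
proof -
  interpret op_cuntz H k S S' by fact
  have "adjoint_on K (S i) (S' i)" if "i \<in> {1..k}" for i
    using adjoint_R[OF that] assms(3) assms(4)[OF that] unfolding adjoint_on_def by blast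
  moreover have "S' i (S j x) = (if i = j then x else 0)" if "i \<in> {1..k}" "j \<in> {1..k}" "x \<in> K" for i j x
    using R'_R[OF that(1,2)] that(3) assms(3) by blast
  moreover have "(\<Sum>i\<in>{1..k}. S i (S' i x)) = x" if "x \<in> K" for x
    using sum_R_R' that assms(3) by blast
  ultimately have "op_cuntz_family K k S S'"
    unfolding op_cuntz_family_def by blast
  then show ?thesis
    using assms(2) m by unfold_locales
qed

text \<open>A family that leaves \<open>K\<close> invariant together with its adjoints is a Cuntz family on \<open>K\<close>. Its transfer on \<open>K\<close> is
  given by the same functions as on the whole space, and these therefore map \<open>K\<close> into itself.\<close>

lemma invariant_iff:
  assumes cor: "corresponds \<pi> \<pi>'" and K: "hilbert_subspace K" "K \<subseteq> rep_space \<pi>"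
  shows "(\<forall>b\<in>carrier B. rep_op \<pi> b ` K \<subseteq> K) \<longleftrightarrow> (\<forall>a\<in>carrier A. rep_op \<pi>' a ` K \<subseteq> K)"
proof -
  let ?R = "rep_family \<pi>" and ?R' = "rep_cofamily \<pi>"
  let ?S = "transferred \<pi>" and ?S' = "cotransferred \<pi>"
  interpret \<pi>: star_rep B \<pi>
    by unfold_locales (use cor in \<open>simp add: corresponds_def\<close>)
  interpret \<pi>': star_rep A \<pi>'
    by unfold_locales (use cor in \<open>simp add: corresponds_def\<close>)
  have H: "\<pi>'.H = \<pi>.H"
    using cor unfolding corresponds_def by blast
  interpret R: op_cuntz \<pi>.H m ?R ?R'
    by (rule op_cuntz_rep_family) (rule \<pi>.rep)
  have \<pi>'_op: "rep_op \<pi>' (s i) x = ?S i x" "rep_op \<pi>' (star A (s i)) x = ?S' i x"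
    if "i \<in> {1..n}" "x \<in> K" for i x
    using corresponds_op[OF cor that(1)] corresponds_adjoint[OF cor that(1)] that(2) K(2) by blast+
  show ?thesis
  proof
    assume inv: "\<forall>b\<in>carrier B. rep_op \<pi> b ` K \<subseteq> K"
    interpret RK: op_cuntz K m ?R ?R'
      by (rule op_cuntz_subspace[OF R.op_cuntz_axioms K]) (use inv in auto)
    interpret SK: op_cuntz K n ?S ?S'
      by (rule RK.op_cuntz_transfer[OF n])
    have "rep_op \<pi>' (s i) ` K \<subseteq> K \<and> rep_op \<pi>' (star A (s i)) ` K \<subseteq> K" if "i \<in> {1..n}" for i
      using \<pi>'_op[OF that] SK.R_in[OF that] SK.R'_in[OF that] by (simp add: image_subset_iff)
    then show "\<forall>a\<in>carrier A. rep_op \<pi>' a ` K \<subseteq> K"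
      using \<pi>'.op_invariant[OF generates_A K(1)] K(2) H by blast
  next
    assume inv: "\<forall>a\<in>carrier A. rep_op \<pi>' a ` K \<subseteq> K"
    have "?S i ` K \<subseteq> K \<and> ?S' i ` K \<subseteq> K" if "i \<in> {1..n}" for i
    proof -
      have "rep_op \<pi>' (s i) ` K \<subseteq> K" "rep_op \<pi>' (star A (s i)) ` K \<subseteq> K"
        using inv s_in[OF that] A.star_closed by blast+
      then show ?thesis
        using \<pi>'_op[OF that] by (simp add: image_subset_iff)
    qed
    then interpret SK: op_cuntz K n ?S ?S'
      by (intro op_cuntz_subspace[OF R.op_cuntz_transfer[OF n] K])
    interpret RK: op_cuntz K m "transfer_family n m ?S ?S'" "transfer_cofamily n m ?S ?S'"
      by (rule SK.op_cuntz_transfer[OF m])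
    have "rep_op \<pi> (r i) ` K \<subseteq> K \<and> rep_op \<pi> (star B (r i)) ` K \<subseteq> K" if "i \<in> {1..m}" for i
      using RK.R_in[OF that] RK.R'_in[OF that] R.transfer_transfer[OF n that] K(2)
      by (simp add: image_subset_iff subsetD[OF K(2)])
    then show "\<forall>b\<in>carrier B. rep_op \<pi> b ` K \<subseteq> K"
      using \<pi>.op_invariant[OF generates_B K] by blast
  qed
qed

text \<open>The coordinate maps intertwine the family of the direct sum with those of the summands, so
  they also intertwine the transferred families: the transfer is computed coordinatewise.\<close>

lemma corresponds_direct_sum:
  assumes "\<And>l. l \<in> L \<Longrightarrow> corresponds (\<rho> l) (\<rho>' l)"
  shows "corresponds (rep_direct_sum B L \<rho>) (rep_direct_sum A L \<rho>')"
proof -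
  let ?\<sigma> = "rep_direct_sum B L \<rho>" and ?\<sigma>' = "rep_direct_sum A L \<rho>'"
  let ?S = "transferred ?\<sigma>"
  let ?S' = "cotransferred ?\<sigma>"
  have reps: "is_rep B (\<rho> l)" "is_rep A (\<rho>' l)" and spaces: "rep_space (\<rho>' l) = rep_space (\<rho> l)"
    if "l \<in> L" for l
    using assms[OF that] unfolding corresponds_def by blast+
  note dsB = is_rep_direct_sum[OF B.unital_cstar_algebra_axioms reps(1)]
    Rep_direct_sum_op[OF B.unital_cstar_algebra_axioms reps(1)]
    direct_sum_space_iff[OF B.unital_cstar_algebra_axioms reps(1)]
  note dsA = is_rep_direct_sum[OF A.unital_cstar_algebra_axioms reps(2)]
    Rep_direct_sum_op[OF A.unital_cstar_algebra_axioms reps(2)]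
    direct_sum_space_iff[OF A.unital_cstar_algebra_axioms reps(2)]
  have space: "rep_space ?\<sigma>' = rep_space ?\<sigma>"
    using spaces by (auto simp: dsA(3) dsB(3))
  interpret R: op_cuntz "rep_space ?\<sigma>" m "rep_family ?\<sigma>" "rep_cofamily ?\<sigma>"
    by (rule op_cuntz_rep_family[OF dsB(1)])
  interpret S: op_cuntz "rep_space ?\<sigma>" n ?S
    ?S'
    by (rule R.op_cuntz_transfer[OF n])
  have "rep_op ?\<sigma>' (s i) x = ?S i x"
    if i: "i \<in> {1..n}" and x: "x \<in> rep_space ?\<sigma>" for i x
  proof (rule l2sum_eqI)
    fix l
    show "Rep_l2sum (rep_op ?\<sigma>' (s i) x) l =
        Rep_l2sum (?S i x) l"
    proof (cases "l \<in> L")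
      case True
      have x_l: "Rep_l2sum x l \<in> rep_space (\<rho> l)"
        using x True by (simp add: dsB(3))
      have coord: "bounded_map (rep_space ?\<sigma>) (rep_space (\<rho> l)) (\<lambda>x. Rep_l2sum x l)"
        by (rule bounded_map_coordinate) (use True in \<open>simp add: dsB(3)\<close>)
      have "Rep_l2sum (?S i x) l =
          transferred (\<rho> l) i (Rep_l2sum x l)"
        by (rule transfer_intertwines(1)[OF R.op_cuntz_axioms
              op_cuntz_rep_family[OF reps(1)[OF True]] coord])
          (use True x in \<open>simp_all add: dsB(2)\<close>)
      also have "\<dots> = rep_op (\<rho>' l) (s i) (Rep_l2sum x l)"
        using assms[OF True] i x_l unfolding corresponds_def by simp
      finally show ?thesis
        using True i x space by (simp add: dsA(2))
    next
      case False
      then show ?thesis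
        using S.R_in[OF i x] i x space by (simp add: dsA(2) dsB(3))
    qed
  qed
  moreover have "is_rep B ?\<sigma>" "is_rep A ?\<sigma>'"
    by (rule dsB(1), assumption, rule dsA(1))
  ultimately show ?thesis
    unfolding corresponds_def using space by simp
qed

end


section \<open>Von Neumann algebras\<close>

lemma commutant_rep_iff:
  assumes "unital_cstar_algebra A" "is_rep A \<pi>"
  shows "T \<in> commutant (rep_space \<pi>) (rep_op \<pi> ` carrier A) \<longleftrightarrow>
    T \<in> bounded_ops (rep_space \<pi>) \<and> intertwines A \<pi> \<pi> T"
proof -
  interpret unital_cstar_algebra A by fact
  interpret star_rep A \<pi> by unfold_locales fact
  have "compose H T (op a) = compose H (op a) T \<longleftrightarrow> (\<forall>x\<in>H. T (op a x) = op a (T x))" for a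
    by (auto simp: compose_def fun_eq_iff)
  then show ?thesis
    unfolding commutant_def intertwines_def by blast
qed

text \<open>An element of \<open>Y\<close> commutes with the commutant of \<open>Y\<close>, which is that of \<open>X\<close> and thus contains the commutant of
  \<open>M\<close>; so it belongs to the bicommutant of \<open>M\<close>.\<close>

lemma vn_subset_of_commutant_eq:
  assumes M: "von_neumann_algebra H M" and Y: "Y \<subseteq> bounded_ops H"
    and eq: "commutant H X = commutant H Y" and X: "X \<subseteq> M"
  shows "Y \<subseteq> M"
proof
  fix y assume y: "y \<in> Y"
  have "compose H y T = compose H T y" if T: "T \<in> commutant H M" for T
  proof -
    have "T \<in> commutant H X"
      using T X unfolding commutant_def by blast
    then have "T \<in> commutant H Y"
      using eq by simp
    then have "compose H T y = compose H y T"
      using y unfolding commutant_def by blast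
    then show ?thesis
      by simp
  qed
  then have "y \<in> commutant H (commutant H M)"
    using y Y unfolding commutant_def[of H "commutant H M"] by blast
  then show "y \<in> M"
    using M unfolding von_neumann_algebra_def by blast
qed

lemma vn_generated_cong:
  assumes "X \<subseteq> bounded_ops H" "Y \<subseteq> bounded_ops H" "commutant H X = commutant H Y"
  shows "vn_generated H X = vn_generated H Y"
  unfolding vn_generated_def
  using vn_subset_of_commutant_eq[OF _ assms(2,3)] vn_subset_of_commutant_eq[OF _ assms(1) assms(3)[symmetric]]
  by blast

lemma (in cuntz_algebras) rep_vn_eq:
  assumes "corresponds \<pi> \<pi>'"
  shows "rep_vn A \<pi>' = rep_vn B \<pi>"
proof -
  have reps: "is_rep B \<pi>" "is_rep A \<pi>'" and H: "rep_space \<pi>' = rep_space \<pi>"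
    using assms unfolding corresponds_def by blast+
  interpret \<pi>: star_rep B \<pi> by unfold_locales fact
  interpret \<pi>': star_rep A \<pi>' by unfold_locales fact
  have "commutant \<pi>.H (rep_op \<pi>' ` carrier A) = commutant \<pi>.H (rep_op \<pi> ` carrier B)"
  proof (rule Set.set_eqI)
    fix T
    show "T \<in> commutant \<pi>.H (rep_op \<pi>' ` carrier A) \<longleftrightarrow> T \<in> commutant \<pi>.H (rep_op \<pi> ` carrier B)"
      using commutant_rep_iff[OF B.unital_cstar_algebra_axioms reps(1), of T]
        commutant_rep_iff[OF A.unital_cstar_algebra_axioms reps(2), of T, unfolded H]
        intertwines_iff[OF assms assms, of T] bounded_ops_iff by blast
  qed
  then show ?thesis
    unfolding rep_vn_def H
    using \<pi>.op_bounded_ops \<pi>'.op_bounded_ops H by (intro vn_generated_cong) auto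
qed

section \<open>Factors, types, irreducibility and direct sums\<close>

theorem corollary1p2:
  fixes n m :: nat
    and A :: "'a cstar" and s :: "nat \<Rightarrow> 'a"
    and B :: "'b cstar" and r :: "nat \<Rightarrow> 'b"
    and C :: "'c cstar" and t :: "nat \<Rightarrow> 'c"
    and \<pi> :: "('b, 'h::chilbert_space) rep" and \<pi>' :: "('a, 'h) rep"
  assumes "2 \<le> n" and "2 \<le> m"
    and "cuntz_algebra n A s" and "cuntz_algebra m B r" and "cuntz_algebra_inf C t"
    and "is_rep B \<pi>"
    and "\<pi>' = cuntz_functor n m A s B r C t \<pi>"
  shows "(factor_rep B \<pi> \<longleftrightarrow> factor_rep A \<pi>') \<and>
    (\<forall>X. rep_has_type X B \<pi> \<longleftrightarrow> rep_has_type X A \<pi>') \<and>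
    (irreducible_rep B \<pi> \<longleftrightarrow> irreducible_rep A \<pi>') \<and>
    (\<forall>(L :: 'i set) (\<rho> :: 'i \<Rightarrow> ('b, 'k::chilbert_space) rep) \<rho>'.
      (\<forall>l\<in>L. is_rep B (\<rho> l)) \<and> (\<forall>l\<in>L. \<rho>' l = cuntz_functor n m A s B r C t (\<rho> l)) \<longrightarrow>
      (\<forall>U. unitary_between (rep_space \<pi>) (rep_space (rep_direct_sum B L \<rho>)) U \<longrightarrow>
        (intertwines B \<pi> (rep_direct_sum B L \<rho>) U \<longleftrightarrow>
         intertwines A \<pi>' (rep_direct_sum A L \<rho>') U)) \<and>
      (unitarily_equivalent B \<pi> (rep_direct_sum B L \<rho>) \<longleftrightarrow>
       unitarily_equivalent A \<pi>' (rep_direct_sum A L \<rho>')))"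
proof (intro conjI allI impI)
  interpret cuntz_algebras n m A s B r C t
    using assms by unfold_locales
  have cor: "corresponds \<pi> \<pi>'"
    unfolding assms(7) by (rule corresponds_functor[OF assms(6)])
  then have H: "rep_space \<pi>' = rep_space \<pi>"
    unfolding corresponds_def by blast
  have vn: "rep_vn A \<pi>' = rep_vn B \<pi>"
    by (rule rep_vn_eq[OF cor])
  show "factor_rep B \<pi> \<longleftrightarrow> factor_rep A \<pi>'"
    unfolding factor_rep_def vn H ..
  show "rep_has_type X B \<pi> \<longleftrightarrow> rep_has_type X A \<pi>'" for X
    unfolding rep_has_type_def vn H ..
  show "irreducible_rep B \<pi> \<longleftrightarrow> irreducible_rep A \<pi>'"
    unfolding irreducible_rep_def H by (simp add: invariant_iff[OF cor] cong: conj_cong)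
  fix L :: "'i set" and \<rho> :: "'i \<Rightarrow> ('b, 'k) rep" and \<rho>'
  assume \<rho>: "(\<forall>l\<in>L. is_rep B (\<rho> l)) \<and> (\<forall>l\<in>L. \<rho>' l = cuntz_functor n m A s B r C t (\<rho> l))"
  have cor_sum: "corresponds (rep_direct_sum B L \<rho>) (rep_direct_sum A L \<rho>')"
    by (rule corresponds_direct_sum) (use \<rho> corresponds_functor in auto)
  show int: "intertwines B \<pi> (rep_direct_sum B L \<rho>) U \<longleftrightarrow> intertwines A \<pi>' (rep_direct_sum A L \<rho>') U"
    if "unitary_between (rep_space \<pi>) (rep_space (rep_direct_sum B L \<rho>)) U" for U
    by (rule intertwines_iff[OF cor cor_sum bounded_map_unitary[OF that]])
  have "rep_space (rep_direct_sum A L \<rho>') = rep_space (rep_direct_sum B L \<rho>)"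
    using cor_sum unfolding corresponds_def by blast
  then show "unitarily_equivalent B \<pi> (rep_direct_sum B L \<rho>) \<longleftrightarrow>
      unitarily_equivalent A \<pi>' (rep_direct_sum A L \<rho>')"
    unfolding unitarily_equivalent_def H using int by auto
qed

end
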